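(* Let $\psi: \mathbb{N} \rightarrow [0,\infty)$ be a function. Assume that $$\sum_{n=1}^\infty \frac{\psi(n) \varphi(n)}{n} = \infty.$$ Assume additionally that there exists a constant $\eta > 0$ such that $$ \sum_{2^h < n \leq 2^h h^\eta} \frac{\psi(n) \varphi(n)}{n} \ll \frac{1}{\log \log h} $$ for all positive integers $h$, with an implied constant independent of $h$. Then $\lambda(W(\psi))=1$.
   Context: $\mathbb{N}$ is the set of positive integers, $\varphi$ is the Euler totient function, and $\lambda$ is Lebesgue measure. Convention: $\log x$ is understood as $\max(1,\log x)$ (also in iterated logarithms), so that all logarithms and iterated logarithms are positive and well-defined. $A \ll B$ means $A \le C B$ for some constant $C>0$. For a function $\psi:\mathbb{N}\to[0,\infty)$ and $n \in \mathbb{N}$, define the set $\mathcal{E}_n \subset \mathbb{R}/\mathbb{Z}$ by $$\mathcal{E}_n := \bigcup_{\substack{1 \leq a \leq n,\\ \gcd(a,n)=1}} \left( \frac{a - \psi(n)}{n},\frac{a+\psi(n)}{n} \right),$$ and let $W(\psi)$ be the set of those $x \in [0,1]$ which are contained (modulo 1) in infinitely many of the sets $\mathcal{E}_n$. *)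

theory Defs
  imports "HOL-Analysis.Analysis" "HOL-Number_Theory.Number_Theory"
begin

text \<open>Convention: every logarithm is truncated from below at 1, also inside iterated
  logarithms, so that \<open>log log h\<close> reads \<open>tlog (tlog h)\<close>.\<close>

definition tlog :: "real \<Rightarrow> real" where
  "tlog x = max 1 (ln x)"

text \<open>A representative in the reals of a subset of the circle \<open>\<real>/\<int>\<close>: the intervals
  are not cut off at 0 and 1, and membership is to be understood modulo 1. The sets are only
  relevant for \<open>n \<ge> 1\<close>.\<close>

definition approx_set :: "(nat \<Rightarrow> real) \<Rightarrow> nat \<Rightarrow> real set" where
  "approx_set \<psi> n =
     (\<Union>a\<in>{a::nat. 1 \<le> a \<and> a \<le> n \<and> gcd a n = 1}.
        {(real a - \<psi> n) / real n <..< (real a + \<psi> n) / real n})"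

definition in_mod1 :: "real \<Rightarrow> real set \<Rightarrow> bool" where
  "in_mod1 x A \<longleftrightarrow> (\<exists>k::int. x + of_int k \<in> A)"

definition approx_limsup :: "(nat \<Rightarrow> real) \<Rightarrow> real set" where
  "approx_limsup \<psi> =
     {x \<in> {0..1}. infinite {n::nat. n \<ge> 1 \<and> in_mod1 x (approx_set \<psi> n)}}"

definition dyadic_block :: "real \<Rightarrow> nat \<Rightarrow> nat set" where
  "dyadic_block \<eta> h = {n. 2 ^ h < real n \<and> real n \<le> 2 ^ h * real h powr \<eta>}"

text \<open>Sums over these blocks are genuine finite sums.\<close>

lemma finite_dyadic_block: "finite (dyadic_block \<eta> h)"
proof (rule finite_subset)
  show "dyadic_block \<eta> h \<subseteq> {..nat \<lfloor>2 ^ h * real h powr \<eta>\<rfloor>}"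
    by (auto simp: dyadic_block_def le_nat_floor)
qed simp

end

theory Submission
  imports Defs
begin

text \<open>By the second moment method it suffices to bound the total overlap of the sets by a constant
  times the square of their total measure, over every finite block of total measure at least 1; this
  gives a limsup set of measure at least an absolute constant. A sieve bounds the overlap of the sets of
  \<open>m\<close> and \<open>n\<close> by the product of their measures times a product over the primes \<open>p\<close> at
  which \<open>m\<close> and \<open>n\<close> have different valuations; only primes beyond a multiple of \<open>log D\<close>
  count, where \<open>D\<close> is the normalised size of the larger arc. A pair can only be harmful if
  \<open>gcd m n\<close> is large relative to the arcs and \<open>m n / (gcd m n)\<^sup>2\<close> has many small prime factors.

  Harmful pairs are counted by a bilinear form \<open>T\<close>, shown to be at most a constant times
  \<open>(A A')\<^sup>3\<^sup>/\<^sup>4\<close>, where \<open>A\<close> and \<open>A'\<close> are the two total masses, by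
  induction on the set of primes involved (following Green--Walker and Hauke--Vazquez Saez--Walker).
  Splitting both sides according to the valuation at one prime \<open>p\<close> closes the induction
  unless almost all mass, up to \<open>O(1/p)\<close>, sits at one valuation. If this happens for every prime, then
  half of the mass lies on pairs in which at each prime one of the two members has the typical valuation;
  such pairs are parametrised by coprime fractions and are counted directly.

  For the zero-one law, the \<open>n\<close> are split by the exact power of 2 dividing them. On one class an
  expanding affine map of the circle acts; if every class has a convergent series, then multiples
  of arbitrarily high powers of 2 already suffice, and translations by dyadic rationals act. In both cases
  the lower bound on the measure, being uniform in \<open>\<psi>\<close>, gives an invariant set of positive
  measure.\<close>

section \<open>A dichotomy for one prime\<close>

text \<open>The obstacle is uniformity in the set of primes: there may be arbitrarily many of them,
  so an induction over primes can afford a constant loss only at boundedly many, those up to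
  \<open>p0\<close>. The exponent 3/4 is what two applications of Cauchy-Schwarz yield for the pairs
  that are counted directly. It also fixes the final balance. A pair that is bad at level
  \<open>t\<close> has normalised arc sizes below \<open>X = 4 ^ (t + 1)\<close>. Dividing sizes and
  masses by \<open>X\<close> brings it within reach of the bilinear bound; scaling back costs
  \<open>X powr (2 - 3/2) = 2 ^ (t + 1)\<close>, against a gain \<open>exp (- 2 * t)\<close> from
  exponential weights at the primes from \<open>t\<close> on. The decay \<open>2 ^ (- t)\<close>
  that remains pays for the trivial bound \<open>t + 1\<close> at the small primes. The base 4 comes
  from the estimate \<open>4 ^ y\<close> for the product of the primes up to \<open>y\<close>: a
  sieve period then fits into the range of the differences to be counted, so that rounding to whole
  periods costs only a constant and no error term arises.\<close>

lemma geometric_partial_le: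
  fixes r :: real
  assumes "0 \<le> r" "r < 1"
  shows "(\<Sum>i<n. r ^ i) \<le> 1 / (1 - r)"
proof -
  have "(\<Sum>i<n. r ^ i) = (1 - r ^ n) / (1 - r)"
    using assms sum_gp_strict[of r n] by auto
  also have "\<dots> \<le> 1 / (1 - r)"
    using assms by (intro divide_right_mono) auto
  finally show ?thesis .
qed

definition nat_dist :: "nat \<Rightarrow> nat \<Rightarrow> nat" where
  "nat_dist i j = (i - j) + (j - i)"

lemma nat_dist_sym: "nat_dist i j = nat_dist j i"
  by (simp add: nat_dist_def)

lemma sum_nat_dist_le:
  fixes r :: real
  assumes "0 \<le> r" "r < 1" "i \<le> n"
  shows "(\<Sum>j\<in>{..n}-{i}. r ^ nat_dist i j) \<le> 2 * r / (1 - r)"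
proof -
  have eq: "{..n}-{i} = {..<i} \<union> {i<..n}" using assms by auto
  have "(\<Sum>j\<in>{..n}-{i}. r ^ nat_dist i j) = (\<Sum>j<i. r ^ nat_dist i j) + (\<Sum>j\<in>{i<..n}. r ^ nat_dist i j)"
    unfolding eq by (rule sum.union_disjoint) auto
  also have "(\<Sum>j<i. r ^ nat_dist i j) = (\<Sum>j<i. r ^ Suc j)"
    by (rule sum.reindex_bij_witness[of _ "\<lambda>j. i - 1 - j" "\<lambda>j. i - 1 - j"])
       (auto simp: nat_dist_def Suc_diff_Suc simp del: power_Suc)
  also have "(\<Sum>j\<in>{i<..n}. r ^ nat_dist i j) = (\<Sum>j<n-i. r ^ Suc j)"
    by (rule sum.reindex_bij_witness[of _ "\<lambda>j. i + 1 + j" "\<lambda>j. j - i - 1"])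
       (auto simp: nat_dist_def Suc_diff_Suc simp del: power_Suc)
  also have "(\<Sum>j<i. r ^ Suc j) + (\<Sum>j<n-i. r ^ Suc j) \<le> r * (1 / (1 - r)) + r * (1 / (1 - r))"
    unfolding power_Suc sum_distrib_left[symmetric] using assms
    by (intro add_mono mult_left_mono geometric_partial_le) auto
  finally show ?thesis by simp
qed

text \<open>Schur's test: the kernel \<open>r ^ nat_dist i j\<close> is symmetric with off-diagonal
  row sums at most \<open>2 * r / (1 - r)\<close>, so after
  \<open>u * v \<le> (u^2 + v^2) / 2\<close> each square is summed against a whole row. Omitting the
  diagonal is what produces the factor \<open>r\<close>.\<close>

lemma schur_offdiag:
  fixes r :: real and u v :: "nat \<Rightarrow> real"
  assumes r: "0 \<le> r" "r < 1" and I: "I \<subseteq> {..n}"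
    and decay: "\<And>i j. i \<noteq> j \<Longrightarrow> decay i j \<le> M * r ^ nat_dist i j" and M: "0 \<le> M"
    and nn: "\<And>i. 0 \<le> u i" "\<And>i. 0 \<le> v i"
  shows "(\<Sum>i\<in>I. \<Sum>j\<in>I-{i}. decay i j * u i * v j)
    \<le> M * r / (1 - r) * ((\<Sum>i\<in>I. (u i)^2) + (\<Sum>i\<in>I. (v i)^2))"
proof -
  have fin: "finite I" using I finite_subset by blast
  have row: "(\<Sum>j\<in>I-{i}. r ^ nat_dist i j) \<le> 2 * r / (1 - r)" if "i \<in> I" for i
  proof -
    have "(\<Sum>j\<in>I-{i}. r ^ nat_dist i j) \<le> (\<Sum>j\<in>{..n}-{i}. r ^ nat_dist i j)"
      using I r by (intro sum_mono2) auto
    also have "\<dots> \<le> 2 * r / (1 - r)"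
      using sum_nat_dist_le[OF r] I that by blast
    finally show ?thesis .
  qed
  have swap: "(\<Sum>i\<in>I. \<Sum>j\<in>I-{i}. r ^ nat_dist i j * (v j)^2) = (\<Sum>j\<in>I. \<Sum>i\<in>I-{j}. r ^ nat_dist j i * (v j)^2)"
  proof -
    have "(\<Sum>i\<in>I. \<Sum>j\<in>I-{i}. r ^ nat_dist i j * (v j)^2) = (\<Sum>i\<in>I. \<Sum>j\<in>I. if i = j then 0 else r ^ nat_dist i j * (v j)^2)"
      using fin by (intro sum.cong refl sum.mono_neutral_cong_left) auto
    also have "\<dots> = (\<Sum>j\<in>I. \<Sum>i\<in>I. if i = j then 0 else r ^ nat_dist i j * (v j)^2)"
      by (rule sum.swap)
    also have "\<dots> = (\<Sum>j\<in>I. \<Sum>i\<in>I-{j}. r ^ nat_dist j i * (v j)^2)"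
      using fin by (intro sum.cong refl sum.mono_neutral_cong_right) (auto simp: nat_dist_sym)
    finally show ?thesis .
  qed
  have "(\<Sum>i\<in>I. \<Sum>j\<in>I-{i}. decay i j * u i * v j)
    \<le> (\<Sum>i\<in>I. \<Sum>j\<in>I-{i}. M / 2 * (r ^ nat_dist i j * (u i)^2 + r ^ nat_dist i j * (v j)^2))"
  proof (intro sum_mono)
    fix i j assume "j \<in> I - {i}"
    then have "decay i j * (u i * v j) \<le> (M * r ^ nat_dist i j) * (u i * v j)"
      using decay nn by (intro mult_right_mono) auto
    also have "\<dots> \<le> (M * r ^ nat_dist i j) * (((u i)^2 + (v j)^2) / 2)"
      using M r sum_squares_bound[of "u i" "v j"] by (intro mult_left_mono) auto
    finally show "decay i j * u i * v j \<le> M / 2 * (r ^ nat_dist i j * (u i)^2 + r ^ nat_dist i j * (v j)^2)"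
      by (simp add: field_simps)
  qed
  also have "\<dots> = M / 2 * ((\<Sum>i\<in>I. \<Sum>j\<in>I-{i}. r ^ nat_dist i j * (u i)^2) + (\<Sum>i\<in>I. \<Sum>j\<in>I-{i}. r ^ nat_dist i j * (v j)^2))"
    by (simp add: sum.distrib sum_distrib_left distrib_left)
  also have "\<dots> = M / 2 * ((\<Sum>i\<in>I. (\<Sum>j\<in>I-{i}. r ^ nat_dist i j) * (u i)^2) + (\<Sum>i\<in>I. (\<Sum>j\<in>I-{i}. r ^ nat_dist i j) * (v i)^2))"
    by (simp add: swap sum_distrib_right)
  also have "\<dots> \<le> M / 2 * ((\<Sum>i\<in>I. (2 * r / (1 - r)) * (u i)^2) + (\<Sum>i\<in>I. (2 * r / (1 - r)) * (v i)^2))"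
    using M row by (intro mult_left_mono add_mono sum_mono mult_right_mono) auto
  also have "\<dots> = M * r / (1 - r) * ((\<Sum>i\<in>I. (u i)^2) + (\<Sum>i\<in>I. (v i)^2))"
    unfolding sum_distrib_left[symmetric] by (simp add: add_divide_distrib distrib_left)
  finally show ?thesis .
qed

lemma sum_split_diag:
  fixes f :: "nat \<Rightarrow> nat \<Rightarrow> real"
  assumes "finite I"
  shows "(\<Sum>i\<in>I. \<Sum>j\<in>I. f i j) = (\<Sum>i\<in>I. f i i) + (\<Sum>i\<in>I. \<Sum>j\<in>I-{i}. f i j)"
  using assms by (simp add: sum.remove sum.distrib)

lemma schur_full:
  fixes r :: real and u v :: "nat \<Rightarrow> real"
  assumes r: "0 \<le> r" "r < 1" and I: "I \<subseteq> {..n}"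
    and decay: "\<And>i j. i \<noteq> j \<Longrightarrow> decay i j \<le> M * r ^ nat_dist i j" and M: "0 \<le> M"
    and kap1: "\<And>i. decay i i \<le> 1"
    and nn: "\<And>i. 0 \<le> u i" "\<And>i. 0 \<le> v i"
  shows "(\<Sum>i\<in>I. \<Sum>j\<in>I. decay i j * u i * v j)
    \<le> (1/2 + M * r / (1 - r)) * ((\<Sum>i\<in>I. (u i)^2) + (\<Sum>i\<in>I. (v i)^2))"
proof -
  have fin: "finite I" using I finite_subset by blast
  have "(\<Sum>i\<in>I. decay i i * u i * v i) \<le> (\<Sum>i\<in>I. 1/2 * ((u i)^2 + (v i)^2))"
  proof (intro sum_mono)
    fix i
    have "decay i i * (u i * v i) \<le> 1 * (u i * v i)" using kap1 nn by (intro mult_right_mono) auto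
    then show "decay i i * u i * v i \<le> 1/2 * ((u i)^2 + (v i)^2)"
      using sum_squares_bound[of "u i" "v i"] by (simp add: mult.assoc)
  qed
  also have "\<dots> = 1/2 * ((\<Sum>i\<in>I. (u i)^2) + (\<Sum>i\<in>I. (v i)^2))"
    by (simp only: sum_distrib_left[symmetric] sum.distrib)
  finally show ?thesis
    using schur_offdiag[where u = u and v = v, OF r I decay M nn] sum_split_diag[OF fin, of "\<lambda>i j. decay i j * u i * v j"]
    unfolding distrib_right by linarith
qed

text \<open>Fourth powers are masses, and Schur's test for cubes leads to sixth powers. For a total
  mass \<open>a\<close> one may take \<open>c = sqrt a\<close> and obtains
  \<open>a powr (3/2)\<close>; this superlinear gain drives the dichotomy.\<close>

lemma sixth_le_fourth:
  fixes x :: "nat \<Rightarrow> real"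
  assumes "finite I" "\<And>i. i \<in> I \<Longrightarrow> (x i)^2 \<le> c"
  shows "(\<Sum>i\<in>I. (x i ^ 3)^2) \<le> c * (\<Sum>i\<in>I. x i ^ 4)"
  unfolding sum_distrib_left
proof (rule sum_mono)
  fix i assume "i \<in> I"
  have "(x i ^ 3)^2 = (x i)^2 * x i ^ 4" by (simp add: power_mult[symmetric] power_add[symmetric])
  then show "(x i ^ 3)^2 \<le> c * x i ^ 4" using mult_right_mono[OF assms(2)[OF \<open>i \<in> I\<close>], of "x i ^ 4"] by simp
qed

text \<open>Young's inequality, by comparing \<open>x\<close> with \<open>8 * u\<close>. The
  coefficient 1/8 is small enough to be absorbed by the 1/2 that is lost on the diagonal in the
  dichotomy.\<close>

lemma young_cubic:
  fixes u x :: real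
  assumes "0 \<le> u" "0 \<le> x"
  shows "u * x ^ 3 \<le> x ^ 4 / 8 + 512 * u ^ 4"
proof (cases "8 * u \<le> x")
  case True
  then have "(8 * u) * x ^ 3 \<le> x * x ^ 3" using assms by (intro mult_right_mono) auto
  moreover have "x * x ^ 3 = x ^ 4" by (simp add: power_numeral_reduce)
  ultimately have "u * x ^ 3 \<le> x ^ 4 / 8" by simp
  then show ?thesis using zero_le_power[OF assms(1), of 4] by linarith
next
  case False
  then have "x ^ 3 \<le> (8 * u) ^ 3" using assms by (intro power_mono) auto
  then have "u * x ^ 3 \<le> u * (8 * u) ^ 3" using assms by (intro mult_left_mono) auto
  also have "\<dots> = 512 * u ^ 4" by (simp add: power_mult_distrib power_numeral_reduce)
  finally show ?thesis using zero_le_power[OF assms(2), of 4] by linarith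
qed

text \<open>The fourth powers are the relative masses of the fibres of the two sides over the valuations at
  a prime \<open>p\<close>, so that masses enter the bilinear form to the power \<open>3/4\<close>, and
  \<open>r = p\<^sup>-\<^sup>1\<^sup>/\<^sup>4\<close>. The gain \<open>r\<^sup>6 = p\<^sup>-\<^sup>3\<^sup>/\<^sup>2\<close> is summable over the primes, which is
  why the exponent has to exceed \<open>1/2\<close>.\<close>

lemma dichotomy:
  fixes x y :: "nat \<Rightarrow> real" and r M :: real
  assumes nn: "\<And>i. 0 \<le> x i" "\<And>i. 0 \<le> y i"
    and sx: "(\<Sum>i\<le>n. x i ^ 4) = 1" and sy: "(\<Sum>i\<le>n. y i ^ 4) = 1"
    and M: "1 \<le> M" and r: "0 \<le> r" "2048 * M * r \<le> 1"
    and kap1: "\<And>i. decay i i \<le> 1" and decay: "\<And>i j. i \<noteq> j \<Longrightarrow> decay i j \<le> M * r ^ nat_dist i j"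
    and big: "1 < (\<Sum>i\<le>n. \<Sum>j\<le>n. decay i j * x i ^ 3 * y j ^ 3)"
  shows "\<exists>k. (\<Sum>i\<in>{..n}-{k}. \<Sum>j\<in>{..n}-{k}. decay i j * x i ^ 3 * y j ^ 3) \<le> 2 ^ 22 * M ^ 6 * r ^ 6"
proof -
  have r1: "r \<le> 1 / 2048" using mult_right_mono[OF M, of "2048 * r"] r by (simp add: mult.commute mult.left_commute)
  have rl: "r < 1" using r1 by simp
  have Mr: "M * r / (1 - r) \<le> 2 * M * r"
  proof -
    have "M * r / (1 - r) \<le> M * r / (1/2)" using r r1 M by (intro divide_left_mono) auto
    then show ?thesis by simp
  qed
  have le1: "z i \<le> 1" if "\<And>i. 0 \<le> z i" "(\<Sum>i\<le>n. z i ^ 4) = 1" "i \<le> n" for z :: "nat \<Rightarrow> real" and i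
  proof -
    have "z i ^ 4 \<le> (\<Sum>i\<le>n. z i ^ 4)" using that by (intro member_le_sum) auto
    then show ?thesis using that by (simp add: power_le_one_iff)
  qed
  have x1: "x i \<le> 1" and y1: "y i \<le> 1" if "i \<le> n" for i
    using le1[OF nn(1) sx that] le1[OF nn(2) sy that] by auto
  have x6: "(\<Sum>i\<le>n. (x i ^ 3)^2) \<le> 1" and y6: "(\<Sum>i\<le>n. (y i ^ 3)^2) \<le> 1"
    using sixth_le_fourth[of "{..n}" x 1] sixth_le_fourth[of "{..n}" y 1] sx sy nn x1 y1
    by (auto simp: power_le_one_iff)
  define e where "e = 4 * M * r"
  have e: "0 \<le> e" "e \<le> 1 / 512" using r M by (auto simp: e_def)
  have off: "(\<Sum>i\<le>n. \<Sum>j\<in>{..n}-{i}. decay i j * x i ^ 3 * y j ^ 3) \<le> e"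
  proof -
    have "(\<Sum>i\<le>n. \<Sum>j\<in>{..n}-{i}. decay i j * x i ^ 3 * y j ^ 3)
      \<le> M * r / (1 - r) * ((\<Sum>i\<le>n. (x i ^ 3)^2) + (\<Sum>i\<le>n. (y i ^ 3)^2))"
      using M nn by (intro schur_offdiag[OF r(1) rl _ decay, where n = n]) auto
    also have "\<dots> \<le> (2 * M * r) * (1 + 1)"
      using Mr M r x6 y6 by (intro mult_mono add_mono add_nonneg_nonneg sum_nonneg) auto
    finally show ?thesis by (simp add: e_def)
  qed
  have "1 - e < (\<Sum>i\<le>n. decay i i * x i ^ 3 * y i ^ 3)"
    using big off sum_split_diag[of "{..n}" "\<lambda>i j. decay i j * x i ^ 3 * y j ^ 3"] by simp
  also have "\<dots> \<le> (\<Sum>i\<le>n. x i ^ 3 * y i ^ 3)"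
  proof (rule sum_mono)
    fix i
    have "decay i i * (x i ^ 3 * y i ^ 3) \<le> 1 * (x i ^ 3 * y i ^ 3)"
      using kap1 nn by (intro mult_right_mono) auto
    then show "decay i i * x i ^ 3 * y i ^ 3 \<le> x i ^ 3 * y i ^ 3" by (simp add: mult.assoc)
  qed
  finally have diag: "1 - e < (\<Sum>i\<le>n. x i ^ 3 * y i ^ 3)" .
  obtain k where k: "k \<le> n" "\<And>i. i \<le> n \<Longrightarrow> x i * y i \<le> x k * y k"
  proof -
    have "Max ((\<lambda>i. x i * y i) ` {..n}) \<in> (\<lambda>i. x i * y i) ` {..n}" by (intro Max_in) auto
    then obtain k where "k \<in> {..n}" "Max ((\<lambda>i. x i * y i) ` {..n}) = x k * y k" by (rule imageE)
    moreover have "x i * y i \<le> Max ((\<lambda>i. x i * y i) ` {..n})" if "i \<le> n" for i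
      using that by (intro Max_ge) auto
    ultimately show thesis by (intro that[of k]) auto
  qed
  \<comment> \<open>Writing \<open>x^3 * y^3 = (x * y) * (x^2 * y^2)\<close>, the second factors sum
    to at most 1. So the largest product \<open>x k * y k\<close> exceeds \<open>1 - e\<close>, and
    both sides concentrate at the same index \<open>k\<close>.\<close>
  have "(\<Sum>i\<le>n. x i ^ 3 * y i ^ 3) \<le> (\<Sum>i\<le>n. (x k * y k) * ((x i ^ 4 + y i ^ 4) / 2))"
  proof (rule sum_mono)
    fix i assume i: "i \<in> {..n}"
    have "x i ^ 3 * y i ^ 3 = (x i * y i) * ((x i)^2 * (y i)^2)" by (simp add: power2_eq_square power3_eq_cube)
    also have "\<dots> \<le> (x k * y k) * ((x i)^2 * (y i)^2)" using k i by (intro mult_right_mono) auto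
    also have "\<dots> \<le> (x k * y k) * ((x i ^ 4 + y i ^ 4) / 2)"
      using nn sum_squares_bound[of "(x i)^2" "(y i)^2"] by (intro mult_left_mono) (auto simp: power_mult[symmetric])
    finally show "x i ^ 3 * y i ^ 3 \<le> (x k * y k) * ((x i ^ 4 + y i ^ 4) / 2)" .
  qed
  also have "\<dots> = x k * y k"
    by (simp only: sum_distrib_left[symmetric] sum_divide_distrib[symmetric] sum.distrib sx sy) simp
  finally have xy: "1 - e < x k * y k" using diag by linarith
  have "x k * y k \<le> x k * 1" "x k * y k \<le> 1 * y k"
    using mult_left_mono[OF y1[OF k(1)] nn(1)[of k]] mult_right_mono[OF x1[OF k(1)] nn(2)[of k]] .
  then have xk: "1 - e \<le> x k" and yk: "1 - e \<le> y k" using xy by auto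
  let ?I = "{..n} - {k}"
  define a where "a = (\<Sum>i\<in>?I. x i ^ 4)"
  define b where "b = (\<Sum>i\<in>?I. y i ^ 4)"
  have ab: "x k ^ 4 = 1 - a" "y k ^ 4 = 1 - b"
    using sx sy k(1) unfolding a_def b_def by (auto simp: sum.remove)
  have small: "1 - z ^ 4 \<le> 1 / 64" if "1 - e \<le> z" for z
  proof -
    have "1 + real 4 * (- e) \<le> (1 + (- e)) ^ 4" using e by (intro Bernoulli_inequality) auto
    also have "(1 + (- e)) ^ 4 \<le> z ^ 4" using that e by (intro power_mono) auto
    finally show ?thesis using e by simp
  qed
  have a: "0 \<le> a" "a \<le> 1 / 64" and b: "0 \<le> b" "b \<le> 1 / 64"
    using ab small[OF xk] small[OF yk] by (auto simp: a_def b_def intro!: sum_nonneg)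
  have sq: "(z i)^2 \<le> sqrt (\<Sum>i\<in>?I. z i ^ 4)" if "i \<in> ?I" for z :: "nat \<Rightarrow> real" and i
  proof -
    have "((z i)^2)^2 \<le> (\<Sum>i\<in>?I. z i ^ 4)"
      using member_le_sum[of i ?I "\<lambda>i. z i ^ 4"] that by (simp add: power_mult[symmetric])
    then show ?thesis by (intro real_le_rsqrt)
  qed
  have a6: "(\<Sum>i\<in>?I. (x i ^ 3)^2) \<le> sqrt a * a" and b6: "(\<Sum>i\<in>?I. (y i ^ 3)^2) \<le> sqrt b * b"
    using sixth_le_fourth[of ?I x "sqrt a"] sixth_le_fourth[of ?I y "sqrt b"] sq
    by (auto simp: a_def b_def)
  have rest: "(\<Sum>i\<in>?I. \<Sum>j\<in>?I. decay i j * x i ^ 3 * y j ^ 3) \<le> sqrt a * a + sqrt b * b"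
  proof -
    have "(\<Sum>i\<in>?I. \<Sum>j\<in>?I. decay i j * x i ^ 3 * y j ^ 3)
      \<le> (1/2 + M * r / (1 - r)) * ((\<Sum>i\<in>?I. (x i ^ 3)^2) + (\<Sum>i\<in>?I. (y i ^ 3)^2))"
      using M nn by (intro schur_full[OF r(1) rl _ decay, where n = n] kap1) auto
    also have "\<dots> \<le> 1 * ((\<Sum>i\<in>?I. (x i ^ 3)^2) + (\<Sum>i\<in>?I. (y i ^ 3)^2))"
      using Mr r by (intro mult_right_mono add_nonneg_nonneg sum_nonneg) auto
    finally show ?thesis using a6 b6 by simp
  qed
  have sqab: "sqrt a \<le> 1/8" "sqrt b \<le> 1/8"
    using real_sqrt_le_mono[OF a(2)] real_sqrt_le_mono[OF b(2)] by (simp_all add: real_sqrt_divide)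
  \<comment> \<open>The terms in row or column \<open>k\<close> contain only one small cube. Young's
    inequality splits off a part to be absorbed; the rest has order \<open>r ^ 4\<close>, since
    every other index is at distance at least 1.\<close>
  have star: "(\<Sum>i\<in>?I. M * r ^ nat_dist k i * z i ^ 3) \<le> (\<Sum>i\<in>?I. z i ^ 4) / 8 + 2048 * M ^ 4 * r ^ 4"
    if z: "\<And>i. 0 \<le> z i" for z :: "nat \<Rightarrow> real"
  proof -
    have "(\<Sum>i\<in>?I. M * r ^ nat_dist k i * z i ^ 3) \<le> (\<Sum>i\<in>?I. z i ^ 4 / 8 + 512 * (M * r ^ nat_dist k i) ^ 4)"
      using z M r by (intro sum_mono young_cubic) auto
    also have "\<dots> = (\<Sum>i\<in>?I. z i ^ 4) / 8 + 512 * M ^ 4 * (\<Sum>i\<in>?I. (r ^ 4) ^ nat_dist k i)"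
      by (simp add: sum.distrib sum_divide_distrib sum_distrib_left power_mult_distrib power_mult[symmetric] mult.commute mult.left_commute)
    also have "(\<Sum>i\<in>?I. (r ^ 4) ^ nat_dist k i) \<le> 2 * r ^ 4 / (1 - r ^ 4)"
      using r rl k(1) by (intro sum_nat_dist_le) (auto simp: power_less_one_iff)
    also have "2 * r ^ 4 / (1 - r ^ 4) \<le> 2 * r ^ 4 / (1 / 2)"
    proof (intro divide_left_mono)
      have "r ^ 4 \<le> r ^ 1" using r rl by (intro power_decreasing) auto
      then show "1 / 2 \<le> 1 - r ^ 4" using r1 by simp
      then show "0 < (1 - r ^ 4) * (1 / 2)" by simp
    qed auto
    finally show ?thesis using M by (simp add: mult_left_mono)
  qed
  have xterm: "(\<Sum>i\<in>?I. decay i k * x i ^ 3 * y k ^ 3) \<le> (\<Sum>i\<in>?I. M * r ^ nat_dist k i * x i ^ 3)"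
    and yterm: "(\<Sum>i\<in>?I. decay k i * x k ^ 3 * y i ^ 3) \<le> (\<Sum>i\<in>?I. M * r ^ nat_dist k i * y i ^ 3)"
  proof -
    have gen: "c * z ^ 3 * w ^ 3 \<le> c' * z ^ 3" if "c \<le> c'" "0 \<le> c'" "0 \<le> z" "0 \<le> w" "w \<le> 1" for c c' z w :: real
    proof -
      have "c * (z ^ 3 * w ^ 3) \<le> c' * (z ^ 3 * w ^ 3)" using that by (intro mult_right_mono) auto
      also have "\<dots> \<le> c' * (z ^ 3 * 1)" using that by (intro mult_left_mono) (auto simp: power_le_one)
      finally show ?thesis by (simp add: mult.assoc)
    qed
    show "(\<Sum>i\<in>?I. decay i k * x i ^ 3 * y k ^ 3) \<le> (\<Sum>i\<in>?I. M * r ^ nat_dist k i * x i ^ 3)"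
    proof (rule sum_mono)
      fix i assume "i \<in> ?I"
      then show "decay i k * x i ^ 3 * y k ^ 3 \<le> M * r ^ nat_dist k i * x i ^ 3"
        using decay[of i k] M r nn y1 k by (intro gen) (auto simp: nat_dist_sym)
    qed
    show "(\<Sum>i\<in>?I. decay k i * x k ^ 3 * y i ^ 3) \<le> (\<Sum>i\<in>?I. M * r ^ nat_dist k i * y i ^ 3)"
    proof (rule sum_mono)
      fix i assume "i \<in> ?I"
      then have "decay k i * y i ^ 3 * x k ^ 3 \<le> M * r ^ nat_dist k i * y i ^ 3"
        using decay[of k i] M r nn x1 k by (intro gen) auto
      then show "decay k i * x k ^ 3 * y i ^ 3 \<le> M * r ^ nat_dist k i * y i ^ 3" by (simp add: mult.commute mult.left_commute)
    qed
  qed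
  have kk: "decay k k * x k ^ 3 * y k ^ 3 \<le> 1 - (a / 2 + b / 2)"
  proof -
    define p q where "p = (x k ^ 3)^2" and "q = (y k ^ 3)^2"
    have "decay k k * (x k ^ 3 * y k ^ 3) \<le> 1 * (x k ^ 3 * y k ^ 3)" using kap1 nn by (intro mult_right_mono) auto
    then have "decay k k * x k ^ 3 * y k ^ 3 \<le> x k ^ 3 * y k ^ 3" by (simp only: mult.assoc mult_1)
    moreover have "x k ^ 3 * y k ^ 3 \<le> (p + q) / 2"
      using sum_squares_bound[of "x k ^ 3" "y k ^ 3"] unfolding p_def q_def by simp
    moreover have "p \<le> 1 - a" "q \<le> 1 - b"
      unfolding p_def q_def ab[symmetric] power_mult[symmetric] using x1 y1 nn k by (auto intro!: power_decreasing)
    ultimately show ?thesis by argo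
  qed
  have remk: "(\<Sum>i\<le>n. h i) = h k + (\<Sum>i\<in>?I. h i)" for h :: "nat \<Rightarrow> real"
    using k(1) by (intro sum.remove) auto
  have split: "(\<Sum>i\<le>n. \<Sum>j\<le>n. h i j) = h k k + (\<Sum>i\<in>?I. h i k) + (\<Sum>j\<in>?I. h k j) + (\<Sum>i\<in>?I. \<Sum>j\<in>?I. h i j)" for h :: "nat \<Rightarrow> nat \<Rightarrow> real"
    unfolding remk sum.distrib by simp
  \<comment> \<open>The entry at \<open>k\<close> loses \<open>(a + b) / 2\<close>. Cross terms give
    back \<open>(a + b) / 8\<close>, the remainder another \<open>(a + b) / 8\<close> because
    \<open>sqrt a\<close> and \<open>sqrt b\<close> are at most 1/8. Hence
    \<open>(a + b) / 4\<close> is below the \<open>r ^ 4\<close> terms; feeding this into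
    \<open>rest\<close> raises it to the power 3/2 and gives \<open>r ^ 6\<close>.\<close>
  have "1 < 1 - (a / 2 + b / 2) + (a / 8 + 2048 * M ^ 4 * r ^ 4) + (b / 8 + 2048 * M ^ 4 * r ^ 4) + (sqrt a * a + sqrt b * b)"
    using big[unfolded split] kk xterm yterm star[of x, OF nn(1)] star[of y, OF nn(2)] rest
    unfolding a_def[symmetric] b_def[symmetric] by linarith
  moreover have "sqrt a * a \<le> 1/8 * a" "sqrt b * b \<le> 1/8 * b" using mult_right_mono[OF sqab(1) a(1)] mult_right_mono[OF sqab(2) b(1)] .
  ultimately have abB: "a + b \<le> 16384 * M ^ 4 * r ^ 4" by linarith
  define B where "B = 16384 * M ^ 4 * r ^ 4"
  have aB: "a \<le> B" "b \<le> B" using abB a b unfolding B_def by linarith+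
  have sB: "sqrt B = 128 * M^2 * r^2"
  proof -
    have "B = (128 * M^2 * r^2)^2" by (simp add: B_def power_mult_distrib power_mult[symmetric])
    then show ?thesis using M r by (simp add: real_sqrt_abs abs_mult)
  qed
  have "sqrt a * a \<le> sqrt B * B" "sqrt b * b \<le> sqrt B * B"
    using aB a b by (intro mult_mono real_sqrt_le_mono real_sqrt_ge_zero; linarith)+
  then have "(\<Sum>i\<in>?I. \<Sum>j\<in>?I. decay i j * x i ^ 3 * y j ^ 3) \<le> 2 * (sqrt B * B)" using rest by linarith
  also have "\<dots> = 2 ^ 22 * (M^2 * M ^ 4) * (r^2 * r ^ 4)"
  proof -
    have "2 * (128 * s * t * (16384 * u * v)) = 2 ^ 22 * (s * u) * (t * v)" for s t u v :: real by simp
    then show ?thesis unfolding sB unfolding B_def .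
  qed
  also have "\<dots> = 2 ^ 22 * M ^ 6 * r ^ 6"
  proof -
    have "M^2 * M ^ 4 = M ^ 6" "r^2 * r ^ 4 = r ^ 6" using power_add[of M 2 4] power_add[of r 2 4] by simp_all
    then show ?thesis by (simp only:)
  qed
  finally show ?thesis by blast
qed

section \<open>Bilinear sums over pairs with large common divisors\<close>

lemma prod_primes_dvd:
  fixes n :: nat
  assumes "finite S" "\<And>p. p \<in> S \<Longrightarrow> prime p" "\<And>p. p \<in> S \<Longrightarrow> p dvd n"
  shows "\<Prod>S dvd n"
  using assms
proof (induction S rule: finite_induct)
  case (insert p S)
  have "coprime p (\<Prod>S)"
    using insert by (intro prod_coprime_right) (metis insertCI primes_coprime)
  then show ?case using insert by (auto intro!: divides_mult)
qed simp

lemma prod_if_zero: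
  fixes d :: "'a \<Rightarrow> real"
  assumes "finite S"
  shows "(\<Prod>p\<in>S. if R p then d p else 0) = (if \<forall>p\<in>S. R p then \<Prod>p\<in>S. d p else 0)"
  using assms by (induction S rule: finite_induct) auto

text \<open>Rankin's trick: expand the product over the prime divisors of \<open>u\<close> and swap the sums.\<close>

lemma sum_prod_prime_divisors_le:
  fixes c :: "nat \<Rightarrow> real"
  assumes fin: "finite P" and pr: "\<And>p. p \<in> P \<Longrightarrow> prime p" and c: "\<And>p. p \<in> P \<Longrightarrow> 1 \<le> c p"
  shows "(\<Sum>u=1..N. \<Prod>p\<in>P. if p dvd u then c p else 1) \<le> real N * (\<Prod>p\<in>P. 1 + (c p - 1) / real p)"
proof -
  have count: "(\<Sum>u=1..N. \<Prod>p\<in>S. if p dvd u then c p - 1 else 0) \<le> real N * (\<Prod>p\<in>S. (c p - 1) / real p)"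
    if S: "S \<subseteq> P" for S
  proof -
    have fS: "finite S" using S fin finite_subset by blast
    have prS: "p \<in> S \<Longrightarrow> prime p" for p using S pr by blast
    have pos: "0 < \<Prod>S" using prS by (intro prod_pos) (auto simp: prime_gt_0_nat)
    have nn: "0 \<le> (\<Prod>p\<in>S. c p - 1)" using S c by (intro prod_nonneg) auto
    have "(\<Sum>u=1..N. \<Prod>p\<in>S. if p dvd u then c p - 1 else 0)
        = (\<Sum>u=1..N. if \<forall>p\<in>S. p dvd u then \<Prod>p\<in>S. c p - 1 else 0)"
      by (simp add: prod_if_zero[OF fS])
    also have "\<dots> = real (card {u\<in>{1..N}. \<forall>p\<in>S. p dvd u}) * (\<Prod>p\<in>S. c p - 1)"
      by (simp add: sum.If_cases Int_def)
    also have "\<dots> \<le> real (N div \<Prod>S) * (\<Prod>p\<in>S. c p - 1)"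
    proof (intro mult_right_mono nn)
      have "{u\<in>{1..N}. \<forall>p\<in>S. p dvd u} \<subseteq> (\<lambda>k. k * \<Prod>S) ` {1..N div \<Prod>S}"
      proof
        fix u assume u: "u \<in> {u\<in>{1..N}. \<forall>p\<in>S. p dvd u}"
        then have "\<Prod>S dvd u" using prod_primes_dvd[OF fS prS] by auto
        then obtain k where k: "u = k * \<Prod>S" by (metis dvdE mult.commute)
        moreover have "k \<le> N div \<Prod>S" using u k pos by (simp add: less_eq_div_iff_mult_less_eq)
        moreover have "1 \<le> k" using u k by (cases k) auto
        ultimately show "u \<in> (\<lambda>k. k * \<Prod>S) ` {1..N div \<Prod>S}" by auto
      qed
      then have "card {u\<in>{1..N}. \<forall>p\<in>S. p dvd u} \<le> card {1..N div \<Prod>S}"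
        by (meson card_image_le card_mono finite_atLeastAtMost finite_imageI le_trans)
      then show "real (card {u\<in>{1..N}. \<forall>p\<in>S. p dvd u}) \<le> real (N div \<Prod>S)" by simp
    qed
    also have "\<dots> \<le> (real N / real (\<Prod>S)) * (\<Prod>p\<in>S. c p - 1)"
      by (intro mult_right_mono nn of_nat_div_le_of_nat)
    also have "\<dots> = real N * (\<Prod>p\<in>S. (c p - 1) / real p)"
      by (simp add: prod_dividef)
    finally show ?thesis .
  qed
  have expand: "(\<Prod>p\<in>P. if p dvd u then c p else 1) = (\<Sum>S\<in>Pow P. \<Prod>p\<in>S. if p dvd u then c p - 1 else 0)" for u
  proof -
    have "(\<Prod>p\<in>P. if p dvd u then c p else 1) = (\<Prod>p\<in>P. (if p dvd u then c p - 1 else 0) + 1)"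
      by (intro prod.cong) auto
    then show ?thesis by (simp add: prod_add[OF fin])
  qed
  have "(\<Sum>u=1..N. \<Prod>p\<in>P. if p dvd u then c p else 1)
      = (\<Sum>S\<in>Pow P. \<Sum>u=1..N. \<Prod>p\<in>S. if p dvd u then c p - 1 else 0)"
    unfolding expand by (rule sum.swap)
  also have "\<dots> \<le> (\<Sum>S\<in>Pow P. real N * (\<Prod>p\<in>S. (c p - 1) / real p))"
    using count by (intro sum_mono) auto
  also have "\<dots> = real N * (\<Prod>p\<in>P. (c p - 1) / real p + 1)"
    by (simp add: prod_add[OF fin] sum_distrib_left)
  finally show ?thesis by (simp add: add.commute)
qed

lemma sum_inverse_consecutive_le:
  assumes "finite P" "\<And>p. p \<in> P \<Longrightarrow> prime p"
  shows "(\<Sum>p\<in>P. 1 / (real p * (real p - 1))) \<le> 1"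
proof -
  have tel: "(\<Sum>p\<in>{2..n}. 1 / (real p * (real p - 1))) \<le> 1 - 1 / real n" if "1 \<le> n" for n
    using that
  proof (induction n rule: dec_induct)
    case (step n)
    have "{2..Suc n} = insert (Suc n) {2..n}" using step by auto
    then have "(\<Sum>p\<in>{2..Suc n}. 1 / (real p * (real p - 1))) = 1 / (real (Suc n) * real n) + (\<Sum>p\<in>{2..n}. 1 / (real p * (real p - 1)))"
      by simp
    also have "\<dots> \<le> 1 / (real (Suc n) * real n) + (1 - 1 / real n)" using step by simp
    also have "\<dots> = 1 - 1 / real (Suc n)"
    proof -
      have "1 / ((x + 1) * x) + (1 - 1 / x) = 1 - 1 / (x + 1)" if "1 \<le> x" for x :: real
        using that by (simp add: divide_simps) (simp add: algebra_simps)
      from this[of "real n"] show ?thesis using step by (simp add: add.commute)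
    qed
    finally show ?case .
  qed simp
  define n where "n = Suc (Max (insert 0 P))"
  have "P \<subseteq> {2..n}"
  proof
    fix p assume "p \<in> P"
    then have "p \<le> Max (insert 0 P)" "2 \<le> p" using assms by (auto intro!: Max_ge prime_ge_2_nat)
    then show "p \<in> {2..n}" by (simp add: n_def)
  qed
  then have "(\<Sum>p\<in>P. 1 / (real p * (real p - 1))) \<le> (\<Sum>p\<in>{2..n}. 1 / (real p * (real p - 1)))"
    by (intro sum_mono2) auto
  also have "\<dots> \<le> 1 - 1 / real n" by (intro tel) (simp add: n_def)
  also have "\<dots> \<le> 1" by simp
  finally show ?thesis .
qed

text \<open>Integers are represented by their valuations at the primes in \<open>P\<close>: \<open>rdist\<close> is
  \<open>b / gcd a b\<close> and \<open>totfac\<close> is \<open>\<phi>(a) / a\<close>. This avoids quotients of sets of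
  integers in the induction on \<open>P\<close>.\<close>

definition rdist :: "nat set \<Rightarrow> (nat \<Rightarrow> nat) \<Rightarrow> (nat \<Rightarrow> nat) \<Rightarrow> real" where
  "rdist P a b = (\<Prod>p\<in>P. real p ^ (b p - a p))"

definition wdist :: "(nat \<Rightarrow> real) \<Rightarrow> nat set \<Rightarrow> (nat \<Rightarrow> nat) \<Rightarrow> (nat \<Rightarrow> nat) \<Rightarrow> real" where
  "wdist \<omega> P a b = (\<Prod>p\<in>P. if a p = b p then 1 else \<omega> p)"

definition totfac :: "nat set \<Rightarrow> (nat \<Rightarrow> nat) \<Rightarrow> real" where
  "totfac P a = (\<Prod>p\<in>P. if a p = 0 then 1 else 1 - 1 / real p)"

text \<open>The members of \<open>V\<close> are mere labels; the last clause says that the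
  valuations in \<open>P\<close> separate them, which replaces distinctness of integers. The mass is
  bounded by \<open>\<psi> v * totfac P (e v)\<close> instead of being equal to it because
  \<open>totfac\<close> grows when a prime leaves \<open>P\<close>.\<close>

definition admissible :: "nat set \<Rightarrow> ('a \<Rightarrow> nat \<Rightarrow> nat) \<Rightarrow> 'a set \<Rightarrow> ('a \<Rightarrow> real) \<Rightarrow> ('a \<Rightarrow> real) \<Rightarrow> bool" where
  "admissible P e V \<psi> f \<longleftrightarrow> finite V \<and>
     (\<forall>v\<in>V. 0 \<le> \<psi> v \<and> 0 \<le> f v \<and> f v \<le> \<psi> v * totfac P (e v)) \<and>
     (\<forall>v\<in>V. \<forall>w\<in>V. (\<forall>p\<in>P. e v p = e w p) \<longrightarrow> v = w)"

text \<open>The fourth power appears since Cauchy-Schwarz is applied twice. The bound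
  \<open>B\<close> on the sum makes all Euler products formed with these weights bounded
  independently of the set of primes.\<close>

locale weights =
  fixes \<omega> :: "nat \<Rightarrow> real" and M B :: real
  assumes weight_ge: "1 \<le> \<omega> p" and weight_le: "\<omega> p \<le> M"
    and weight_sum: "finite Q \<Longrightarrow> (\<And>q. q \<in> Q \<Longrightarrow> prime q) \<Longrightarrow> (\<Sum>p\<in>Q. (\<omega> p ^ 4 - 1) / real p) \<le> B"
begin

lemma weight_power: "1 \<le> \<omega> p ^ n"
  using weight_ge by (rule one_le_power)

text \<open>\<open>zeta p j\<close> dominates the contribution of a valuation that lies \<open>j\<close> below
  the typical one, including the loss in \<open>totfac\<close> when the valuation drops to 0.\<close>

definition zeta :: "nat \<Rightarrow> nat \<Rightarrow> real" where
  "zeta p j = (if j = 0 then 1 else \<omega> p ^ 4 * inverse (1 - 1 / real p) / real p ^ j)"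

text \<open>A geometric series. One factor \<open>inverse (1 - 1 / real p)\<close> is kept apart, to
  be collected into \<open>inverse (totfac P k)\<close>; what remains is 1 plus terms whose sum over
  the primes is bounded.\<close>

lemma sum_zeta_le:
  assumes p: "prime p"
  shows "(\<Sum>j\<le>k. zeta p j) \<le> (if k = 0 then 1 else inverse (1 - 1 / real p)) *
     exp (2 * ((\<omega> p ^ 4 - 1) / real p) + 1 / (real p * (real p - 1)))"
proof (cases "k = 0")
  case True
  have "0 \<le> 2 * ((\<omega> p ^ 4 - 1) / real p) + 1 / (real p * (real p - 1))"
    using weight_power[of p 4] prime_ge_2_nat[OF p] by (intro add_nonneg_nonneg) auto
  then show ?thesis using True by (simp add: zeta_def)
next
  case False
  define q where "q = real p"
  have q: "2 \<le> q" using prime_ge_2_nat[OF p] by (simp add: q_def)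
  define z where "z = \<omega> p ^ 4"
  have z: "1 \<le> z" using weight_power by (simp add: z_def)
  have "(\<Sum>j\<le>k. zeta p j) = 1 + (\<Sum>j\<in>{1..k}. zeta p j)"
  proof -
    have "{..k} = insert 0 {1..k}" by auto
    then show ?thesis by (simp add: zeta_def)
  qed
  also have "(\<Sum>j\<in>{1..k}. zeta p j) = z * inverse (1 - 1 / q) * (\<Sum>j\<in>{1..k}. (1 / q) ^ j)"
    unfolding sum_distrib_left by (intro sum.cong) (auto simp: zeta_def z_def q_def power_one_over divide_inverse power_inverse)
  also have "(\<Sum>j\<in>{1..k}. (1 / q) ^ j) = (\<Sum>j<k. (1 / q) * (1 / q) ^ j)"
    by (rule sum.reindex_bij_witness[of _ Suc "\<lambda>j. j - 1"]) (auto simp: power_eq_if)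
  also have "\<dots> = (1 / q) * ((1 - (1 / q) ^ k) / (1 - 1 / q))"
    using q sum_gp_strict[of "1/q" k] by (simp only: sum_distrib_left[symmetric]) auto
  also have "\<dots> \<le> (1 / q) * (1 / (1 - 1 / q))"
    using q by (intro mult_left_mono divide_right_mono) auto
  finally have "(\<Sum>j\<le>k. zeta p j) \<le> 1 + z * inverse (1 - 1 / q) * ((1 / q) * (1 / (1 - 1 / q)))"
    using z q by (simp add: mult_left_mono)
  also have "\<dots> = inverse (1 - 1 / q) * (1 + ((z - 1) / (q - 1) + 1 / (q * (q - 1))))"
  proof -
    define s where "s = q - 1"
    have s: "0 < s" "q = s + 1" using q by (auto simp: s_def)
    have inv: "inverse (1 - 1 / q) = (s + 1) / s" "1 / (1 - 1 / q) = (s + 1) / s"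
      using s by (simp_all add: field_simps)
    show ?thesis unfolding inv using s by (simp add: divide_simps) (simp add: algebra_simps)
  qed
  also have "\<dots> \<le> inverse (1 - 1 / q) * exp ((z - 1) / (q - 1) + 1 / (q * (q - 1)))"
    using q by (intro mult_left_mono exp_ge_add_one_self) auto
  also have "\<dots> \<le> inverse (1 - 1 / q) * exp (2 * ((z - 1) / q) + 1 / (q * (q - 1)))"
  proof -
    have "(z - 1) / (q - 1) \<le> (z - 1) / (q / 2)" using q z by (intro divide_left_mono) auto
    also have "\<dots> = 2 * ((z - 1) / q)" by simp
    finally have "exp ((z - 1) / (q - 1) + 1 / (q * (q - 1))) \<le> exp (2 * ((z - 1) / q) + 1 / (q * (q - 1)))"
      unfolding exp_le_cancel_iff by (rule add_right_mono)
    then show ?thesis using q by (intro mult_left_mono) auto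
  qed
  finally show ?thesis using False by (simp add: q_def z_def)
qed

lemma prod_sum_zeta_le:
  assumes fin: "finite P" and pr: "\<And>p. p \<in> P \<Longrightarrow> prime p"
  shows "(\<Prod>p\<in>P. \<Sum>j\<le>k p. zeta p j) \<le> inverse (totfac P k) * exp (2 * B + 1)"
proof -
  have "(\<Prod>p\<in>P. \<Sum>j\<le>k p. zeta p j) \<le> (\<Prod>p\<in>P. (if k p = 0 then 1 else inverse (1 - 1 / real p)) *
     exp (2 * ((\<omega> p ^ 4 - 1) / real p) + 1 / (real p * (real p - 1))))"
  proof (rule prod_mono, intro conjI sum_nonneg sum_zeta_le)
    fix p j assume p: "p \<in> P"
    then have "1 \<le> real p" using prime_ge_2_nat[OF pr] by force
    then show "0 \<le> zeta p j" using weight_power[of p 4] by (auto simp: zeta_def field_simps)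
  qed (use pr in auto)
  also have "\<dots> = (\<Prod>p\<in>P. if k p = 0 then 1 else inverse (1 - 1 / real p)) *
     exp (2 * (\<Sum>p\<in>P. (\<omega> p ^ 4 - 1) / real p) + (\<Sum>p\<in>P. 1 / (real p * (real p - 1))))"
    by (simp only: prod.distrib exp_sum[OF fin, symmetric] sum.distrib sum_distrib_left)
  also have "(\<Prod>p\<in>P. if k p = 0 then 1 else inverse (1 - 1 / real p)) = inverse (totfac P k)"
    unfolding totfac_def prod_inversef[symmetric] o_def by (intro prod.cong) auto
  also have "inverse (totfac P k) * exp (2 * (\<Sum>p\<in>P. (\<omega> p ^ 4 - 1) / real p) + (\<Sum>p\<in>P. 1 / (real p * (real p - 1))))
      \<le> inverse (totfac P k) * exp (2 * B + 1)"
  proof (intro mult_left_mono)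
    show "exp (2 * (\<Sum>p\<in>P. (\<omega> p ^ 4 - 1) / real p) + (\<Sum>p\<in>P. 1 / (real p * (real p - 1)))) \<le> exp (2 * B + 1)"
      using weight_sum[OF fin pr] sum_inverse_consecutive_le[OF fin pr] by simp
    show "0 \<le> inverse (totfac P k)"
      unfolding totfac_def
    proof (intro iffD2[OF inverse_nonnegative_iff_nonnegative] prod_nonneg)
      fix p assume "p \<in> P"
      then have "1 \<le> real p" using prime_ge_1_nat[OF pr] by force
      then show "0 \<le> (if k p = 0 then 1 else 1 - 1 / real p)" by (auto simp: field_simps)
    qed
  qed
  finally show ?thesis .
qed

end

text \<open>Relative to the typical valuations \<open>k\<close>, an integer is \<open>upart / dpart\<close> times
  \<open>\<Prod>p\<in>P. p ^ k p\<close>.\<close>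

definition upart :: "nat set \<Rightarrow> (nat \<Rightarrow> nat) \<Rightarrow> (nat \<Rightarrow> nat) \<Rightarrow> nat" where
  "upart P k a = (\<Prod>p\<in>P. p ^ (a p - k p))"

definition dpart :: "nat set \<Rightarrow> (nat \<Rightarrow> nat) \<Rightarrow> (nat \<Rightarrow> nat) \<Rightarrow> real" where
  "dpart P k a = (\<Prod>p\<in>P. real p ^ (k p - a p))"

text \<open>A bound for \<open>totfac P a / totfac P k\<close>: the ratio can be raised only by
  primes at which a positive typical valuation drops to 0.\<close>

definition lossfac :: "nat set \<Rightarrow> (nat \<Rightarrow> nat) \<Rightarrow> (nat \<Rightarrow> nat) \<Rightarrow> real" where
  "lossfac P k a = (\<Prod>p\<in>P. if 0 < k p \<and> a p = 0 then inverse (1 - 1 / real p) else 1)"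

lemma inverse_prime_factor: "1 \<le> inverse (1 - 1 / real p)" "0 < 1 - 1 / real p" if "prime p" for p
proof -
  have "2 \<le> real p" using prime_ge_2_nat[OF that] by simp
  then show "1 \<le> inverse (1 - 1 / real p)" "0 < 1 - 1 / real p" by (simp_all add: field_simps)
qed

lemma totfac_pos: "0 < totfac P a" if "\<And>p. p \<in> P \<Longrightarrow> prime p"
  unfolding totfac_def using inverse_prime_factor(2) that by (intro prod_pos) auto

lemma lossfac_pos: "0 < lossfac P k a" if "\<And>p. p \<in> P \<Longrightarrow> prime p"
  unfolding lossfac_def using inverse_prime_factor(2) that by (intro prod_pos) auto

lemma dpart_pos: "0 < dpart P k a" if "\<And>p. p \<in> P \<Longrightarrow> prime p"
  unfolding dpart_def using prime_gt_0_nat that by (intro prod_pos) auto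

lemma totfac_le_lossfac:
  assumes "\<And>p. p \<in> P \<Longrightarrow> prime p"
  shows "totfac P a \<le> totfac P k * lossfac P k a"
  unfolding totfac_def lossfac_def prod.distrib[symmetric]
proof (rule prod_mono)
  fix p assume "p \<in> P"
  then have "0 < 1 - 1 / real p" using inverse_prime_factor assms by blast
  then show "0 \<le> (if a p = 0 then 1 else 1 - 1 / real p) \<and> (if a p = 0 then 1 else 1 - 1 / real p)
    \<le> (if k p = 0 then 1 else 1 - 1 / real p) * (if 0 < k p \<and> a p = 0 then inverse (1 - 1 / real p) else 1)"
    by (auto simp: field_simps)
qed

context weights
begin

text \<open>An element is recovered from the pair of its excess \<open>upart\<close>, whose
  factorisation shows the valuations above \<open>k\<close>, and its deficit at each prime. The sum
  thus factorises: Rankin's trick bounds the sum over excesses by \<open>X * exp B\<close>, and the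
  deficits give the Euler product of \<open>zeta\<close>.\<close>

lemma sum_structured_le:
  fixes e :: "'a \<Rightarrow> nat \<Rightarrow> nat"
  assumes fin: "finite P" and pr: "\<And>p. p \<in> P \<Longrightarrow> prime p" and W: "finite W"
    and inj: "\<And>v w. v \<in> W \<Longrightarrow> w \<in> W \<Longrightarrow> (\<And>p. p \<in> P \<Longrightarrow> e v p = e w p) \<Longrightarrow> v = w"
    and X: "0 \<le> X"
  shows "(\<Sum>w\<in>{w\<in>W. real (upart P k (e w)) \<le> X}. wdist \<omega> P k (e w) ^ 4 * (lossfac P k (e w) / dpart P k (e w)))
    \<le> X * exp (3 * B + 1) * inverse (totfac P k)"
proof -
  define N where "N = nat \<lfloor>X\<rfloor>"
  define g1 where "g1 u = (\<Prod>p\<in>P. if p dvd u then \<omega> p ^ 4 else 1)" for u :: nat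
  define g2 where "g2 \<delta> = (\<Prod>p\<in>P. zeta p (\<delta> p))" for \<delta> :: "nat \<Rightarrow> nat"
  define \<Delta> where "\<Delta> = PiE P (\<lambda>p. {..k p})"
  define F where "F w = (upart P k (e w), restrict (\<lambda>p. k p - e w p) P)" for w
  let ?W = "{w\<in>W. real (upart P k (e w)) \<le> X}"
  have w4: "1 \<le> \<omega> p ^ 4" for p by (rule weight_power)
  have up_pos: "0 < upart P k a" for a
    unfolding upart_def using pr prime_gt_0_nat by (intro prod_pos) auto
  have zeta0: "0 \<le> zeta p j" if "p \<in> P" for p j
    using w4[of p] inverse_prime_factor(2)[OF pr[OF that]] by (auto simp: zeta_def)
  have "(\<Sum>w\<in>?W. wdist \<omega> P k (e w) ^ 4 * (lossfac P k (e w) / dpart P k (e w))) \<le> (\<Sum>w\<in>?W. case F w of (u, \<delta>) \<Rightarrow> g1 u * g2 \<delta>)"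
  proof (rule sum_mono)
    fix w
    define a where "a = e w"
    have "wdist \<omega> P k a ^ 4 * (lossfac P k a / dpart P k a)
      = (\<Prod>p\<in>P. (if k p = a p then 1 else \<omega> p ^ 4) * ((if 0 < k p \<and> a p = 0 then inverse (1 - 1 / real p) else 1) / real p ^ (k p - a p)))"
      unfolding wdist_def lossfac_def dpart_def prod_power_distrib prod.distrib prod_dividef by (simp add: if_distrib[of "\<lambda>x. x ^ 4"] cong: if_cong)
    also have "\<dots> \<le> (\<Prod>p\<in>P. (if p dvd upart P k a then \<omega> p ^ 4 else 1) * zeta p (k p - a p))"
    proof (rule prod_mono, intro conjI)
      fix p assume p: "p \<in> P"
      note ip = inverse_prime_factor[OF pr[OF p]]
      have pp: "0 < real p" using prime_gt_0_nat[OF pr[OF p]] by simp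
      show "0 \<le> (if k p = a p then 1 else \<omega> p ^ 4) * ((if 0 < k p \<and> a p = 0 then inverse (1 - 1 / real p) else 1) / real p ^ (k p - a p))"
        using ip pp w4[of p] by auto
      have dv: "p dvd upart P k a" if "k p < a p"
      proof -
        have "p dvd p ^ (a p - k p)" using that by simp
        also have "\<dots> dvd upart P k a" unfolding upart_def using p fin by (intro dvd_prodI) auto
        finally show ?thesis .
      qed
      consider "a p = k p" | "k p < a p" | "a p < k p" by linarith
      then show "(if k p = a p then 1 else \<omega> p ^ 4) * ((if 0 < k p \<and> a p = 0 then inverse (1 - 1 / real p) else 1) / real p ^ (k p - a p))
        \<le> (if p dvd upart P k a then \<omega> p ^ 4 else 1) * zeta p (k p - a p)"
      proof cases
        case 3
        have "\<omega> p ^ 4 * ((if 0 < k p \<and> a p = 0 then inverse (1 - 1 / real p) else 1) / real p ^ (k p - a p))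
          \<le> \<omega> p ^ 4 * (inverse (1 - 1 / real p) / real p ^ (k p - a p))"
          using ip pp w4[of p] by (intro mult_left_mono divide_right_mono) auto
        also have "\<dots> = 1 * zeta p (k p - a p)" using 3 by (simp add: zeta_def)
        also have "\<dots> \<le> (if p dvd upart P k a then \<omega> p ^ 4 else 1) * zeta p (k p - a p)"
          using w4[of p] zeta0[OF p] by (intro mult_right_mono) auto
        finally show ?thesis using 3 by simp
      qed (use dv w4[of p] in \<open>auto simp: zeta_def\<close>)
    qed
    also have "\<dots> = g1 (upart P k a) * g2 (restrict (\<lambda>p. k p - a p) P)"
      unfolding g1_def g2_def by (simp add: prod.distrib)
    finally show "wdist \<omega> P k (e w) ^ 4 * (lossfac P k (e w) / dpart P k (e w)) \<le> (case F w of (u, \<delta>) \<Rightarrow> g1 u * g2 \<delta>)"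
      by (simp add: a_def F_def)
  qed
  also have "\<dots> = (\<Sum>(u, \<delta>)\<in>F ` ?W. g1 u * g2 \<delta>)"
  proof (subst sum.reindex)
    show "inj_on F ?W"
    proof (rule inj_onI)
      fix v w assume vw: "v \<in> ?W" "w \<in> ?W" and eq: "F v = F w"
      show "v = w"
      proof (rule inj)
        fix p assume p: "p \<in> P"
        have mu: "multiplicity p (upart P k a) = a p - k p" for a
          unfolding upart_def using multiplicity_prod_prime_powers[OF fin pr pr[OF p]] p by simp
        have "upart P k (e v) = upart P k (e w)" using eq by (simp add: F_def)
        then have "e v p - k p = e w p - k p" using mu[of "e v"] mu[of "e w"] by simp
        moreover have "k p - e v p = k p - e w p"
          using eq p by (auto simp: F_def dest!: fun_cong[of _ _ p])
        ultimately show "e v p = e w p" by linarith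
      qed (use vw in auto)
    qed
  qed simp
  \<comment> \<open>Excess and deficit live on disjoint sets of primes; forgetting this enlarges the
    range to a product.\<close>
  also have "\<dots> \<le> (\<Sum>(u, \<delta>)\<in>{1..N} \<times> \<Delta>. g1 u * g2 \<delta>)"
  proof (rule sum_mono2)
    show "finite ({1..N} \<times> \<Delta>)" using fin by (auto simp: \<Delta>_def intro!: finite_PiE)
    show "F ` ?W \<subseteq> {1..N} \<times> \<Delta>"
    proof (clarify)
      fix u \<delta> w assume w: "w \<in> W" "real (upart P k (e w)) \<le> X" and F: "(u, \<delta>) = F w"
      have "upart P k (e w) \<le> N" using w(2) by (simp add: N_def le_nat_floor)
      then show "u \<in> {1..N} \<and> \<delta> \<in> \<Delta>" using F up_pos[of "e w"] by (auto simp: F_def \<Delta>_def)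
    qed
    show "0 \<le> (case x of (u, \<delta>) \<Rightarrow> g1 u * g2 \<delta>)" for x
    proof (cases x)
      case (Pair u \<delta>)
      have "0 \<le> g1 u" unfolding g1_def
      proof (rule prod_nonneg)
        fix p show "0 \<le> (if p dvd u then \<omega> p ^ 4 else 1)" using w4[of p] by simp
      qed
      moreover have "0 \<le> g2 \<delta>" unfolding g2_def using zeta0 by (intro prod_nonneg) auto
      ultimately show ?thesis using Pair by simp
    qed
  qed
  also have "\<dots> = (\<Sum>u=1..N. g1 u) * (\<Sum>\<delta>\<in>\<Delta>. g2 \<delta>)"
    by (simp add: sum_product sum.cartesian_product)
  also have "(\<Sum>\<delta>\<in>\<Delta>. g2 \<delta>) = (\<Prod>p\<in>P. \<Sum>j\<le>k p. zeta p j)"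
    unfolding g2_def \<Delta>_def using fin by (intro prod_sum_PiE[symmetric]) auto
  also have "(\<Sum>u=1..N. g1 u) * (\<Prod>p\<in>P. \<Sum>j\<le>k p. zeta p j) \<le> (X * exp B) * (inverse (totfac P k) * exp (2 * B + 1))"
  proof (rule mult_mono)
    have "(\<Sum>u=1..N. g1 u) \<le> real N * (\<Prod>p\<in>P. 1 + (\<omega> p ^ 4 - 1) / real p)"
      unfolding g1_def using w4 by (intro sum_prod_prime_divisors_le fin pr)
    also have "\<dots> \<le> X * exp B"
    proof (rule mult_mono)
      show "real N \<le> X" using X by (simp add: N_def)
      have "(\<Prod>p\<in>P. 1 + (\<omega> p ^ 4 - 1) / real p) \<le> (\<Prod>p\<in>P. exp ((\<omega> p ^ 4 - 1) / real p))"
        using w4 by (intro prod_mono conjI exp_ge_add_one_self add_nonneg_nonneg divide_nonneg_nonneg) auto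
      also have "\<dots> \<le> exp B" using weight_sum[OF fin pr] by (simp add: exp_sum[OF fin, symmetric])
      finally show "(\<Prod>p\<in>P. 1 + (\<omega> p ^ 4 - 1) / real p) \<le> exp B" .
      show "0 \<le> (\<Prod>p\<in>P. 1 + (\<omega> p ^ 4 - 1) / real p)"
        using w4 by (intro prod_nonneg add_nonneg_nonneg divide_nonneg_nonneg) auto
    qed (use X in auto)
    finally show "(\<Sum>u=1..N. g1 u) \<le> X * exp B" .
    show "(\<Prod>p\<in>P. \<Sum>j\<le>k p. zeta p j) \<le> inverse (totfac P k) * exp (2 * B + 1)"
      by (rule prod_sum_zeta_le[OF fin pr])
    show "0 \<le> X * exp B" using X by simp
    show "0 \<le> (\<Prod>p\<in>P. \<Sum>j\<le>k p. zeta p j)" using zeta0 by (intro prod_nonneg sum_nonneg) auto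
  qed
  also have "\<dots> = X * exp (3 * B + 1) * inverse (totfac P k)"
  proof -
    have "exp B * exp (2 * B + 1) = exp (3 * B + 1)" by (simp flip: exp_add)
    then show ?thesis by (simp add: mult_ac)
  qed
  finally show ?thesis .
qed

text \<open>For fixed \<open>v\<close> closeness is a bound \<open>X = 1 / (D * \<psi> v)\<close> on
  the excess of \<open>w\<close>. Here \<open>D\<close> cancels against \<open>xi v\<close>, and
  \<open>inverse (totfac P k)\<close> and the remaining \<open>lossfac\<close> are paid for by
  \<open>f v \<le> \<psi> v * totfac P (e v)\<close>. One factor \<open>f v\<close>
  survives.\<close>

lemma side_sum_le:
  fixes e :: "'a \<Rightarrow> nat \<Rightarrow> nat" and k :: "nat \<Rightarrow> nat"
  assumes fin: "finite P" and pr: "\<And>p. p \<in> P \<Longrightarrow> prime p"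
    and V: "admissible P e V \<psi> f" and W: "admissible P e W \<theta> g"
  defines "xi \<equiv> \<lambda>w. lossfac P k (e w) / dpart P k (e w)"
  shows "(\<Sum>v\<in>V. \<Sum>w\<in>W. if dpart P k (e v) * real (upart P k (e w)) * \<psi> v \<le> 1
      then (f v)^2 * (wdist \<omega> P k (e w) ^ 4 * xi w) / xi v else 0) \<le> exp (3 * B + 1) * sum f V"
  unfolding sum_distrib_left
proof (rule sum_mono)
  fix v assume v: "v \<in> V"
  have f: "0 \<le> f v" "f v \<le> \<psi> v * totfac P (e v)" "0 \<le> \<psi> v" using V v by (auto simp: admissible_def)
  let ?c = "\<lambda>w. dpart P k (e v) * real (upart P k (e w)) * \<psi> v \<le> 1"
  show "(\<Sum>w\<in>W. if ?c w then (f v)^2 * (wdist \<omega> P k (e w) ^ 4 * xi w) / xi v else 0) \<le> exp (3 * B + 1) * f v"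
  proof (cases "f v = 0")
    case True
    then show ?thesis by (simp add: sum.neutral)
  next
    case False
    then have f0: "0 < f v" using f by simp
    then have psi: "0 < \<psi> v" using f by (metis less_eq_real_def mult_zero_left not_le)
    define D where "D = dpart P k (e v)"
    have D: "0 < D" unfolding D_def by (rule dpart_pos[OF pr])
    define Tk where "Tk = totfac P k"
    define L where "L = lossfac P k (e v)"
    have TL: "0 < Tk" "0 < L" unfolding Tk_def L_def by (rule totfac_pos[OF pr] lossfac_pos[OF pr]; simp)+
    have finW: "finite W" using W by (simp add: admissible_def)
    have "(\<Sum>w\<in>W. if ?c w then (f v)^2 * (wdist \<omega> P k (e w) ^ 4 * xi w) / xi v else 0)
      = (f v)^2 / xi v * (\<Sum>w\<in>{w\<in>W. real (upart P k (e w)) \<le> 1 / (D * \<psi> v)}. wdist \<omega> P k (e w) ^ 4 * xi w)"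
      unfolding sum_distrib_left using D psi finW
      by (simp add: sum.inter_filter D_def field_simps cong: if_cong)
    also have "\<dots> \<le> (f v)^2 / xi v * (1 / (D * \<psi> v) * exp (3 * B + 1) * inverse Tk)"
      unfolding xi_def Tk_def
      using D psi f W dpart_pos[OF pr, of P k "e v"] lossfac_pos[OF pr, of P k "e v"]
      by (intro mult_left_mono sum_structured_le fin pr) (auto simp: admissible_def)
    also have "\<dots> = exp (3 * B + 1) * f v * (f v / (\<psi> v * (Tk * L)))"
      using D TL psi by (simp add: xi_def D_def[symmetric] L_def[symmetric] power2_eq_square field_simps)
    also have "\<dots> \<le> exp (3 * B + 1) * f v * 1"
    proof (intro mult_left_mono)
      have "f v \<le> \<psi> v * (Tk * L)"
        using f totfac_le_lossfac[OF pr, of P "e v" k] mult_left_mono[OF _ f(3)] unfolding Tk_def L_def by (meson order_trans)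
      then show "f v / (\<psi> v * (Tk * L)) \<le> 1" using psi TL by simp
    qed (use f in auto)
    finally show ?thesis by simp
  qed
qed

end

text \<open>In terms of the integers \<open>v\<close> and \<open>w\<close>: their greatest common
  divisor is at least \<open>w * \<psi> v\<close> and at least
  \<open>v * \<theta> w\<close>.\<close>

definition close_pair :: "nat set \<Rightarrow> ('a \<Rightarrow> nat \<Rightarrow> nat) \<Rightarrow> ('a \<Rightarrow> real) \<Rightarrow> ('a \<Rightarrow> real) \<Rightarrow> 'a \<Rightarrow> 'a \<Rightarrow> bool" where
  "close_pair P e \<psi> \<theta> v w \<longleftrightarrow> rdist P (e v) (e w) * \<psi> v \<le> 1 \<and> rdist P (e w) (e v) * \<theta> w \<le> 1"

lemma sum_over_fibres:
  assumes "finite V" "finite I"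
  shows "(\<Sum>i\<in>I. \<Sum>v\<in>{v\<in>V. h v = i}. F v) = (\<Sum>v\<in>{v\<in>V. h v \<in> I}. F v)"
proof -
  have "(\<Sum>i\<in>I. \<Sum>v\<in>{v\<in>{v\<in>V. h v \<in> I}. h v = i}. F v) = (\<Sum>v\<in>{v\<in>V. h v \<in> I}. F v)"
    using assms by (intro sum.group) auto
  moreover have "{v\<in>{v\<in>V. h v \<in> I}. h v = i} = {v\<in>V. h v = i}" if "i \<in> I" for i
    using that by auto
  ultimately show ?thesis by simp
qed

lemma double_sum_over_fibres:
  fixes t :: "'a \<Rightarrow> 'b \<Rightarrow> real"
  assumes "finite V" "finite W" "finite I"
  shows "(\<Sum>i\<in>I. \<Sum>j\<in>I. \<Sum>v\<in>{v\<in>V. h v = i}. \<Sum>w\<in>{w\<in>W. h' w = j}. t v w)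
    = (\<Sum>v\<in>{v\<in>V. h v \<in> I}. \<Sum>w\<in>{w\<in>W. h' w \<in> I}. t v w)"
proof -
  have "(\<Sum>i\<in>I. \<Sum>j\<in>I. \<Sum>v\<in>{v\<in>V. h v = i}. \<Sum>w\<in>{w\<in>W. h' w = j}. t v w)
    = (\<Sum>i\<in>I. \<Sum>v\<in>{v\<in>V. h v = i}. \<Sum>j\<in>I. \<Sum>w\<in>{w\<in>W. h' w = j}. t v w)"
    by (intro sum.cong refl sum.swap)
  then show ?thesis using assms by (simp add: sum_over_fibres)
qed

lemma admissibleD:
  assumes "admissible P e V \<psi> f"
  shows "finite V" "v \<in> V \<Longrightarrow> 0 \<le> \<psi> v" "v \<in> V \<Longrightarrow> 0 \<le> f v" "v \<in> V \<Longrightarrow> f v \<le> \<psi> v * totfac P (e v)"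
    "v \<in> V \<Longrightarrow> w \<in> V \<Longrightarrow> (\<And>p. p \<in> P \<Longrightarrow> e v p = e w p) \<Longrightarrow> v = w"
  using assms by (auto simp: admissible_def)

text \<open>On a fibre the valuation at \<open>p\<close> is constant, so the other primes still
  separate; deleting \<open>p\<close> can only increase \<open>totfac\<close>; and the mass
  condition is homogeneous, which leaves room for the rescaling by \<open>c\<close>.\<close>

lemma admissible_fibre:
  assumes "admissible P e V \<psi> f" and p: "p \<in> P" "finite P" and pr: "\<And>p. p \<in> P \<Longrightarrow> prime p" and c: "0 \<le> c"
  shows "admissible (P - {p}) e {v\<in>V. e v p = i} (\<lambda>v. c * \<psi> v) (\<lambda>v. c * f v)"
proof -
  note a = admissibleD[OF assms(1)]
  have le: "f v \<le> \<psi> v * totfac (P - {p}) (e v)" if "v \<in> V" for v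
  proof -
    have "totfac P (e v) = (if e v p = 0 then 1 else 1 - 1 / real p) * totfac (P - {p}) (e v)"
      using p by (simp add: totfac_def prod.remove)
    also have "\<dots> \<le> 1 * totfac (P - {p}) (e v)"
      using totfac_pos[of "P - {p}" "e v"] pr by (intro mult_right_mono) auto
    finally have "totfac P (e v) \<le> totfac (P - {p}) (e v)" by simp
    from mult_left_mono[OF this a(2)[OF that]] show ?thesis using a(4)[OF that] by simp
  qed
  show ?thesis unfolding admissible_def
  proof (intro conjI ballI impI)
    fix v w assume vw: "v \<in> {v\<in>V. e v p = i}" "w \<in> {v\<in>V. e v p = i}" "\<forall>q\<in>P - {p}. e v q = e w q"
    show "v = w"
    proof (rule a(5))
      fix q assume "q \<in> P" then show "e v q = e w q" using vw by (cases "q = p") auto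
    qed (use vw in auto)
  qed (use a c le in \<open>auto simp: mult.assoc intro!: mult_left_mono\<close>)
qed

context weights
begin

lemma wdist_ge: "1 \<le> wdist \<omega> P a b"
  unfolding wdist_def using weight_ge by (intro prod_ge_1) auto

lemma M_ge: "1 \<le> M"
  using weight_ge weight_le order_trans by blast

definition pair_term :: "nat set \<Rightarrow> ('a \<Rightarrow> nat \<Rightarrow> nat) \<Rightarrow> ('a \<Rightarrow> real) \<Rightarrow> ('a \<Rightarrow> real) \<Rightarrow> ('a \<Rightarrow> real) \<Rightarrow> ('a \<Rightarrow> real) \<Rightarrow> 'a \<Rightarrow> 'a \<Rightarrow> real" where
  "pair_term P e \<psi> \<theta> f g v w = (if close_pair P e \<psi> \<theta> v w then f v * g w * wdist \<omega> P (e v) (e w) else 0)"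

text \<open>For these pairs \<open>rdist\<close> factors as \<open>dpart \<sqdot> upart\<close> and \<open>wdist\<close> splits, so
  after Cauchy--Schwarz each side is summed freely. The sum over \<open>dpart\<close> is not bounded; it costs
  exactly the factor \<open>totfac\<close> that the masses carry.\<close>

lemma structured_pairs_le:
  fixes e :: "'a \<Rightarrow> nat \<Rightarrow> nat" and k :: "nat \<Rightarrow> nat"
  assumes fin: "finite P" and pr: "\<And>p. p \<in> P \<Longrightarrow> prime p"
    and V: "admissible P e V \<psi> f" and W: "admissible P e W \<theta> g"
  shows "(\<Sum>v\<in>V. \<Sum>w\<in>W. if \<forall>p\<in>P. e v p = k p \<or> e w p = k p then pair_term P e \<psi> \<theta> f g v w else 0)
    \<le> exp ((3 * B + 1) / 2) * root 4 (sum f V) ^ 3 * root 4 (sum g W) ^ 3"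
proof -
  note v = admissibleD[OF V] and w = admissibleD[OF W]
  define Z where "Z = {(v, w). v \<in> V \<and> w \<in> W \<and> (\<forall>p\<in>P. e v p = k p \<or> e w p = k p) \<and> close_pair P e \<psi> \<theta> v w}"
  have ZVW: "Z \<subseteq> V \<times> W" by (auto simp: Z_def)
  have finZ: "finite Z" using ZVW v(1) w(1) finite_subset by blast
  define H where "H v = wdist \<omega> P k (e v)" for v
  define xi where "xi v = lossfac P k (e v) / dpart P k (e v)" for v
  have H: "1 \<le> H v" for v by (simp add: H_def wdist_ge)
  have xi: "0 < xi v" for v unfolding xi_def using lossfac_pos[OF pr] dpart_pos[OF pr] by (intro divide_pos_pos) auto
  define A A' where "A = sum f V" and "A' = sum g W"
  have A: "0 \<le> A" "0 \<le> A'" using v w by (auto simp: A_def A'_def intro: sum_nonneg)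
  have rd: "rdist P a b = dpart P k a * real (upart P k b)" if "\<forall>p\<in>P. a p = k p \<or> b p = k p" for a b
    unfolding rdist_def dpart_def upart_def of_nat_prod prod.distrib[symmetric] using that
    by (intro prod.cong refl) auto
  have wd: "wdist \<omega> P (e v) (e w) = H v * H w" if "(v, w) \<in> Z" for v w
    unfolding H_def wdist_def prod.distrib[symmetric] using that
    by (intro prod.cong refl) (auto simp: Z_def)
  have Zdist: "dpart P k (e v) * real (upart P k (e w)) * \<psi> v \<le> 1" "dpart P k (e w) * real (upart P k (e v)) * \<theta> w \<le> 1"
    if "(v, w) \<in> Z" for v w
  proof -
    have "\<forall>p\<in>P. e v p = k p \<or> e w p = k p" "\<forall>p\<in>P. e w p = k p \<or> e v p = k p" "close_pair P e \<psi> \<theta> v w"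
      using that by (auto simp: Z_def)
    then show "dpart P k (e v) * real (upart P k (e w)) * \<psi> v \<le> 1" "dpart P k (e w) * real (upart P k (e v)) * \<theta> w \<le> 1"
      by (simp_all add: close_pair_def rd)
  qed
  have subZ: "(\<Sum>(v, w)\<in>Z. F v w) \<le> (\<Sum>v\<in>V. \<Sum>w\<in>W. if c v w then F v w else 0)"
    if "\<And>v w. (v, w) \<in> Z \<Longrightarrow> c v w" "\<And>v w. v \<in> V \<Longrightarrow> w \<in> W \<Longrightarrow> 0 \<le> F v w" for F :: "'a \<Rightarrow> 'a \<Rightarrow> real" and c
  proof -
    have "(\<Sum>(v, w)\<in>Z. F v w) = (\<Sum>(v, w)\<in>Z. if c v w then F v w else 0)"
      using that(1) by (intro sum.cong) auto
    also have "\<dots> \<le> (\<Sum>(v, w)\<in>V \<times> W. if c v w then F v w else 0)"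
      using ZVW v(1) w(1) that(2) by (intro sum_mono2) auto
    finally show ?thesis by (simp add: sum.cartesian_product)
  qed
  define S1 S2 where "S1 = (\<Sum>(v, w)\<in>Z. f v * g w * (H v * H w))" and "S2 = (\<Sum>(v, w)\<in>Z. f v * g w * (H v * H w)^2)"
  define C where "C = exp (3 * B + 1)"
  have fgZ: "0 \<le> f v" "0 \<le> g w" if "(v, w) \<in> Z" for v w using that v w by (auto simp: Z_def)
  have S0: "0 \<le> S1" "0 \<le> S2"
  proof -
    have "0 \<le> H v" for v using H[of v] by linarith
    then show "0 \<le> S1" "0 \<le> S2"
      unfolding S1_def S2_def using fgZ by (auto intro!: sum_nonneg mult_nonneg_nonneg)
  qed
  \<comment> \<open>First Cauchy-Schwarz: one factor drops the weights and is bounded trivially by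
    \<open>A * A'\<close>, the other carries them squared.\<close>
  have "S1^2 \<le> (\<Sum>(v, w)\<in>Z. f v * g w) * S2"
  proof -
    have "S1 = (\<Sum>z\<in>Z. (case z of (v, w) \<Rightarrow> sqrt (f v * g w)) * (case z of (v, w) \<Rightarrow> sqrt (f v * g w) * (H v * H w)))"
      unfolding S1_def using fgZ by (intro sum.cong refl) (auto simp: mult.assoc[symmetric])
    then have "S1^2 \<le> (\<Sum>z\<in>Z. (case z of (v, w) \<Rightarrow> sqrt (f v * g w))^2) * (\<Sum>z\<in>Z. (case z of (v, w) \<Rightarrow> sqrt (f v * g w) * (H v * H w))^2)"
      by (simp only: Cauchy_Schwarz_ineq_sum)
    also have "(\<Sum>z\<in>Z. (case z of (v, w) \<Rightarrow> sqrt (f v * g w))^2) = (\<Sum>(v, w)\<in>Z. f v * g w)"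
      using fgZ by (intro sum.cong refl) auto
    also have "(\<Sum>z\<in>Z. (case z of (v, w) \<Rightarrow> sqrt (f v * g w) * (H v * H w))^2) = S2"
      unfolding S2_def using fgZ by (intro sum.cong refl) (auto simp: power_mult_distrib)
    finally show ?thesis .
  qed
  also have "\<dots> \<le> (A * A') * S2"
  proof (intro mult_right_mono S0)
    have "(\<Sum>(v, w)\<in>Z. f v * g w) \<le> (\<Sum>v\<in>V. \<Sum>w\<in>W. if True then f v * g w else 0)"
      using v w by (intro subZ) auto
    then show "(\<Sum>(v, w)\<in>Z. f v * g w) \<le> A * A'" by (simp add: A_def A'_def sum_product)
  qed
  finally have S1S2: "S1^2 \<le> (A * A') * S2" .
  have "S2^2 \<le> (C * A) * (C * A')"
  proof -
    \<comment> \<open>Second Cauchy-Schwarz. The roots of \<open>xi w / xi v\<close> and its inverse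
      cancel in the product, but they make each squared factor summable over one side with the other
      side fixed, in the shape of \<open>side_sum_le\<close>.\<close>
    define a where "a v w = f v * (H w)^2 * sqrt (xi w / xi v)" for v w
    define b where "b v w = g w * (H v)^2 * sqrt (xi v / xi w)" for v w
    have sq: "sqrt (xi w / xi v) * sqrt (xi v / xi w) = 1" for v w
      using xi[of v] xi[of w] by (simp flip: real_sqrt_mult)
    have "S2 = (\<Sum>z\<in>Z. (case z of (v, w) \<Rightarrow> a v w) * (case z of (v, w) \<Rightarrow> b v w))"
      unfolding S2_def
    proof (intro sum.cong refl)
      fix z assume "z \<in> Z"
      obtain v w where z: "z = (v, w)" by force
      have "a v w * b v w = f v * g w * (H v * H w)^2 * (sqrt (xi w / xi v) * sqrt (xi v / xi w))"
        unfolding a_def b_def by (simp add: power_mult_distrib mult_ac)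
      then show "(case z of (v, w) \<Rightarrow> f v * g w * (H v * H w)^2) = (case z of (v, w) \<Rightarrow> a v w) * (case z of (v, w) \<Rightarrow> b v w)"
        unfolding z sq by simp
    qed
    then have "S2^2 \<le> (\<Sum>z\<in>Z. (case z of (v, w) \<Rightarrow> a v w)^2) * (\<Sum>z\<in>Z. (case z of (v, w) \<Rightarrow> b v w)^2)"
      by (simp only: Cauchy_Schwarz_ineq_sum)
    also have "\<dots> \<le> (C * A) * (C * A')"
    proof (rule mult_mono)
      have "(\<Sum>z\<in>Z. (case z of (v, w) \<Rightarrow> a v w)^2) = (\<Sum>(v, w)\<in>Z. (f v)^2 * (H w ^ 4 * xi w) / xi v)"
        using xi by (intro sum.cong refl) (auto simp: a_def power_mult_distrib power_mult[symmetric] less_imp_le)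
      also have "\<dots> \<le> (\<Sum>v\<in>V. \<Sum>w\<in>W. if dpart P k (e v) * real (upart P k (e w)) * \<psi> v \<le> 1 then (f v)^2 * (H w ^ 4 * xi w) / xi v else 0)"
        using Zdist xi by (intro subZ) (auto simp: less_imp_le)
      also have "\<dots> \<le> C * A"
        unfolding H_def xi_def C_def A_def by (rule side_sum_le[OF fin pr V W])
      finally show "(\<Sum>z\<in>Z. (case z of (v, w) \<Rightarrow> a v w)^2) \<le> C * A" .
      have "(\<Sum>z\<in>Z. (case z of (v, w) \<Rightarrow> b v w)^2) = (\<Sum>(v, w)\<in>Z. (g w)^2 * (H v ^ 4 * xi v) / xi w)"
        using xi by (intro sum.cong refl) (auto simp: b_def power_mult_distrib power_mult[symmetric] less_imp_le)
      also have "\<dots> \<le> (\<Sum>v\<in>V. \<Sum>w\<in>W. if dpart P k (e w) * real (upart P k (e v)) * \<theta> w \<le> 1 then (g w)^2 * (H v ^ 4 * xi v) / xi w else 0)"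
        using Zdist xi by (intro subZ) (auto simp: less_imp_le)
      also have "\<dots> = (\<Sum>w\<in>W. \<Sum>v\<in>V. if dpart P k (e w) * real (upart P k (e v)) * \<theta> w \<le> 1 then (g w)^2 * (H v ^ 4 * xi v) / xi w else 0)"
        by (rule sum.swap)
      also have "\<dots> \<le> C * A'"
        unfolding H_def xi_def C_def A'_def by (rule side_sum_le[OF fin pr W V])
      finally show "(\<Sum>z\<in>Z. (case z of (v, w) \<Rightarrow> b v w)^2) \<le> C * A'" .
    qed (use A in \<open>auto simp: C_def intro!: sum_nonneg\<close>)
    finally show ?thesis .
  qed
  \<comment> \<open>Combining both estimates gives \<open>S1 ^ 4 \<le> C^2 * A ^ 3 * A' ^ 3\<close>,
    the origin of the exponent 3/4.\<close>
  then have "(A * A')^2 * S2^2 \<le> (A * A')^2 * ((C * A) * (C * A'))" by (intro mult_left_mono) auto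
  moreover have "(S1^2)^2 \<le> ((A * A') * S2)^2" using S1S2 by (intro power_mono) auto
  ultimately have four: "S1 ^ 4 \<le> C^2 * A ^ 3 * A' ^ 3"
  proof -
    have "S1 ^ 4 = (S1^2)^2" "((A * A') * S2)^2 = (A * A')^2 * S2^2"
      "(A * A')^2 * ((C * A) * (C * A')) = C^2 * A ^ 3 * A' ^ 3"
      by (simp_all add: power_mult_distrib) (simp add: power2_eq_square power3_eq_cube)
    then show ?thesis
      using \<open>(A * A')^2 * S2^2 \<le> _\<close> \<open>(S1^2)^2 \<le> _\<close> by linarith
  qed
  have "S1 \<le> exp ((3 * B + 1) / 2) * root 4 A ^ 3 * root 4 A' ^ 3"
  proof (rule power_le_imp_le_base)
    have r: "(root 4 x ^ 3) ^ Suc 3 = x ^ 3" if "0 \<le> x" for x :: real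
    proof -
      have "(root 4 x ^ 3) ^ Suc 3 = (root 4 x ^ 4) ^ 3" by (simp flip: power_mult)
      then show ?thesis using that by simp
    qed
    have "exp ((3 * B + 1) / 2) ^ Suc 3 = C^2"
      unfolding C_def by (simp flip: exp_of_nat_mult)
    then show "S1 ^ Suc 3 \<le> (exp ((3 * B + 1) / 2) * root 4 A ^ 3 * root 4 A' ^ 3) ^ Suc 3"
      using four by (simp only: power_mult_distrib r A) simp
  qed (use A in auto)
  moreover have "(\<Sum>v\<in>V. \<Sum>w\<in>W. if \<forall>p\<in>P. e v p = k p \<or> e w p = k p then pair_term P e \<psi> \<theta> f g v w else 0) = S1"
  proof -
    have "(\<Sum>v\<in>V. \<Sum>w\<in>W. if \<forall>p\<in>P. e v p = k p \<or> e w p = k p then pair_term P e \<psi> \<theta> f g v w else 0)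
      = (\<Sum>(v, w)\<in>V \<times> W. if (v, w) \<in> Z then f v * g w * (H v * H w) else 0)"
      unfolding sum.cartesian_product by (intro sum.cong refl) (auto simp: pair_term_def wd, auto simp: Z_def)
    also have "\<dots> = S1" unfolding S1_def
      using ZVW v(1) w(1) by (intro sum.mono_neutral_cong_right) auto
    finally show ?thesis .
  qed
  ultimately show ?thesis by (simp add: A_def A'_def)
qed

lemma pair_term_nonneg: "0 \<le> f v \<Longrightarrow> 0 \<le> g w \<Longrightarrow> 0 \<le> pair_term P e \<psi> \<theta> f g v w"
  unfolding pair_term_def using wdist_ge[of P "e v" "e w"] by auto

text \<open>Two fibres at distance \<open>d\<close> are rescaled by powers of \<open>p\<close> of
  total exponent \<open>d\<close>. The induction hypothesis returns this power to the exponent 3/4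
  while it is divided out in full, so \<open>p powr (- 1/4)\<close> remains per unit of distance,
  times the weight of a prime with different valuations.\<close>

definition decay :: "nat \<Rightarrow> nat \<Rightarrow> nat \<Rightarrow> real" where
  "decay p i j = (if i = j then 1 else \<omega> p) * root 4 (1 / real p) ^ nat_dist i j"

lemma decay_le: "i \<noteq> j \<Longrightarrow> decay p i j \<le> M * root 4 (1 / real p) ^ nat_dist i j"
  unfolding decay_def using weight_le by (auto intro!: mult_right_mono)

lemma decay_diag: "decay p i i \<le> 1"
  by (simp add: decay_def nat_dist_def)

lemma decay_nonneg: "0 \<le> decay p i j"
  unfolding decay_def using weight_ge[of p] by auto

text \<open>Closeness at \<open>p\<close> is absorbed into the sizes: with truncated subtraction at
  most one of \<open>c\<close> and \<open>c'\<close> differs from 1. The masses are scaled along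
  with the sizes to keep the fibres admissible.\<close>

lemma pair_term_fibre:
  assumes p: "p \<in> P" "finite P" "prime p" and v: "e v p = i" and w: "e w p = j"
  defines "c \<equiv> real p ^ (j - i)" and "c' \<equiv> real p ^ (i - j)"
  shows "pair_term P e \<psi> \<theta> f g v w = (if i = j then 1 else \<omega> p) / (c * c') *
    pair_term (P - {p}) e (\<lambda>v. c * \<psi> v) (\<lambda>w. c' * \<theta> w) (\<lambda>v. c * f v) (\<lambda>w. c' * g w) v w"
proof -
  have p0: "0 < real p" using p prime_gt_0_nat by simp
  have cc: "0 < c" "0 < c'" using p0 by (auto simp: c_def c'_def)
  have "rdist P (e v) (e w) = c * rdist (P - {p}) (e v) (e w)" "rdist P (e w) (e v) = c' * rdist (P - {p}) (e w) (e v)"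
    using p v w by (simp_all add: rdist_def c_def c'_def prod.remove)
  then have cp: "close_pair P e \<psi> \<theta> v w \<longleftrightarrow> close_pair (P - {p}) e (\<lambda>v. c * \<psi> v) (\<lambda>w. c' * \<theta> w) v w"
    by (simp add: close_pair_def mult_ac)
  have wd: "wdist \<omega> P (e v) (e w) = (if i = j then 1 else \<omega> p) * wdist \<omega> (P - {p}) (e v) (e w)"
    using p v w by (simp add: wdist_def prod.remove)
  show ?thesis unfolding pair_term_def cp wd using cc by (simp add: field_simps)
qed

lemma root4_scale:
  assumes p: "0 < (p::real)" and A: "0 \<le> A" "0 \<le> A'"
  shows "root 4 (p ^ m * A) ^ 3 * root 4 (p ^ n * A') ^ 3 / (p ^ m * p ^ n)
    = root 4 (1 / p) ^ (m + n) * (root 4 A ^ 3 * root 4 A' ^ 3)"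
proof -
  define q where "q = root 4 p"
  have q: "0 < q" "q ^ 4 = p" using p by (auto simp: q_def)
  have L: "root 4 (p ^ k * z) = q ^ k * root 4 z" for k z
    unfolding q_def using p by (simp add: real_root_mult real_root_power)
  have R: "p ^ m * p ^ n = (q ^ m) ^ 3 * q ^ m * ((q ^ n) ^ 3 * q ^ n)"
    unfolding q(2)[symmetric] by (simp flip: power_mult power_add)
  have I: "root 4 (1 / p) = 1 / q" by (simp add: q_def real_root_divide)
  show ?thesis unfolding L R I power_add power_one_over power_mult_distrib using q(1) by (simp add: field_simps)
qed

lemma fibre_sum_le:
  assumes p: "p \<in> P" "finite P" and pr: "\<And>p. p \<in> P \<Longrightarrow> prime p"
    and V: "admissible P e V \<psi> f" and W: "admissible P e W \<theta> g"
    and IH: "\<And>V W \<psi> \<theta> f g. admissible (P - {p}) e V \<psi> f \<Longrightarrow> admissible (P - {p}) e W \<theta> g \<Longrightarrow>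
      (\<Sum>v\<in>V. \<Sum>w\<in>W. pair_term (P - {p}) e \<psi> \<theta> f g v w) \<le> K * root 4 (sum f V) ^ 3 * root 4 (sum g W) ^ 3"
  shows "(\<Sum>v\<in>{v\<in>V. e v p = i}. \<Sum>w\<in>{w\<in>W. e w p = j}. pair_term P e \<psi> \<theta> f g v w)
    \<le> K * (decay p i j * root 4 (sum f {v\<in>V. e v p = i}) ^ 3 * root 4 (sum g {w\<in>W. e w p = j}) ^ 3)"
proof -
  define c where "c = real p ^ (j - i)"
  define c' where "c' = real p ^ (i - j)"
  define o' where "o' = (if i = j then 1 else \<omega> p)"
  have o': "0 \<le> o'" using weight_ge[of p] by (auto simp: o'_def)
  have p0: "0 < real p" using p pr prime_gt_0_nat by simp
  have cc: "0 < c" "0 < c'" using p0 by (auto simp: c_def c'_def)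
  let ?V = "{v\<in>V. e v p = i}" and ?W = "{w\<in>W. e w p = j}"
  have "(\<Sum>v\<in>?V. \<Sum>w\<in>?W. pair_term P e \<psi> \<theta> f g v w)
    = o' / (c * c') * (\<Sum>v\<in>?V. \<Sum>w\<in>?W. pair_term (P - {p}) e (\<lambda>v. c * \<psi> v) (\<lambda>w. c' * \<theta> w) (\<lambda>v. c * f v) (\<lambda>w. c' * g w) v w)"
    unfolding sum_distrib_left
    by (intro sum.cong refl) (use p pr pair_term_fibre[of p P e _ i _ j] in \<open>auto simp: c_def c'_def o'_def\<close>)
  also have "\<dots> \<le> o' / (c * c') * (K * root 4 (\<Sum>v\<in>?V. c * f v) ^ 3 * root 4 (\<Sum>w\<in>?W. c' * g w) ^ 3)"
    using cc o' by (intro mult_left_mono IH admissible_fibre[OF V p pr] admissible_fibre[OF W p pr]) auto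
  also have "\<dots> = K * (o' * (root 4 (c * sum f ?V) ^ 3 * root 4 (c' * sum g ?W) ^ 3 / (c * c')))"
    by (simp add: sum_distrib_left)
  also have "root 4 (c * sum f ?V) ^ 3 * root 4 (c' * sum g ?W) ^ 3 / (c * c')
      = root 4 (1 / real p) ^ nat_dist i j * (root 4 (sum f ?V) ^ 3 * root 4 (sum g ?W) ^ 3)"
    unfolding c_def c'_def using admissibleD(3)[OF V] admissibleD(3)[OF W]
    by (subst root4_scale[OF p0]) (auto intro!: sum_nonneg simp: nat_dist_def add.commute)
  finally show ?thesis by (simp add: decay_def o'_def mult_ac)
qed

text \<open>Primes up to \<open>p0\<close> are removed first, each at the cost of a factor
  \<open>c1\<close>. Once none is left, all primes are examined together and the constant may not
  grow. \<open>K1\<close> is twice the constant for structured pairs, since these account for at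
  least half of a total that violates the bound.\<close>

theorem bilinear_bound_primes:
  fixes e :: "'a \<Rightarrow> nat \<Rightarrow> nat" and p0 :: nat
  assumes p0: "\<And>p. prime p \<Longrightarrow> p0 < p \<Longrightarrow> 2048 * M * root 4 (1 / real p) \<le> 1"
    "\<And>Q. finite Q \<Longrightarrow> (\<And>q. q \<in> Q \<Longrightarrow> p0 < q) \<Longrightarrow> (\<Sum>q\<in>Q. 2 ^ 22 * M ^ 6 * root 4 (1 / real q) ^ 6) \<le> 1 / 2"
  assumes "finite P" "\<And>p. p \<in> P \<Longrightarrow> prime p" "admissible P e V \<psi> f" "admissible P e W \<theta> g"
  defines "K1 \<equiv> 2 * exp ((3 * B + 1) / 2)" and "c1 \<equiv> 1 + 2 * M / (1 - root 4 (1 / 2))"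
  shows "(\<Sum>v\<in>V. \<Sum>w\<in>W. pair_term P e \<psi> \<theta> f g v w)
    \<le> K1 * c1 ^ card {p\<in>P. p \<le> p0} * root 4 (sum f V) ^ 3 * root 4 (sum g W) ^ 3"
  using assms(3-6)
proof (induction P arbitrary: V W \<psi> \<theta> f g rule: finite_psubset_induct)
  case (psubset P)
  note fin = \<open>finite P\<close> and pr = psubset.prems(1) and V = psubset.prems(2) and W = psubset.prems(3)
  note v = admissibleD[OF V] and w = admissibleD[OF W]
  define A A' where "A = sum f V" and "A' = sum g W"
  define a a' where "a = root 4 A" and "a' = root 4 A'"
  let ?t = "pair_term P e \<psi> \<theta> f g"
  define T where "T = (\<Sum>v\<in>V. \<Sum>w\<in>W. ?t v w)"
  have A0: "0 \<le> A" "0 \<le> A'" using v w by (auto simp: A_def A'_def intro: sum_nonneg)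
  have r2: "0 < root 4 (1/2 :: real)" "root 4 (1/2 :: real) < 1" by auto
  have c1: "1 \<le> c1" using r2 M_ge by (simp add: c1_def)
  have K1: "0 < K1" by (simp add: K1_def)
  have t0: "v \<in> V \<Longrightarrow> w \<in> W \<Longrightarrow> 0 \<le> ?t v w" for v w using v w by (intro pair_term_nonneg) auto
  show ?case
  proof (cases "A = 0 \<or> A' = 0")
    case True
    then have "(\<forall>v\<in>V. f v = 0) \<or> (\<forall>w\<in>W. g w = 0)"
      using v w by (auto simp: A_def A'_def sum_nonneg_eq_0_iff)
    then have "T = 0" unfolding T_def by (auto intro!: sum.neutral simp: pair_term_def)
    then show ?thesis using K1 c1 v w unfolding T_def
      by (auto intro!: mult_nonneg_nonneg sum_nonneg)
  next
    case False
    then have Apos: "0 < A" "0 < A'" using A0 by auto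
    then have apos: "0 < a" "0 < a'" by (auto simp: a_def a'_def)
    have a4: "a ^ 4 = A" "a' ^ 4 = A'" using A0 by (auto simp: a_def a'_def)
    obtain n where n: "\<And>v p. v \<in> V \<union> W \<Longrightarrow> p \<in> P \<Longrightarrow> e v p \<le> n"
    proof -
      have "finite ((\<lambda>(v, p). e v p) ` ((V \<union> W) \<times> P))" using v(1) w(1) fin by auto
      then obtain n where "\<forall>x\<in>(\<lambda>(v, p). e v p) ` ((V \<union> W) \<times> P). x \<le> n" using finite_nat_set_iff_bounded_le by blast
      then show thesis by (intro that[of n]) auto
    qed
    define x where "x p i = root 4 (sum f {v\<in>V. e v p = i}) / a" for p i
    define y where "y p i = root 4 (sum g {w\<in>W. e w p = i}) / a'" for p i
    have xy0: "0 \<le> x p i" "0 \<le> y p i" for p i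
      unfolding x_def y_def using apos v w by (auto intro!: divide_nonneg_pos sum_nonneg)
    have xy4: "(\<Sum>i\<le>n. x p i ^ 4) = 1" "(\<Sum>i\<le>n. y p i ^ 4) = 1" if p: "p \<in> P" for p
    proof -
      have "{v\<in>V. e v p \<in> {..n}} = V" "{w\<in>W. e w p \<in> {..n}} = W" using n p by auto
      then have s: "(\<Sum>i\<le>n. sum f {v\<in>V. e v p = i}) = A" "(\<Sum>i\<le>n. sum g {w\<in>W. e w p = i}) = A'"
        using sum_over_fibres[OF v(1), where I = "{..n}" and h = "\<lambda>v. e v p" and F = f]
          sum_over_fibres[OF w(1), where I = "{..n}" and h = "\<lambda>v. e v p" and F = g]
        by (auto simp: A_def A'_def)
      have "x p i ^ 4 = sum f {v\<in>V. e v p = i} / A" "y p i ^ 4 = sum g {w\<in>W. e w p = i} / A'" for i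
      proof -
        have "0 \<le> sum f {v\<in>V. e v p = i}" "0 \<le> sum g {w\<in>W. e w p = i}"
          using v(3) w(3) by (auto intro: sum_nonneg)
        then show "x p i ^ 4 = sum f {v\<in>V. e v p = i} / A" "y p i ^ 4 = sum g {w\<in>W. e w p = i} / A'"
          unfolding x_def y_def power_divide a4 by simp_all
      qed
      then show "(\<Sum>i\<le>n. x p i ^ 4) = 1" "(\<Sum>i\<le>n. y p i ^ 4) = 1"
        using Apos by (simp_all add: sum_divide_distrib[symmetric] s)
    qed
    define K where "K p = K1 * c1 ^ card {q\<in>P - {p}. q \<le> p0}" for p
    have K0: "0 < K p" for p using K1 c1 by (simp add: K_def)
    have fib: "(\<Sum>v\<in>{v\<in>V. e v p = i}. \<Sum>w\<in>{w\<in>W. e w p = j}. ?t v w)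
        \<le> K p * (a ^ 3 * a' ^ 3) * (decay p i j * x p i ^ 3 * y p j ^ 3)" if p: "p \<in> P" for p i j
    proof -
      have "(\<Sum>v\<in>{v\<in>V. e v p = i}. \<Sum>w\<in>{w\<in>W. e w p = j}. ?t v w)
        \<le> K p * (decay p i j * root 4 (sum f {v\<in>V. e v p = i}) ^ 3 * root 4 (sum g {w\<in>W. e w p = j}) ^ 3)"
      proof (rule fibre_sum_le[OF p fin pr V W])
        fix V W :: "'a set" and \<psi> \<theta> f g :: "'a \<Rightarrow> real"
        assume "admissible (P - {p}) e V \<psi> f" "admissible (P - {p}) e W \<theta> g"
        then show "(\<Sum>v\<in>V. \<Sum>w\<in>W. pair_term (P - {p}) e \<psi> \<theta> f g v w) \<le> K p * root 4 (sum f V) ^ 3 * root 4 (sum g W) ^ 3"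
          unfolding K_def using p pr by (intro psubset.IH) auto
      qed auto
      moreover have "root 4 (sum f {v\<in>V. e v p = i}) = a * x p i" "root 4 (sum g {w\<in>W. e w p = j}) = a' * y p j"
        using apos by (auto simp: x_def y_def)
      ultimately show ?thesis by (simp add: power_mult_distrib mult_ac)
    qed
    have restr: "(\<Sum>v\<in>{v\<in>V. e v p \<in> I}. \<Sum>w\<in>{w\<in>W. e w p \<in> I}. ?t v w)
        \<le> K p * (a ^ 3 * a' ^ 3) * (\<Sum>i\<in>I. \<Sum>j\<in>I. decay p i j * x p i ^ 3 * y p j ^ 3)" if p: "p \<in> P" and I: "finite I" for p I
      unfolding double_sum_over_fibres[OF v(1) w(1) I, symmetric] sum_distrib_left
      by (intro sum_mono fib p)
    have whole: "T \<le> K p * (a ^ 3 * a' ^ 3) * (\<Sum>i\<le>n. \<Sum>j\<le>n. decay p i j * x p i ^ 3 * y p j ^ 3)" if p: "p \<in> P" for p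
    proof -
      have "{v\<in>V. e v p \<in> {..n}} = V" "{w\<in>W. e w p \<in> {..n}} = W" using n p by auto
      then show ?thesis using restr[OF p, of "{..n}"] by (simp add: T_def)
    qed
    have rp: "0 \<le> root 4 (1 / real p)" "root 4 (1 / real p) \<le> root 4 (1 / 2)" if "p \<in> P" for p
      using prime_ge_2_nat[OF pr[OF that]] by (auto intro!: divide_left_mono simp: field_simps)
    have "T \<le> K1 * c1 ^ card {p\<in>P. p \<le> p0} * a ^ 3 * a' ^ 3"
    proof (cases "\<exists>p\<in>P. p \<le> p0")
      \<comment> \<open>A prime up to \<open>p0\<close>: no typical valuation is sought. Schur's
        test bounds the normalised form by \<open>c1\<close>, which is computed from the worst case
        \<open>p = 2\<close>.\<close>
      case True
      then obtain p where p: "p \<in> P" "p \<le> p0" by blast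
      define r where "r = root 4 (1 / real p)"
      have r: "0 \<le> r" "r \<le> root 4 (1 / 2)" "r < 1" using rp[OF p(1)] r2 by (auto simp: r_def)
      have six: "(\<Sum>i\<le>n. (z i ^ 3)^2) \<le> 1" if "\<And>i. 0 \<le> z i" "(\<Sum>i\<le>n. z i ^ 4) = 1" for z :: "nat \<Rightarrow> real"
      proof -
        have "(z i)^2 \<le> 1" if "i \<in> {..n}" for i
        proof -
          have "z i ^ 4 \<le> (\<Sum>i\<le>n. z i ^ 4)" using that by (intro member_le_sum) auto
          then show ?thesis using \<open>(\<Sum>i\<le>n. z i ^ 4) = 1\<close> \<open>\<And>i. 0 \<le> z i\<close> by (simp add: power_le_one_iff)
        qed
        then have "(\<Sum>i\<le>n. (z i ^ 3)^2) \<le> 1 * (\<Sum>i\<le>n. z i ^ 4)" by (intro sixth_le_fourth) auto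
        then show ?thesis using that by simp
      qed
      have kl: "decay p i j \<le> M * r ^ nat_dist i j" if "i \<noteq> j" for i j
        unfolding r_def using that by (rule decay_le)
      have "(\<Sum>i\<le>n. \<Sum>j\<le>n. decay p i j * x p i ^ 3 * y p j ^ 3)
        \<le> (1/2 + M * r / (1 - r)) * ((\<Sum>i\<le>n. (x p i ^ 3)^2) + (\<Sum>i\<le>n. (y p i ^ 3)^2))"
        using M_ge xy0 r by (intro schur_full[where n = n] kl decay_diag) auto
      also have "\<dots> \<le> (1/2 + M * r / (1 - r)) * (1 + 1)"
      proof (intro mult_left_mono add_mono six xy0 xy4 p)
        have "0 \<le> M * r / (1 - r)" using M_ge r(1) r(3) by (intro divide_nonneg_pos mult_nonneg_nonneg; linarith)
        then show "0 \<le> 1 / 2 + M * r / (1 - r)" by linarith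
      qed
      also have "\<dots> = 1 + 2 * (M * r / (1 - r))" by simp
      also have "M * r / (1 - r) \<le> M * 1 / (1 - root 4 (1/2))"
      proof (intro frac_le mult_left_mono)
        show "r \<le> 1" using r(3) by simp
      qed (use M_ge r(2) r2 in auto)
      finally have "(\<Sum>i\<le>n. \<Sum>j\<le>n. decay p i j * x p i ^ 3 * y p j ^ 3) \<le> c1" by (simp add: c1_def)
      then have "T \<le> K p * (a ^ 3 * a' ^ 3) * c1"
        using whole[OF p(1)] K0[of p] apos by (meson less_imp_le mult_left_mono mult_nonneg_nonneg order_trans zero_le_power)
      moreover have "card {q\<in>P. q \<le> p0} = Suc (card {q\<in>P - {p}. q \<le> p0})"
      proof -
        have "{q\<in>P. q \<le> p0} = insert p {q\<in>P - {p}. q \<le> p0}" using p by auto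
        then show ?thesis using fin by simp
      qed
      ultimately show ?thesis by (simp add: K_def mult_ac)
    next
      case False
      then have big: "p0 < p" if "p \<in> P" for p using that by force
      then have "{q\<in>P. q \<le> p0} = {}" and e0: "{q\<in>P - {p}. q \<le> p0} = {}" for p by force+
      have Kp: "K p = K1" for p by (simp only: K_def e0 card.empty power_0 mult_1_right)
      have "T \<le> K1 * (a ^ 3 * a' ^ 3)"
      proof (rule ccontr)
        \<comment> \<open>If the bound fails, \<open>whole\<close> makes the normalised form exceed
          1 at every prime, so the dichotomy supplies a typical valuation for each. The failure also
          allows \<open>T\<close> to replace \<open>K1 * (a ^ 3 * a' ^ 3)\<close> in the estimate of
          pairs that are atypical on both sides at some prime; their total is at most
          \<open>T / 2\<close> and is absorbed.\<close>
        assume "\<not> T \<le> K1 * (a ^ 3 * a' ^ 3)"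
        then have T: "K1 * (a ^ 3 * a' ^ 3) < T" by simp
        have "\<exists>k. (\<Sum>i\<in>{..n}-{k}. \<Sum>j\<in>{..n}-{k}. decay p i j * x p i ^ 3 * y p j ^ 3) \<le> 2 ^ 22 * M ^ 6 * root 4 (1 / real p) ^ 6"
          if p: "p \<in> P" for p
        proof (rule dichotomy[OF xy0 xy4[OF p] M_ge])
          show "1 < (\<Sum>i\<le>n. \<Sum>j\<le>n. decay p i j * x p i ^ 3 * y p j ^ 3)"
          proof (rule ccontr)
            assume "\<not> ?thesis"
            then have "K1 * (a ^ 3 * a' ^ 3) * (\<Sum>i\<le>n. \<Sum>j\<le>n. decay p i j * x p i ^ 3 * y p j ^ 3) \<le> K1 * (a ^ 3 * a' ^ 3) * 1"
              using K1 apos by (intro mult_left_mono) auto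
            then show False using whole[OF p] T by (simp add: Kp)
          qed
          show "0 \<le> root 4 (1 / real p)" by (rule rp(1)[OF p])
          show "2048 * M * root 4 (1 / real p) \<le> 1" by (rule p0(1)[OF pr[OF p] big[OF p]])
          show "decay p i i \<le> 1" for i by (rule decay_diag)
          show "decay p i j \<le> M * root 4 (1 / real p) ^ nat_dist i j" if "i \<noteq> j" for i j using that by (rule decay_le)
        qed
        moreover define Q where "Q p k \<longleftrightarrow> (\<Sum>i\<in>{..n}-{k}. \<Sum>j\<in>{..n}-{k}. decay p i j * x p i ^ 3 * y p j ^ 3)
            \<le> 2 ^ 22 * M ^ 6 * root 4 (1 / real p) ^ 6" for p k
        ultimately have "\<forall>p\<in>P. \<exists>k. Q p k" by blast
        then obtain k where "\<forall>p\<in>P. Q p (k p)" by metis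
        then have k: "(\<Sum>i\<in>{..n}-{k p}. \<Sum>j\<in>{..n}-{k p}. decay p i j * x p i ^ 3 * y p j ^ 3)
            \<le> 2 ^ 22 * M ^ 6 * root 4 (1 / real p) ^ 6" if "p \<in> P" for p using that by (simp only: Q_def)
        have "0 < K1 * (a ^ 3 * a' ^ 3)" using K1 apos by simp
        then have T0: "0 \<le> T" using T by linarith
        define good where "good v w \<longleftrightarrow> (\<forall>p\<in>P. e v p = k p \<or> e w p = k p)" for v w
        have cover: "?t v w \<le> (if good v w then ?t v w else 0) + (\<Sum>p\<in>P. if e v p \<noteq> k p \<and> e w p \<noteq> k p then ?t v w else 0)"
          if "v \<in> V" "w \<in> W" for v w
        proof (cases "good v w")
          case False
          then obtain p where p: "p \<in> P" "e v p \<noteq> k p" "e w p \<noteq> k p" by (auto simp: good_def)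
          have "(if e v p \<noteq> k p \<and> e w p \<noteq> k p then ?t v w else 0) \<le> (\<Sum>p\<in>P. if e v p \<noteq> k p \<and> e w p \<noteq> k p then ?t v w else 0)"
            using fin p t0[OF that] by (intro member_le_sum) auto
          then show ?thesis using p False by simp
        qed (use t0[OF that] in \<open>auto intro!: sum_nonneg\<close>)
        have "T \<le> (\<Sum>v\<in>V. \<Sum>w\<in>W. (if good v w then ?t v w else 0) + (\<Sum>p\<in>P. if e v p \<noteq> k p \<and> e w p \<noteq> k p then ?t v w else 0))"
          unfolding T_def using cover by (intro sum_mono) auto
        also have "\<dots> = (\<Sum>v\<in>V. \<Sum>w\<in>W. if good v w then ?t v w else 0)
            + (\<Sum>v\<in>V. \<Sum>w\<in>W. \<Sum>p\<in>P. if e v p \<noteq> k p \<and> e w p \<noteq> k p then ?t v w else 0)"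
          by (simp add: sum.distrib)
        also have "(\<Sum>v\<in>V. \<Sum>w\<in>W. \<Sum>p\<in>P. if e v p \<noteq> k p \<and> e w p \<noteq> k p then ?t v w else 0)
            = (\<Sum>p\<in>P. \<Sum>v\<in>V. \<Sum>w\<in>W. if e v p \<noteq> k p \<and> e w p \<noteq> k p then ?t v w else 0)"
        proof -
          have "(\<Sum>v\<in>V. \<Sum>w\<in>W. \<Sum>p\<in>P. if e v p \<noteq> k p \<and> e w p \<noteq> k p then ?t v w else 0)
            = (\<Sum>v\<in>V. \<Sum>p\<in>P. \<Sum>w\<in>W. if e v p \<noteq> k p \<and> e w p \<noteq> k p then ?t v w else 0)"
            by (intro sum.cong refl sum.swap)
          also have "\<dots> = (\<Sum>p\<in>P. \<Sum>v\<in>V. \<Sum>w\<in>W. if e v p \<noteq> k p \<and> e w p \<noteq> k p then ?t v w else 0)"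
            by (rule sum.swap)
          finally show ?thesis .
        qed
        also have "\<dots> \<le> (\<Sum>p\<in>P. T * (2 ^ 22 * M ^ 6 * root 4 (1 / real p) ^ 6))"
        proof (rule sum_mono)
          fix p assume p: "p \<in> P"
          let ?I = "{..n} - {k p}"
          have I: "{v\<in>V. e v p \<in> ?I} = {v\<in>V. e v p \<noteq> k p}" "{w\<in>W. e w p \<in> ?I} = {w\<in>W. e w p \<noteq> k p}" using n p by auto
          have "(\<Sum>v\<in>V. \<Sum>w\<in>W. if e v p \<noteq> k p \<and> e w p \<noteq> k p then ?t v w else 0)
              = (\<Sum>v\<in>V. if e v p \<noteq> k p then \<Sum>w\<in>W. if e w p \<noteq> k p then ?t v w else 0 else 0)"
            by (intro sum.cong refl) auto
          also have "\<dots> = (\<Sum>v\<in>{v\<in>V. e v p \<in> ?I}. \<Sum>w\<in>{w\<in>W. e w p \<in> ?I}. ?t v w)"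
            unfolding I using v(1) w(1) by (simp only: sum.inter_filter)
          also have "\<dots> \<le> K1 * (a ^ 3 * a' ^ 3) * (\<Sum>i\<in>?I. \<Sum>j\<in>?I. decay p i j * x p i ^ 3 * y p j ^ 3)"
            using restr[OF p, of ?I] by (simp add: Kp)
          also have "\<dots> \<le> T * (2 ^ 22 * M ^ 6 * root 4 (1 / real p) ^ 6)"
            using decay_nonneg xy0
            by (intro mult_mono[OF less_imp_le[OF T] k[OF p] T0] sum_nonneg mult_nonneg_nonneg) auto
          finally show "(\<Sum>v\<in>V. \<Sum>w\<in>W. if e v p \<noteq> k p \<and> e w p \<noteq> k p then ?t v w else 0) \<le> T * (2 ^ 22 * M ^ 6 * root 4 (1 / real p) ^ 6)" .
        qed
        also have "\<dots> \<le> T * (1 / 2)"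
          using mult_left_mono[OF p0(2)[OF fin big] T0] by (simp only: sum_distrib_left)
        also have "(\<Sum>v\<in>V. \<Sum>w\<in>W. if good v w then ?t v w else 0) \<le> exp ((3 * B + 1) / 2) * a ^ 3 * a' ^ 3"
          unfolding good_def a_def a'_def A_def A'_def by (rule structured_pairs_le[OF fin pr V W])
        finally have "T \<le> 2 * (exp ((3 * B + 1) / 2) * a ^ 3 * a' ^ 3)" by simp
        then show False using T by (simp add: K1_def)
      qed
      then show ?thesis by (simp only: \<open>{q\<in>P. q \<le> p0} = {}\<close> card.empty power_0 mult_1_right mult.assoc)
    qed
    then show ?thesis by (simp add: T_def a_def a'_def A_def A'_def)
  qed
qed

end

text \<open>The sixth power of the fourth root is \<open>q powr (- 3/2)\<close>, a convergent series
  already over all integers.\<close>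

lemma small_root_tail:
  assumes M: "1 \<le> (M::real)"
  obtains p0 :: nat where "\<And>p. prime p \<Longrightarrow> p0 < p \<Longrightarrow> 2048 * M * root 4 (1 / real p) \<le> 1"
    "\<And>Q. finite Q \<Longrightarrow> (\<And>q. q \<in> Q \<Longrightarrow> p0 < q) \<Longrightarrow> (\<Sum>q\<in>Q. 2 ^ 22 * M ^ 6 * root 4 (1 / real q) ^ 6) \<le> 1 / 2"
proof -
  define F where "F n = 2 ^ 22 * M ^ 6 * root 4 (1 / real n) ^ 6" for n :: nat
  have F0: "0 \<le> F n" for n using M by (simp add: F_def)
  have "root 4 (1 / real n) ^ 6 = real n powr (- 3 / 2)" for n
  proof (cases "n = 0")
    case False
    then have "root 4 (1 / real n) ^ 6 = ((1 / real n) powr (1 / 4)) powr 6"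
      by (simp add: root_powr_inverse powr_numeral)
    also have "\<dots> = real n powr (- 3 / 2)"
      using False by (simp add: powr_powr powr_divide powr_minus_divide)
    finally show ?thesis .
  qed simp
  moreover have "summable (\<lambda>n. real n powr (- 3 / 2))" by (simp add: summable_real_powr_iff)
  ultimately have "summable F" unfolding F_def by (intro summable_mult) simp
  then obtain N where N: "\<And>m n. N \<le> m \<Longrightarrow> norm (sum F {m..<n}) < 1 / 2"
    unfolding summable_Cauchy by (meson half_gt_zero_iff zero_less_one)
  define p0 where "p0 = max N (nat \<lceil>(2048 * M) ^ 4\<rceil>)"
  show thesis
  proof (rule that[of p0])
    fix p assume "prime p" "p0 < p"
    then have p: "(2048 * M) ^ 4 \<le> real p" unfolding p0_def by linarith
    have pos: "0 < (2048 * M) ^ 4" using M by simp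
    have "2048 * M * root 4 (1 / real p) = root 4 ((2048 * M) ^ 4 / real p)"
    proof -
      have "root 4 ((2048 * M) ^ 4) = 2048 * M" using M by (intro real_root_power_cancel) auto
      then show ?thesis by (simp only: real_root_divide) simp
    qed
    also have "\<dots> \<le> root 4 1"
    proof (intro iffD2[OF real_root_le_iff])
      show "(2048 * M) ^ 4 / real p \<le> 1" using p pos by (subst divide_le_eq_1_pos) linarith+
    qed simp
    finally show "2048 * M * root 4 (1 / real p) \<le> 1" by simp
  next
    fix Q :: "nat set" assume Q: "finite Q" "\<And>q. q \<in> Q \<Longrightarrow> p0 < q"
    have "Q \<subseteq> {N..<Suc (Max (insert 0 Q))}"
    proof
      fix q assume "q \<in> Q"
      then show "q \<in> {N..<Suc (Max (insert 0 Q))}" using Q by (auto simp: p0_def less_Suc_eq_le intro: Max_ge dest!: Q(2))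
    qed
    then have "sum F Q \<le> sum F {N..<Suc (Max (insert 0 Q))}" using F0 by (intro sum_mono2) auto
    also have "\<dots> \<le> 1 / 2" using N[of N "Suc (Max (insert 0 Q))"] by simp
    finally show "(\<Sum>q\<in>Q. 2 ^ 22 * M ^ 6 * root 4 (1 / real q) ^ 6) \<le> 1 / 2" by (simp add: F_def)
  qed
qed

text \<open>There are at most \<open>Suc p0\<close> primes up to \<open>p0\<close>, so the constant
  depends on \<open>M\<close> and \<open>B\<close> only, not on \<open>P\<close> or the
  weights.\<close>

lemma bilinear_bound:
  assumes M: "1 \<le> M"
  obtains K where "0 < K"
    "\<And>\<omega> P (e :: 'a \<Rightarrow> nat \<Rightarrow> nat) V W \<psi> \<theta> f g. weights \<omega> M B \<Longrightarrow> finite P \<Longrightarrow> (\<And>p. p \<in> P \<Longrightarrow> prime p) \<Longrightarrow>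
      admissible P e V \<psi> f \<Longrightarrow> admissible P e W \<theta> g \<Longrightarrow>
      (\<Sum>v\<in>V. \<Sum>w\<in>W. if close_pair P e \<psi> \<theta> v w then f v * g w * wdist \<omega> P (e v) (e w) else 0)
        \<le> K * root 4 (sum f V) ^ 3 * root 4 (sum g W) ^ 3"
proof -
  obtain p0 :: nat where p0: "\<And>p. prime p \<Longrightarrow> p0 < p \<Longrightarrow> 2048 * M * root 4 (1 / real p) \<le> 1"
    "\<And>Q. finite Q \<Longrightarrow> (\<And>q. q \<in> Q \<Longrightarrow> p0 < q) \<Longrightarrow> (\<Sum>q\<in>Q. 2 ^ 22 * M ^ 6 * root 4 (1 / real q) ^ 6) \<le> 1 / 2"
    using small_root_tail[OF M] by metis
  define c1 where "c1 = 1 + 2 * M / (1 - root 4 (1 / 2))"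
  have "0 < 1 - root 4 (1 / 2 :: real)" by simp
  then have c1: "1 \<le> c1" using M by (simp add: c1_def)
  define K where "K = 2 * exp ((3 * B + 1) / 2) * c1 ^ Suc p0"
  show thesis
  proof (rule that[of K])
    show "0 < K" using c1 by (simp add: K_def)
    fix \<omega> P and e :: "'a \<Rightarrow> nat \<Rightarrow> nat" and V W :: "'a set" and \<psi> \<theta> f g :: "'a \<Rightarrow> real"
    assume w: "weights \<omega> M B" and P: "finite P" "\<And>p. p \<in> P \<Longrightarrow> prime p"
      and V: "admissible P e V \<psi> f" and W: "admissible P e W \<theta> g"
    have "card {p\<in>P. p \<le> p0} \<le> card {..p0}" by (intro card_mono) auto
    then have "c1 ^ card {p\<in>P. p \<le> p0} \<le> c1 ^ Suc p0" using c1 by (intro power_increasing) auto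
    moreover have "0 \<le> root 4 (sum f V) ^ 3 * root 4 (sum g W) ^ 3"
      using admissibleD(3)[OF V] admissibleD(3)[OF W] by (auto intro!: mult_nonneg_nonneg sum_nonneg)
    ultimately have "2 * exp ((3 * B + 1) / 2) * c1 ^ card {p\<in>P. p \<le> p0} * (root 4 (sum f V) ^ 3 * root 4 (sum g W) ^ 3)
      \<le> K * (root 4 (sum f V) ^ 3 * root 4 (sum g W) ^ 3)"
      unfolding K_def by (intro mult_right_mono mult_left_mono) auto
    moreover have "(\<Sum>v\<in>V. \<Sum>w\<in>W. if close_pair P e \<psi> \<theta> v w then f v * g w * wdist \<omega> P (e v) (e w) else 0)
      \<le> 2 * exp ((3 * B + 1) / 2) * c1 ^ card {p\<in>P. p \<le> p0} * root 4 (sum f V) ^ 3 * root 4 (sum g W) ^ 3"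
      unfolding c1_def weights.pair_term_def[OF w, symmetric]
      by (rule weights.bilinear_bound_primes[OF w _ _ P V W]) (use p0 in auto)
    ultimately show "(\<Sum>v\<in>V. \<Sum>w\<in>W. if close_pair P e \<psi> \<theta> v w then f v * g w * wdist \<omega> P (e v) (e w) else 0)
        \<le> K * root 4 (sum f V) ^ 3 * root 4 (sum g W) ^ 3"
      by (simp only: mult.assoc)
  qed
qed

section \<open>Exponential weights at large primes\<close>

lemma sum_inverse_consecutive_tail:
  assumes "finite Q" "\<And>q. q \<in> Q \<Longrightarrow> m \<le> q" "2 \<le> m"
  shows "(\<Sum>q\<in>Q. 1 / (real q * (real q - 1))) \<le> 1 / (real m - 1)"
proof -
  have tel: "(\<Sum>q\<in>{m..<n}. 1 / (real q * (real q - 1))) = 1 / (real m - 1) - 1 / (real n - 1)" if "m \<le> n" for n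
    using that
  proof (induction n rule: dec_induct)
    case (step n)
    have "1 / (x - 1) - 1 / x = 1 / (x * (x - 1))" if "2 \<le> x" for x :: real
      using that by (simp add: divide_simps)
    from this[of "real n"] show ?case using step assms(3) by (simp add: atLeastLessThanSuc)
  qed simp
  define n where "n = Suc (Max (insert m Q))"
  have n: "m \<le> n" unfolding n_def using assms(1) by (simp add: le_Suc_eq)
  have "Q \<subseteq> {m..<n}" using assms(1,2) by (auto simp: n_def less_Suc_eq_le)
  then have "(\<Sum>q\<in>Q. 1 / (real q * (real q - 1))) \<le> (\<Sum>q\<in>{m..<n}. 1 / (real q * (real q - 1)))"
    using assms(3) by (intro sum_mono2) auto
  also have "\<dots> \<le> 1 / (real m - 1)" using tel[OF n] n assms(3) by simp
  finally show ?thesis .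
qed

text \<open>For an exponential Markov inequality: if the differing primes from \<open>t\<close> on
  have reciprocals summing to more than 1, the product of their weights exceeds
  \<open>exp (2 * t)\<close>. The cut at \<open>t\<close> keeps every weight below
  \<open>exp 2\<close>.\<close>

definition tail_weight :: "nat \<Rightarrow> nat \<Rightarrow> real" where
  "tail_weight t p = (if t \<le> p then exp (2 * real t / real p) else 1)"

text \<open>For \<open>q \<ge> t\<close> the numerator \<open>exp (8 * t / q) - 1\<close> is
  \<open>O(t / q)\<close>, and \<open>t\<close> times the sum of \<open>1 / q^2\<close> over
  \<open>q \<ge> t\<close> is bounded. The constants are the same for all \<open>t\<close>.\<close>

lemma tail_weight_weights: "weights (tail_weight t) (exp 2) (16 * exp 8)"
proof
  fix p :: nat
  show "1 \<le> tail_weight t p" by (simp add: tail_weight_def)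
  show "tail_weight t p \<le> exp 2" by (cases "p = 0") (auto simp: tail_weight_def field_simps)
next
  fix Q :: "nat set" assume Q: "finite Q" "\<And>q. q \<in> Q \<Longrightarrow> prime q"
  define m where "m = max t 2"
  define Q' where "Q' = {q\<in>Q. m \<le> q}"
  have tm: "(tail_weight t q ^ 4 - 1) / real q \<le> (if m \<le> q then 8 * exp 8 * real t * (1 / (real q * (real q - 1))) else 0)" if q: "q \<in> Q" for q
  proof (cases "m \<le> q")
    case True
    have q2: "2 \<le> real q" using prime_ge_2_nat[OF Q(2)[OF q]] by simp
    define x where "x = 8 * real t / real q"
    have x: "0 \<le> x" "x \<le> 8" using True q2 by (auto simp: x_def m_def field_simps)
    have "tail_weight t q ^ 4 = exp x" using True by (simp add: tail_weight_def m_def x_def flip: exp_of_nat_mult)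
    moreover have "exp x - 1 \<le> x * exp 8"
    proof -
      have "1 - x \<le> exp (- x)" using exp_ge_add_one_self[of "- x"] by simp
      then have "exp x * (1 - x) \<le> exp x * exp (- x)" by (intro mult_left_mono) auto
      then have "exp x - 1 \<le> x * exp x" by (simp add: exp_minus field_simps)
      also have "\<dots> \<le> x * exp 8" using x by (intro mult_left_mono) auto
      finally show ?thesis .
    qed
    ultimately have "(tail_weight t q ^ 4 - 1) / real q \<le> x * exp 8 / real q" using q2 by (simp add: divide_right_mono)
    also have "\<dots> = 8 * exp 8 * real t * (1 / (real q * real q))" by (simp add: x_def)
    also have "\<dots> \<le> 8 * exp 8 * real t * (1 / (real q * (real q - 1)))"
      using q2 by (intro mult_left_mono divide_left_mono) auto
    finally show ?thesis using True by simp
  next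
    case False
    then have "\<not> t \<le> q" using prime_ge_2_nat[OF Q(2)[OF q]] by (auto simp: m_def)
    then show ?thesis using False by (simp add: tail_weight_def)
  qed
  have "(\<Sum>q\<in>Q. (tail_weight t q ^ 4 - 1) / real q) \<le> (\<Sum>q\<in>Q. if m \<le> q then 8 * exp 8 * real t * (1 / (real q * (real q - 1))) else 0)"
    by (intro sum_mono tm)
  also have "\<dots> = 8 * exp 8 * real t * (\<Sum>q\<in>Q'. 1 / (real q * (real q - 1)))"
    unfolding Q'_def sum_distrib_left using Q(1) by (simp only: sum.inter_filter)
  also have "\<dots> \<le> 8 * exp 8 * real t * (1 / (real m - 1))"
    by (intro mult_left_mono sum_inverse_consecutive_tail) (use Q in \<open>auto simp: Q'_def m_def\<close>)
  also have "\<dots> = 8 * exp 8 * (real t / (real m - 1))" by simp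
  also have "\<dots> \<le> 8 * exp 8 * 2"
    by (intro mult_left_mono) (auto simp: m_def field_simps max_def)
  finally show "(\<Sum>p\<in>Q. (tail_weight t p ^ 4 - 1) / real p) \<le> 16 * exp 8" by simp
qed

section \<open>Overlaps of two approximation sets\<close>

lemma sum_residues_affine:
  fixes F :: "int \<Rightarrow> real" and q :: nat
  assumes q: "0 < q" and cop: "coprime a (int q)" and per: "\<And>x. F (x mod int q) = F x"
  shows "(\<Sum>y<q. F (c + a * int y)) = (\<Sum>y<q. F (int y))"
proof -
  define g where "g y = nat ((c + a * int y) mod int q)" for y
  have g: "int (g y) = (c + a * int y) mod int q" for y using q by (simp add: g_def)
  have maps: "g ` {..<q} \<subseteq> {..<q}"
  proof
    fix z assume "z \<in> g ` {..<q}"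
    then obtain y where "z = g y" by auto
    then have "int z < int q" using g q by simp
    then show "z \<in> {..<q}" by simp
  qed
  have inj: "inj_on g {..<q}"
  proof (rule inj_onI)
    fix y y' assume yy: "y \<in> {..<q}" "y' \<in> {..<q}" and "g y = g y'"
    then have "(c + a * int y) mod int q = (c + a * int y') mod int q" using g by metis
    then have "int q dvd (c + a * int y) - (c + a * int y')" by (simp add: mod_eq_dvd_iff)
    then have "int q dvd a * (int y - int y')" by (simp add: algebra_simps)
    then have "int q dvd int y - int y'" using cop by (simp add: coprime_commute coprime_dvd_mult_right_iff)
    then have "int y mod int q = int y' mod int q" by (simp add: mod_eq_dvd_iff)
    then show "y = y'" using yy by simp
  qed
  have bij: "bij_betw g {..<q} {..<q}"
    using endo_inj_surj[OF _ maps inj] inj by (simp add: bij_betw_def)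
  have "(\<Sum>y<q. F (c + a * int y)) = (\<Sum>y<q. F (int (g y)))"
    by (simp add: g per)
  also have "\<dots> = (\<Sum>y<q. F (int y))" by (rule sum.reindex_bij_betw[OF bij])
  finally show ?thesis .
qed

text \<open>The Chinese remainder theorem for sums over whole periods, by induction on the primes:
  with \<open>z = m * p + x\<close> the factor at \<open>p\<close> depends on \<open>x\<close> only,
  while for the other primes \<open>m\<close> runs along a progression of step \<open>p\<close>,
  which permutes their residues.\<close>

lemma sum_prod_periodic:
  fixes F :: "nat \<Rightarrow> int \<Rightarrow> real"
  assumes "finite Q" "\<And>q. q \<in> Q \<Longrightarrow> prime q" "\<And>q x. q \<in> Q \<Longrightarrow> F q (x mod int q) = F q x"
  shows "(\<Sum>z<h * \<Prod>Q. \<Prod>q\<in>Q. F q (k + int z)) = real h * (\<Prod>q\<in>Q. \<Sum>y<q. F q (int y))"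
  using assms
proof (induction Q arbitrary: F k rule: finite_induct)
  case (insert p Q)
  define N where "N = h * \<Prod>Q"
  have per: "F q (x mod int q) = F q x" if "q \<in> insert p Q" for q x using insert.prems that by blast
  have prp: "prime p" and prQ: "\<And>q. q \<in> Q \<Longrightarrow> prime q" using insert.prems by auto
  have shift: "F q (x + int q * y) = F q x" if "q \<in> insert p Q" for q x y
    using per[OF that, of "x + int q * y"] per[OF that, of x] by simp
  define G where "G z = (\<Prod>q\<in>insert p Q. F q (k + z))" for z
  have "(\<Sum>z<h * \<Prod>(insert p Q). G (int z)) = (\<Sum>z<N * p. G (int z))"
    using insert.hyps by (simp add: N_def mult_ac)
  also have "\<dots> = (\<Sum>m<N. sum (\<lambda>z. G (int z)) {m * p..<m * p + p})"
    by (simp only: sum.nat_group)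
  also have "\<dots> = (\<Sum>m<N. \<Sum>x<p. G (int (m * p + x)))"
  proof (rule sum.cong[OF refl])
    fix m
    show "sum (\<lambda>z. G (int z)) {m * p..<m * p + p} = (\<Sum>x<p. G (int (m * p + x)))"
      using sum.shift_bounds_nat_ivl[of "\<lambda>z. G (int z)" 0 "m * p" p] by (simp add: atLeast0LessThan add.commute)
  qed
  also have "\<dots> = (\<Sum>x<p. \<Sum>m<N. G (int (m * p + x)))" by (rule sum.swap)
  also have "\<dots> = (\<Sum>x<p. F p (k + int x) * (real h * (\<Prod>q\<in>Q. \<Sum>y<q. F q (int y))))"
  proof (intro sum.cong refl)
    fix x
    have "(\<Sum>m<N. G (int (m * p + x))) = (\<Sum>m<N. F p (k + int x) * (\<Prod>q\<in>Q. F q ((k + int x) + int p * int m)))"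
    proof (intro sum.cong refl)
      fix m
      have "G (int (m * p + x)) = F p ((k + int x) + int p * int m) * (\<Prod>q\<in>Q. F q ((k + int x) + int p * int m))"
        unfolding G_def using insert.hyps by (simp add: algebra_simps)
      then show "G (int (m * p + x)) = F p (k + int x) * (\<Prod>q\<in>Q. F q ((k + int x) + int p * int m))"
        by (simp add: shift)
    qed
    also have "\<dots> = F p (k + int x) * (\<Sum>m<N. \<Prod>q\<in>Q. F q ((k + int x) + int p * (0 + int m)))"
      by (simp add: sum_distrib_left)
    also have "(\<Sum>m<N. \<Prod>q\<in>Q. F q ((k + int x) + int p * (0 + int m)))
        = real h * (\<Prod>q\<in>Q. \<Sum>y<q. F q ((k + int x) + int p * int y))"
      unfolding N_def
    proof (rule insert.IH[of "\<lambda>q z. F q ((k + int x) + int p * z)" 0])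
      fix q y assume q: "q \<in> Q"
      have "int p * (y mod int q) mod int q = int p * y mod int q" by (rule mod_mult_right_eq)
      then have "((k + int x) + int p * (y mod int q)) mod int q = ((k + int x) + int p * y) mod int q"
        by (metis mod_add_right_eq)
      then show "F q ((k + int x) + int p * (y mod int q)) = F q ((k + int x) + int p * y)"
        using per q by (metis insertCI)
    qed (use prQ in auto)
    also have "(\<Prod>q\<in>Q. \<Sum>y<q. F q ((k + int x) + int p * int y)) = (\<Prod>q\<in>Q. \<Sum>y<q. F q (int y))"
    proof (intro prod.cong refl sum_residues_affine)
      fix q assume q: "q \<in> Q"
      show "0 < q" using prQ[OF q] prime_gt_0_nat by blast
      have "p \<noteq> q" using q insert.hyps by auto
      then show "coprime (int p) (int q)" using primes_coprime[OF prp prQ[OF q]] by simp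
    qed (use per in auto)
    finally show "(\<Sum>m<N. G (int (m * p + x))) = F p (k + int x) * (real h * (\<Prod>q\<in>Q. \<Sum>y<q. F q (int y)))" .
  qed
  also have "\<dots> = (\<Sum>x<p. F p (k + 1 * int x)) * (real h * (\<Prod>q\<in>Q. \<Sum>y<q. F q (int y)))"
    by (simp add: sum_distrib_right)
  also have "(\<Sum>x<p. F p (k + 1 * int x)) = (\<Sum>x<p. F p (int x))"
    using per prp by (intro sum_residues_affine) (auto simp: prime_gt_0_nat)
  also have "(\<Sum>x<p. F p (int x)) * (real h * (\<Prod>q\<in>Q. \<Sum>y<q. F q (int y)))
      = real h * (\<Prod>q\<in>insert p Q. \<Sum>y<q. F q (int y))"
    using insert.hyps by (simp add: mult_ac)
  finally show ?case by (simp add: G_def)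
qed simp

section \<open>Elementary bounds for products over primes\<close>

lemma binomial_middle_le: "(2 * k + 1) choose k \<le> 4 ^ k"
proof -
  have "(2 * k + 1) choose (k + 1) = (2 * k + 1) choose k"
    using binomial_symmetric[of k "2 * k + 1"] by simp
  moreover have "((2 * k + 1) choose k) + ((2 * k + 1) choose (k + 1)) \<le> (\<Sum>i\<le>2 * k + 1. (2 * k + 1) choose i)"
    using sum_mono2[of "{..2 * k + 1}" "{k, k + 1}" "\<lambda>i. (2 * k + 1) choose i"] by simp
  moreover have "(\<Sum>i\<le>2 * k + 1. (2 * k + 1) choose i) = 2 * 4 ^ k"
    unfolding choose_row_sum by (simp add: power_mult)
  ultimately show ?thesis by linarith
qed

text \<open>Erdos's argument: for odd \<open>y = 2 * k + 1\<close> all primes in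
  \<open>(k + 1, y]\<close> divide the binomial coefficient \<open>y choose k\<close>, which is at
  most \<open>4 ^ k\<close>. The bound serves as the length of a sieve period.\<close>

lemma primorial_le: "\<Prod>{p. prime p \<and> p \<le> y} \<le> 4 ^ (y::nat)"
proof (induction y rule: less_induct)
  case (less y)
  consider "y \<le> 1" | "y = 2" | "2 < y" "even y" | "2 < y" "odd y" by linarith
  then show ?case
  proof cases
    case 1
    then have "\<not> (prime p \<and> p \<le> y)" for p using prime_ge_2_nat[of p] by auto
    then have "{p. prime p \<and> p \<le> y} = {}" by blast
    then show ?thesis by (simp only: prod.empty) simp
  next
    case 2
    then have "p = 2" if "prime p \<and> p \<le> y" for p using prime_ge_2_nat[of p] that by simp
    then have "{p. prime p \<and> p \<le> y} = {} \<or> {p. prime p \<and> p \<le> y} = {2}" by blast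
    then show ?thesis
    proof
      assume e: "{p. prime p \<and> p \<le> y} = {}"
      show ?thesis unfolding e by simp
    next
      assume e: "{p. prime p \<and> p \<le> y} = {2}"
      show ?thesis unfolding e using 2 by simp
    qed
  next
    case 3
    have "p \<le> y - 1" if "prime p" "p \<le> y" for p
    proof -
      have "p \<noteq> y" using that 3 prime_odd_nat by blast
      then show ?thesis using that by simp
    qed
    then have "{p. prime p \<and> p \<le> y} = {p. prime p \<and> p \<le> y - 1}" using 3 by auto
    then have "\<Prod>{p. prime p \<and> p \<le> y} \<le> 4 ^ (y - 1)" using less[of "y - 1"] 3 by simp
    also have "\<dots> \<le> 4 ^ y" by (intro power_increasing) auto
    finally show ?thesis .
  next
    case 4
    then obtain k where k: "y = 2 * k + 1" by (auto elim: oddE)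
    have k1: "1 \<le> k" using 4 k by simp
    define S where "S = {p. prime p \<and> k + 1 < p \<and> p \<le> y}"
    have finS: "finite S" unfolding S_def by (rule finite_subset[of _ "{..y}"]) auto
    have split: "{p. prime p \<and> p \<le> y} = {p. prime p \<and> p \<le> k + 1} \<union> S" using k by (auto simp: S_def)
    have dv: "p dvd (y choose k)" if p: "p \<in> S" for p
    proof -
      have pp: "prime p" "k + 1 < p" "p \<le> y" using p by (auto simp: S_def)
      have "fact k * fact (y - k) * (y choose k) = fact y" using k by (intro binomial_fact_lemma) simp
      moreover have "p dvd fact y" using pp by (simp add: prime_dvd_fact_iff)
      ultimately have "p dvd fact k * fact (y - k) * (y choose k)" by simp
      moreover have "\<not> p dvd fact k" "\<not> p dvd fact (y - k)"
        using pp k prime_dvd_fact_iff[OF pp(1), of k] prime_dvd_fact_iff[OF pp(1), of "y - k"] by linarith+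
      ultimately show ?thesis using pp(1) by (simp add: prime_dvd_mult_iff)
    qed
    have "\<Prod>S dvd (y choose k)" by (rule prod_primes_dvd[OF finS _ dv]) (auto simp: S_def)
    then have "\<Prod>S \<le> (y choose k)" using k by (intro dvd_imp_le) auto
    also have "\<dots> \<le> 4 ^ k" using binomial_middle_le k by simp
    finally have S: "\<Prod>S \<le> 4 ^ k" .
    have "\<Prod>{p. prime p \<and> p \<le> y} = \<Prod>{p. prime p \<and> p \<le> k + 1} * \<Prod>S"
      unfolding split by (rule prod.union_disjoint) (use finS in \<open>auto simp: S_def\<close>)
    also have "\<dots> \<le> 4 ^ (k + 1) * 4 ^ k" using less[of "k + 1"] k k1 S by (intro mult_mono) auto
    also have "\<dots> = 4 ^ y" using k by (simp flip: power_add)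
    finally show ?thesis .
  qed
qed

text \<open>A number below \<open>4 ^ (y + 1)\<close> has at most \<open>2 * y + 1\<close> prime
  factors, and each one beyond \<open>y\<close> contributes a factor of at most
  \<open>1 + 1 / max 1 y\<close>.\<close>

lemma large_prime_divisors_le:
  fixes Z :: "nat set"
  assumes fin: "finite Z" and pr: "\<And>p. p \<in> Z \<Longrightarrow> prime p \<and> y < p" and c: "0 < c" "c < 4 ^ (y + 1)"
    and dv: "\<And>p. p \<in> Z \<Longrightarrow> p dvd c"
  shows "(\<Prod>p\<in>Z. inverse (1 - 1 / real p)) \<le> exp 3"
proof -
  have "\<Prod>Z dvd c" using pr dv by (intro prod_primes_dvd fin) auto
  then have "\<Prod>Z \<le> c" using c by (intro dvd_imp_le) auto
  moreover have "2 ^ card Z \<le> \<Prod>Z"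
    using prod_mono[of Z "\<lambda>_. 2" "\<lambda>p. p"] pr prime_ge_2_nat by (simp add: prod_constant)
  ultimately have "2 ^ card Z < (2::nat) ^ (2 * (y + 1))" using c by (simp add: power_mult)
  then have "card Z < 2 * (y + 1)" by (rule power_less_imp_less_exp[rotated]) simp
  then have card: "card Z \<le> 2 * y + 1" by simp
  define N where "N = real (max 1 y)"
  have N: "1 \<le> N" by (simp add: N_def)
  have "(\<Prod>p\<in>Z. inverse (1 - 1 / real p)) \<le> (\<Prod>p\<in>Z. exp (1 / N))"
  proof (rule prod_mono, intro conjI)
    fix p assume p: "p \<in> Z"
    then have "2 \<le> p" "y < p" using pr prime_ge_2_nat by auto
    then have p': "N + 1 \<le> real p" by (auto simp: N_def)
    show "0 \<le> inverse (1 - 1 / real p)" using p' N by (simp add: field_simps)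
    have "inverse (1 - 1 / real p) = 1 + 1 / (real p - 1)" using p' N by (simp add: field_simps)
    also have "\<dots> \<le> 1 + 1 / N" using p' N by (simp add: frac_le)
    also have "\<dots> \<le> exp (1 / N)" by simp
    finally show "inverse (1 - 1 / real p) \<le> exp (1 / N)" .
  qed
  also have "\<dots> = exp (real (card Z) / N)" by (simp flip: exp_of_nat_mult)
  also have "\<dots> \<le> exp 3"
  proof -
    have "real (card Z) \<le> 3 * N" using card by (auto simp: N_def max_def)
    then show ?thesis using N by (simp add: field_simps)
  qed
  finally show ?thesis .
qed

text \<open>Used with \<open>m = g * s\<close>, \<open>n = g * r\<close> and coprime
  \<open>r\<close>, \<open>s\<close>: the pairs of reduced fractions \<open>a / m\<close>,
  \<open>b / n\<close> with difference \<open>c / (g * r * s)\<close>, over the least common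
  multiple.\<close>

definition coprime_sols :: "nat \<Rightarrow> nat \<Rightarrow> nat \<Rightarrow> nat \<Rightarrow> int \<Rightarrow> (nat \<times> nat) set" where
  "coprime_sols m n s r c = {(a, b). 1 \<le> a \<and> a \<le> m \<and> gcd a m = 1 \<and> 1 \<le> b \<and> b \<le> n \<and> gcd b n = 1 \<and>
     int a * int r - int b * int s = c}"

lemma finite_coprime_sols: "finite (coprime_sols m n s r c)"
  by (rule finite_subset[of _ "{..m} \<times> {..n}"]) (auto simp: coprime_sols_def)

lemma not_dvd_if_coprime_prime:
  fixes p a m :: nat
  assumes "prime p" "gcd a m = 1" "p dvd m"
  shows "\<not> int p dvd int a"
proof
  assume "int p dvd int a"
  then have "p dvd a" by simp
  then have "p dvd gcd a m" using assms(3) by simp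
  then show False using assms(1,2) by simp
qed

text \<open>A prime dividing \<open>r\<close> divides neither \<open>s\<close> nor \<open>b\<close>,
  hence not \<open>b * s\<close>, whereas it divides \<open>a * r\<close>; so it cannot divide
  \<open>c\<close>. The case of \<open>s\<close> is symmetric.\<close>

lemma coprime_sols_rhs:
  assumes cop: "coprime r s" and "(a, b) \<in> coprime_sols (g * s) (g * r) s r c"
    and p: "prime p" "p dvd r * s"
  shows "\<not> int p dvd c"
proof
  assume pc: "int p dvd c"
  have ab: "gcd a (g * s) = 1" "gcd b (g * r) = 1" "int a * int r - int b * int s = c"
    using assms(2) by (auto simp: coprime_sols_def)
  have pp: "prime (int p)" using p(1) by simp
  consider "p dvd r" | "p dvd s" using p prime_dvd_mult_iff by blast
  then show False
  proof cases
    case 1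
    then have "\<not> int p dvd int s" using cop p(1) by (metis coprime_common_divisor int_dvd_int_iff not_prime_unit)
    moreover have "\<not> int p dvd int b" using not_dvd_if_coprime_prime[OF p(1) ab(2)] 1 by simp
    moreover have "int b * int s = int a * int r - c" using ab(3) by simp
    moreover have "int p dvd int a * int r - c" using pc 1 by simp
    ultimately show False using prime_dvd_mult_iff[OF pp, of "int b" "int s"] by metis
  next
    case 2
    then have "\<not> int p dvd int r" using cop p(1) by (metis coprime_common_divisor int_dvd_int_iff not_prime_unit)
    moreover have "\<not> int p dvd int a" using not_dvd_if_coprime_prime[OF p(1) ab(1)] 2 by simp
    moreover have "int a * int r = c + int b * int s" using ab(3) by simp
    moreover have "int p dvd c + int b * int s" using pc 2 by simp
    ultimately show False using prime_dvd_mult_iff[OF pp, of "int a" "int r"] by metis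
  qed
qed

lemma sum_dvd_affine:
  assumes p: "prime p" and s: "\<not> p dvd s"
  shows "(\<Sum>y<p. if int p dvd a + int s * int y then 1 else 0 :: real) = 1"
proof -
  have "coprime (int s) (int p)"
    using prime_imp_coprime[OF p s] by (simp add: coprime_commute)
  then have "(\<Sum>y<p. if int p dvd a + int s * int y then 1 else 0 :: real) = (\<Sum>y<p. if int p dvd int y then 1 else 0)"
    using p by (intro sum_residues_affine) (auto simp: prime_gt_0_nat dvd_mod_iff)
  also have "\<dots> = (\<Sum>y<p. if y = 0 then 1 else 0)"
    by (intro sum.cong refl) (auto dest: dvd_imp_le)
  also have "\<dots> = 1" using p prime_gt_0_nat by (simp add: sum.delta')
  finally show ?thesis .
qed

lemma sum_avoid_one:
  assumes p: "prime p" and s: "\<not> p dvd s"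
  shows "(\<Sum>y<p. if int p dvd a + int s * int y then 0 else 1 :: real) = real p - 1"
proof -
  have "(\<Sum>y<p. if int p dvd a + int s * int y then 0 else 1 :: real) + (\<Sum>y<p. if int p dvd a + int s * int y then 1 else 0 :: real) = (\<Sum>y<p. 1)"
    unfolding sum.distrib[symmetric] by (intro sum.cong) auto
  then show ?thesis using sum_dvd_affine[OF p s, of a] by simp
qed

text \<open>Two residue classes are to be avoided. For \<open>p\<close> dividing neither
  \<open>r * s\<close> nor \<open>c\<close> they are distinct, and \<open>p - 2\<close> is at most
  \<open>p * (1 - 1/p)^2\<close>. Otherwise only one of them is exploited.\<close>

lemma sum_avoid_two:
  assumes p: "prime p" and cop: "coprime r s" and c: "int a * int r - int b * int s = c"
  shows "(\<Sum>y<p. if int p dvd int a + int s * int y \<or> int p dvd int b + int r * int y then 0 else 1 :: real)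
    \<le> real p * (if p dvd r * s \<or> int p dvd c then 1 - 1 / real p else (1 - 1 / real p)^2)"
proof -
  have p2: "2 \<le> real p" using prime_ge_2_nat[OF p] by simp
  let ?A = "\<lambda>y. int p dvd int a + int s * int y" and ?B = "\<lambda>y. int p dvd int b + int r * int y"
  have one: "(\<Sum>y<p. if ?A y \<or> ?B y then 0 else 1 :: real) \<le> real p - 1"
  proof (cases "p dvd s")
    case True
    then have "\<not> p dvd r" using cop p by (metis coprime_common_divisor not_prime_unit)
    then have "(\<Sum>y<p. if ?B y then 0 else 1 :: real) = real p - 1" by (rule sum_avoid_one[OF p])
    moreover have "(\<Sum>y<p. if ?A y \<or> ?B y then 0 else 1 :: real) \<le> (\<Sum>y<p. if ?B y then 0 else 1)" by (intro sum_mono) auto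
    ultimately show ?thesis by simp
  next
    case False
    then have "(\<Sum>y<p. if ?A y then 0 else 1 :: real) = real p - 1" by (rule sum_avoid_one[OF p])
    moreover have "(\<Sum>y<p. if ?A y \<or> ?B y then 0 else 1 :: real) \<le> (\<Sum>y<p. if ?A y then 0 else 1)" by (intro sum_mono) auto
    ultimately show ?thesis by simp
  qed
  show ?thesis
  proof (cases "p dvd r * s \<or> int p dvd c")
    case True
    have "real p * (1 - 1 / real p) = real p - 1" using p2 by (simp add: field_simps)
    then show ?thesis using one unfolding if_P[OF True] by simp
  next
    case False
    then have rs: "\<not> p dvd r" "\<not> p dvd s" by auto
    have disj: "\<not> (?A y \<and> ?B y)" for y
    proof
      assume "?A y \<and> ?B y"
      then have "int p dvd (int a + int s * int y) * int r - (int b + int r * int y) * int s"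
        by (intro dvd_diff dvd_mult2) auto
      moreover have "(int a + int s * int y) * int r - (int b + int r * int y) * int s = c" using c by (simp add: algebra_simps)
      ultimately show False using False by simp
    qed
    have "(\<Sum>y<p. if ?A y \<or> ?B y then 0 else 1 :: real) + ((\<Sum>y<p. if ?A y then 1 else 0 :: real) + (\<Sum>y<p. if ?B y then 1 else 0 :: real)) = (\<Sum>y<p. 1)"
      unfolding sum.distrib[symmetric] using disj by (intro sum.cong) auto
    then have "(\<Sum>y<p. if ?A y \<or> ?B y then 0 else 1 :: real) = real p - 2"
      using sum_dvd_affine[OF p rs(1), of "int b"] sum_dvd_affine[OF p rs(2), of "int a"] by simp
    also have "\<dots> \<le> real p * (1 - 1 / real p)^2" using p2 by (simp add: power2_eq_square field_simps)
    finally show ?thesis using False by simp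
  qed
qed

text \<open>From one solution all others arise as \<open>(a0 + s * z, b0 + r * z)\<close>, and the
  range of \<open>a\<close> confines \<open>z\<close> to a window of \<open>g\<close> consecutive
  integers. As the primes in \<open>Q\<close> divide \<open>g\<close>, the window consists of whole
  periods, and the sieve has no error term.\<close>

lemma card_coprime_sols_le:
  fixes c :: int
  assumes pos: "0 < g" "0 < s" "0 < r" and cop: "coprime r s"
    and Q: "finite Q" "\<And>p. p \<in> Q \<Longrightarrow> prime p" "\<And>p. p \<in> Q \<Longrightarrow> p dvd g"
  shows "real (card (coprime_sols (g * s) (g * r) s r c))
    \<le> real g * (\<Prod>p\<in>Q. if p dvd r * s \<or> int p dvd c then 1 - 1 / real p else (1 - 1 / real p)^2)"
proof (cases "coprime_sols (g * s) (g * r) s r c = {}")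
  case True
  have "0 \<le> (\<Prod>p\<in>Q. if p dvd r * s \<or> int p dvd c then 1 - 1 / real p else (1 - 1 / real p)^2)"
  proof (rule prod_nonneg)
    fix p assume "p \<in> Q"
    then have "1 \<le> real p" using Q(2) prime_ge_1_nat by force
    then show "0 \<le> (if p dvd r * s \<or> int p dvd c then 1 - 1 / real p else (1 - 1 / real p)^2)" by (simp add: field_simps)
  qed
  then show ?thesis using True by simp
next
  case False
  let ?S = "coprime_sols (g * s) (g * r) s r c"
  obtain a0 b0 where ab0: "(a0, b0) \<in> ?S" using False by auto
  then have c0: "int a0 * int r - int b0 * int s = c" by (auto simp: coprime_sols_def)
  \<comment> \<open>The least \<open>z\<close> with \<open>a0 + s * z \<ge> 1\<close>, written as a
    negated floor.\<close>
  define z1 where "z1 = - ((int a0 - 1) div int s)"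
  define F where "F p z = (if int p dvd int a0 + int s * z \<or> int p dvd int b0 + int r * z then 0 else 1 :: real)" for p :: nat and z
  define Z where "Z w = (\<Prod>p\<in>Q. F p (z1 + int w))" for w
  have Z0: "0 \<le> Z w" for w unfolding Z_def F_def by (intro prod_nonneg) auto
  have ex: "\<exists>w<g. int a = int a0 + int s * (z1 + int w) \<and> int b = int b0 + int r * (z1 + int w) \<and> Z w = 1"
    if ab: "(a, b) \<in> ?S" for a b
  proof -
    have ab': "1 \<le> a" "a \<le> g * s" "gcd a (g * s) = 1" "gcd b (g * r) = 1" "int a * int r - int b * int s = c"
      using ab by (auto simp: coprime_sols_def)
    have eq: "(int a - int a0) * int r = (int b - int b0) * int s" using c0 ab'(5) by (simp add: algebra_simps)
    then have "int s dvd (int a - int a0) * int r" by simp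
    moreover have "coprime (int s) (int r)" using cop by (simp add: coprime_commute)
    ultimately have "int s dvd int a - int a0" by (simp add: coprime_dvd_mult_left_iff)
    then obtain z where z: "int a - int a0 = int s * z" by (auto elim: dvdE)
    have "int s * (z * int r) = int s * (int b - int b0)" using eq z by (simp add: mult_ac)
    then have zb: "z * int r = int b - int b0" using pos by simp
    have sz1: "1 - int a0 \<le> int s * z1" "int s * (z1 - 1) < 1 - int a0"
    proof -
      have sp: "0 < int s" using pos by simp
      have "int s * ((int a0 - 1) div int s) \<le> int a0 - 1" "int a0 - 1 < int s * ((int a0 - 1) div int s) + int s"
        using sp pos_mod_bound[OF sp, of "int a0 - 1"] pos_mod_sign[OF sp, of "int a0 - 1"] mult_div_mod_eq[of "int s" "int a0 - 1"] by linarith+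
      then show "1 - int a0 \<le> int s * z1" "int s * (z1 - 1) < 1 - int a0" by (auto simp: z1_def algebra_simps)
    qed
    have "int s * (z1 - 1) < int s * z" using sz1(2) z ab'(1) by linarith
    then have zz: "z1 \<le> z" using pos by simp
    have "int s * z \<le> int (g * s) - int a0" using z ab'(2) by linarith
    then have "int s * (z - z1) < int s * int g" using sz1(1) by (simp add: algebra_simps)
    then have zg: "z - z1 < int g" using pos by simp
    define w where "w = nat (z - z1)"
    have w: "w < g" "z1 + int w = z" using zz zg by (auto simp: w_def)
    have "F p z = 1" if "p \<in> Q" for p
    proof -
      have "int a0 + int s * z = int a" "int b0 + int r * z = int b" using z zb by (auto simp: mult.commute)
      moreover have "\<not> int p dvd int a" using not_dvd_if_coprime_prime[OF Q(2)[OF that] ab'(3)] Q(3)[OF that] by simp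
      moreover have "\<not> int p dvd int b" using not_dvd_if_coprime_prime[OF Q(2)[OF that] ab'(4)] Q(3)[OF that] by simp
      ultimately show ?thesis by (simp add: F_def)
    qed
    then have "Z w = 1" by (simp add: Z_def w(2))
    then show ?thesis using w z zb by (intro exI[of _ w]) (auto simp: mult.commute)
  qed
  define G where "G w = (nat (int a0 + int s * (z1 + int w)), nat (int b0 + int r * (z1 + int w)))" for w
  have "?S \<subseteq> G ` {w\<in>{..<g}. Z w = 1}"
  proof
    fix x assume "x \<in> ?S"
    then obtain a b where x: "x = (a, b)" "(a, b) \<in> ?S" by (cases x) auto
    from ex[OF x(2)] obtain w where w: "w < g" "int a = int a0 + int s * (z1 + int w)" "int b = int b0 + int r * (z1 + int w)" "Z w = 1" by blast
    have "G w = (nat (int a), nat (int b))" unfolding G_def w(2)[symmetric] w(3)[symmetric] ..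
    then have "x = G w" using x by simp
    then show "x \<in> G ` {w\<in>{..<g}. Z w = 1}" using w by auto
  qed
  then have "card ?S \<le> card (G ` {w\<in>{..<g}. Z w = 1})" by (intro card_mono) auto
  also have "\<dots> \<le> card {w\<in>{..<g}. Z w = 1}" by (intro card_image_le) auto
  finally have "real (card ?S) \<le> (\<Sum>w\<in>{w\<in>{..<g}. Z w = 1}. Z w)" by simp
  also have "\<dots> \<le> (\<Sum>w<g. Z w)" using Z0 by (intro sum_mono2) auto
  \<comment> \<open>The product of \<open>Q\<close> divides \<open>g\<close>, so the rounded
    quotient loses nothing.\<close>
  also have "(\<Sum>w<g. Z w) = (\<Sum>w<(g div \<Prod>Q) * \<Prod>Q. Z w)"
    using prod_primes_dvd[OF Q] by simp
  also have "\<dots> = real (g div \<Prod>Q) * (\<Prod>p\<in>Q. \<Sum>y<p. F p (int y))"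
    unfolding Z_def
  proof (intro sum_prod_periodic Q)
    fix p and x :: int
    have m: "int p dvd u + v * (x mod int p) \<longleftrightarrow> int p dvd u + v * x" for u v
    proof -
      have "(u + v * (x mod int p)) mod int p = (u + v * x) mod int p" by (metis mod_add_right_eq mod_mult_right_eq)
      then show ?thesis by (simp add: dvd_eq_mod_eq_0)
    qed
    show "F p (x mod int p) = F p x" unfolding F_def m ..
  qed
  also have "\<dots> \<le> real (g div \<Prod>Q) * (\<Prod>p\<in>Q. real p * (if p dvd r * s \<or> int p dvd c then 1 - 1 / real p else (1 - 1 / real p)^2))"
  proof (intro mult_left_mono prod_mono conjI)
    fix p assume p: "p \<in> Q"
    show "0 \<le> (\<Sum>y<p. F p (int y))" unfolding F_def by (intro sum_nonneg) auto
    show "(\<Sum>y<p. F p (int y)) \<le> real p * (if p dvd r * s \<or> int p dvd c then 1 - 1 / real p else (1 - 1 / real p)^2)"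
      unfolding F_def by (rule sum_avoid_two[OF Q(2)[OF p] cop c0])
  qed simp
  also have "\<dots> = real (g div \<Prod>Q) * real (\<Prod>Q) * (\<Prod>p\<in>Q. if p dvd r * s \<or> int p dvd c then 1 - 1 / real p else (1 - 1 / real p)^2)"
    by (simp add: prod.distrib)
  also have "real (g div \<Prod>Q) * real (\<Prod>Q) = real g"
    unfolding of_nat_mult[symmetric] using dvd_div_mult_self[OF prod_primes_dvd[OF Q]] by (rule arg_cong)
  finally show ?thesis .
qed

text \<open>\<open>c\<close> stands for \<open>a r - b s\<close>; it must be coprime to \<open>D = r s\<close>, and
  \<open>hit_factor\<close> weighs the remaining \<open>c\<close> by the local correction at the primes dividing both
  \<open>c\<close> and the common divisor.\<close>

definition sieve_factor :: "nat \<Rightarrow> nat \<Rightarrow> real" where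
  "sieve_factor D p = (if p dvd D then 1 - 1 / real p else (1 - 1 / real p)^2)"

definition hit_factor :: "nat \<Rightarrow> nat \<Rightarrow> int \<Rightarrow> real" where
  "hit_factor D p c = (if p dvd D then if int p dvd c then 0 else 1
     else if int p dvd c then inverse (1 - 1 / real p) else 1)"

lemma hit_factor_nonneg:
  assumes "prime p"
  shows "0 \<le> hit_factor D p c"
proof -
  have i: "0 \<le> inverse (1 - 1 / real p)" using inverse_prime_factor(1)[OF assms] by linarith
  show ?thesis
    unfolding hit_factor_def by (cases "p dvd D"; cases "int p dvd c"; simp only: if_True if_False i zero_le_one order_refl)
qed

text \<open>Only the residue 0 differs from 1. The mean is \<open>1 - 1/p\<close> if
  \<open>p\<close> divides \<open>D\<close>, and \<open>1 + 1 / (p * (p - 1))\<close> otherwise,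
  which stays harmless in a product over all primes.\<close>

lemma sum_hit_factor_le:
  assumes p: "prime p"
  shows "(\<Sum>y<p. hit_factor D p (int y)) \<le> real p * ((if p dvd D then 1 - 1 / real p else 1) * exp (1 / (real p * (real p - 1))))"
proof -
  have p2: "2 \<le> real p" using prime_ge_2_nat[OF p] by simp
  have e1: "1 \<le> exp (1 / (real p * (real p - 1)))" using p2 by simp
  have "{..<p} = insert 0 {1..<p}" using p prime_gt_0_nat by force
  then have split: "(\<Sum>y<p. hit_factor D p (int y)) = hit_factor D p 0 + (\<Sum>y\<in>{1..<p}. hit_factor D p (int y))" by simp
  have "hit_factor D p (int y) = 1" if "y \<in> {1..<p}" for y
    using that by (auto simp: hit_factor_def dest: dvd_imp_le)
  then have "(\<Sum>y\<in>{1..<p}. hit_factor D p (int y)) = real p - 1" using p2 by (simp add: of_nat_diff)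
  then have eq: "(\<Sum>y<p. hit_factor D p (int y)) = hit_factor D p 0 + (real p - 1)" using split by simp
  show ?thesis
  proof (cases "p dvd D")
    case True
    then have h0: "hit_factor D p 0 = 0" by (simp add: hit_factor_def)
    have "(\<Sum>y<p. hit_factor D p (int y)) = real p * (1 - 1 / real p) * 1"
      unfolding eq h0 using p2 by (simp add: field_simps)
    also have "\<dots> \<le> real p * (1 - 1 / real p) * exp (1 / (real p * (real p - 1)))"
      using e1 p2 by (intro mult_left_mono) auto
    finally show ?thesis using True by (simp add: mult.assoc)
  next
    case False
    have alg: "inverse (1 - 1 / x) + (x - 1) = x * (1 + 1 / (x * (x - 1)))" if "2 \<le> x" for x :: real
    proof -
      have "inverse (1 - 1 / x) = x / (x - 1)" using that by (simp add: field_simps)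
      then show ?thesis using that by (simp add: divide_simps) (simp add: algebra_simps)
    qed
    have h0: "hit_factor D p 0 = inverse (1 - 1 / real p)" using False by (simp add: hit_factor_def)
    have "(\<Sum>y<p. hit_factor D p (int y)) = real p * (1 + 1 / (real p * (real p - 1)))"
      unfolding eq h0 by (rule alg[OF p2])
    also have "\<dots> \<le> real p * exp (1 / (real p * (real p - 1)))" by (intro mult_left_mono exp_ge_add_one_self) auto
    finally show ?thesis using False by simp
  qed
qed

text \<open>The correction at primes beyond \<open>y\<close> is at most \<open>exp 3\<close> for
  each single \<open>c\<close>, by the bound on its large prime divisors. Thus only primes up to
  \<open>y\<close>, whose product is small, have to be averaged over \<open>c\<close>.\<close>

lemma sieve_pointwise:
  assumes Q: "finite Q" "\<And>p. p \<in> Q \<Longrightarrow> prime p" and c: "0 < c" "c < 4 ^ (y + 1)"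
    and av: "\<And>p. prime p \<Longrightarrow> p dvd D \<Longrightarrow> \<not> p dvd c"
  shows "(\<Prod>p\<in>Q. if p dvd D \<or> int p dvd int c then 1 - 1 / real p else (1 - 1 / real p)^2)
    \<le> (\<Prod>p\<in>Q. sieve_factor D p) * (exp 3 * (\<Prod>p\<in>{p. prime p \<and> p \<le> y}. hit_factor D p (int c)))"
proof -
  define h where "h p = (if \<not> p dvd D \<and> p dvd c then inverse (1 - 1 / real p) else 1)" for p :: nat
  have h1: "1 \<le> h p" if "prime p" for p using inverse_prime_factor(1)[OF that] by (simp add: h_def)
  have hh: "hit_factor D p (int c) = h p" if "prime p" for p
    using av[OF that] by (auto simp: hit_factor_def h_def)
  have eq: "(\<Prod>p\<in>Q. if p dvd D \<or> int p dvd int c then 1 - 1 / real p else (1 - 1 / real p)^2) = (\<Prod>p\<in>Q. sieve_factor D p) * (\<Prod>p\<in>Q. h p)"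
    unfolding prod.distrib[symmetric]
  proof (rule prod.cong[OF refl])
    fix p assume "p \<in> Q"
    then have pos: "0 < 1 - 1 / real p" using inverse_prime_factor Q by blast
    define u where "u = 1 - 1 / real p"
    have "u \<noteq> 0" using pos by (simp only: u_def)
    then show "(if p dvd D \<or> int p dvd int c then 1 - 1 / real p else (1 - 1 / real p)^2) = sieve_factor D p * h p"
      unfolding sieve_factor_def h_def u_def[symmetric] by (auto simp: power2_eq_square)
  qed
  have le: "(\<Prod>p\<in>Q. h p) \<le> exp 3 * (\<Prod>p\<in>{p. prime p \<and> p \<le> y}. hit_factor D p (int c))"
  proof -
    have "(\<Prod>p\<in>Q. h p) = (\<Prod>p\<in>{p\<in>Q. y < p}. h p) * (\<Prod>p\<in>{p\<in>Q. p \<le> y}. h p)"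
    proof -
      have "Q = {p\<in>Q. y < p} \<union> {p\<in>Q. p \<le> y}" by auto
      then have "(\<Prod>p\<in>Q. h p) = (\<Prod>p\<in>{p\<in>Q. y < p} \<union> {p\<in>Q. p \<le> y}. h p)" by simp
      also have "\<dots> = (\<Prod>p\<in>{p\<in>Q. y < p}. h p) * (\<Prod>p\<in>{p\<in>Q. p \<le> y}. h p)"
        using Q by (intro prod.union_disjoint) auto
      finally show ?thesis .
    qed
    also have "\<dots> \<le> exp 3 * (\<Prod>p\<in>{p. prime p \<and> p \<le> y}. h p)"
    proof (rule mult_mono)
      have "(\<Prod>p\<in>{p\<in>Q. y < p}. h p) = (\<Prod>p\<in>{p\<in>{p\<in>Q. y < p}. \<not> p dvd D \<and> p dvd c}. inverse (1 - 1 / real p))"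
        unfolding h_def using Q by (intro prod.inter_filter[symmetric]) auto
      also have "\<dots> \<le> exp 3" using Q by (intro large_prime_divisors_le[OF _ _ c]) auto
      finally show "(\<Prod>p\<in>{p\<in>Q. y < p}. h p) \<le> exp 3" .
      show "(\<Prod>p\<in>{p\<in>Q. p \<le> y}. h p) \<le> (\<Prod>p\<in>{p. prime p \<and> p \<le> y}. h p)"
        using Q h1 order_trans[OF zero_le_one h1] by (intro prod_mono2) auto
      show "0 \<le> (\<Prod>p\<in>{p\<in>Q. p \<le> y}. h p)" using Q order_trans[OF zero_le_one h1] by (intro prod_nonneg) auto
    qed simp
    also have "(\<Prod>p\<in>{p. prime p \<and> p \<le> y}. h p) = (\<Prod>p\<in>{p. prime p \<and> p \<le> y}. hit_factor D p (int c))"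
      using hh by (intro prod.cong) auto
    finally show ?thesis .
  qed
  have "0 \<le> (\<Prod>p\<in>Q. sieve_factor D p)"
    using Q inverse_prime_factor(2) by (intro prod_nonneg) (auto simp: sieve_factor_def less_imp_le)
  then show ?thesis unfolding eq by (rule mult_left_mono[OF le])
qed

lemma sum_hit_factor_interval_le:
  assumes Y: "4 ^ y \<le> Y"
  shows "(\<Sum>c\<in>{c. 1 \<le> c \<and> real c < Y}. \<Prod>p\<in>{p. prime p \<and> p \<le> y}. hit_factor D p (int c))
    \<le> 2 * exp 1 * Y * (\<Prod>p\<in>{p. prime p \<and> p \<le> y}. if p dvd D then 1 - 1 / real p else 1)"
proof -
  let ?Q = "{p. prime p \<and> p \<le> y}"
  define M where "M = real (\<Prod>?Q)"
  have fin: "finite ?Q" by simp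
  have pr: "prime p" if "p \<in> ?Q" for p using that by simp
  have M1: "0 < M" unfolding M_def using prime_gt_0_nat by (auto intro!: prod_pos)
  have "M \<le> real (4 ^ y)" unfolding M_def of_nat_le_iff by (rule primorial_le)
  then have MY: "M \<le> Y" using Y by simp
  have Y0: "0 < Y" using MY M1 by linarith
  \<comment> \<open>The period \<open>M\<close> is at most \<open>4 ^ y \<le> Y\<close>, so rounding
    up to \<open>h\<close> whole periods at most doubles the length.\<close>
  define h where "h = nat \<lceil>Y / M\<rceil>"
  have h: "real h \<le> Y / M + 1" "Y / M \<le> real h" using Y0 M1 unfolding h_def by (auto simp: of_nat_nat)
  have hM: "Y \<le> real h * M" "real h * M \<le> 2 * Y"
  proof -
    show "Y \<le> real h * M" using h(2) M1 by (simp add: field_simps)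
    have "real h * M \<le> (Y / M + 1) * M" using h(1) M1 by (intro mult_right_mono) auto
    also have "(Y / M + 1) * M = Y + M" using M1 by (simp add: distrib_right)
    finally show "real h * M \<le> 2 * Y" using MY by linarith
  qed
  define W where "W z = (\<Prod>p\<in>?Q. hit_factor D p z)" for z
  have per: "hit_factor D p (x mod int p) = hit_factor D p x" for p x
    by (simp add: hit_factor_def dvd_mod_iff)
  have W0: "0 \<le> W z" for z unfolding W_def by (intro prod_nonneg hit_factor_nonneg) auto
  have "(\<Sum>c\<in>{c. 1 \<le> c \<and> real c < Y}. W (int c)) = (\<Sum>z\<in>(\<lambda>c. c - 1) ` {c. 1 \<le> c \<and> real c < Y}. W (1 + int z))"
    by (subst sum.reindex) (auto simp: inj_on_def of_nat_diff)
  also have "\<dots> \<le> (\<Sum>z<h * \<Prod>?Q. W (1 + int z))"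
  proof (rule sum_mono2)
    show "(\<lambda>c. c - 1) ` {c. 1 \<le> c \<and> real c < Y} \<subseteq> {..<h * \<Prod>?Q}"
    proof
      fix z assume "z \<in> (\<lambda>c. c - 1) ` {c. 1 \<le> c \<and> real c < Y}"
      then obtain c where c: "1 \<le> c" "real c < Y" "z = c - 1" by auto
      then have "real c < real (h * \<Prod>?Q)" using hM(1) unfolding M_def by simp
      then have "c < h * \<Prod>?Q" by (simp only: of_nat_less_iff)
      then show "z \<in> {..<h * \<Prod>?Q}" using c by simp
    qed
  qed (use W0 in auto)
  also have "\<dots> = real h * (\<Prod>p\<in>?Q. \<Sum>y<p. hit_factor D p (int y))"
    unfolding W_def using per pr by (intro sum_prod_periodic fin) auto
  also have "\<dots> \<le> real h * (\<Prod>p\<in>?Q. real p * ((if p dvd D then 1 - 1 / real p else 1) * exp (1 / (real p * (real p - 1)))))"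
    by (intro mult_left_mono prod_mono conjI sum_nonneg hit_factor_nonneg sum_hit_factor_le) auto
  also have "\<dots> = real h * M * ((\<Prod>p\<in>?Q. if p dvd D then 1 - 1 / real p else 1) * exp (\<Sum>p\<in>?Q. 1 / (real p * (real p - 1))))"
    by (simp add: prod.distrib M_def exp_sum)
  also have "\<dots> \<le> (2 * Y) * ((\<Prod>p\<in>?Q. if p dvd D then 1 - 1 / real p else 1) * exp 1)"
  proof -
    have n: "0 \<le> (\<Prod>p\<in>?Q. if p dvd D then 1 - 1 / real p else 1)"
      using inverse_prime_factor(2) by (intro prod_nonneg) (auto simp: less_imp_le)
    have "exp (\<Sum>p\<in>?Q. 1 / (real p * (real p - 1))) \<le> exp (1::real)"
      using sum_inverse_consecutive_le[OF fin pr] by simp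
    from mult_left_mono[OF this n] show ?thesis
      by (rule mult_mono[OF hM(2)]) (use n Y0 in auto)
  qed
  finally show ?thesis by (simp add: W_def mult_ac)
qed

text \<open>The factor 4 combines the two signs of the difference with the rounding to whole
  periods; \<open>exp 4\<close> collects the large prime divisors of the difference and the mean
  values at primes up to \<open>y\<close>.\<close>

lemma card_close_fractions_le:
  assumes pos: "0 < g" "0 < s" "0 < r" and cop: "coprime r s"
    and Q: "finite Q" "\<And>p. p \<in> Q \<Longrightarrow> prime p" "\<And>p. p \<in> Q \<Longrightarrow> p dvd g"
    and Y: "4 ^ y \<le> Y" "Y < 4 ^ (y + 1)"
  shows "real (card (\<Union>c\<in>{c. c \<noteq> 0 \<and> \<bar>real_of_int c\<bar> < Y}. coprime_sols (g * s) (g * r) s r c))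
    \<le> 4 * exp 4 * real g * Y * (\<Prod>p\<in>Q. sieve_factor (r * s) p) * (\<Prod>p\<in>{p. prime p \<and> p \<le> y}. if p dvd r * s then 1 - 1 / real p else 1)"
proof -
  let ?S = "coprime_sols (g * s) (g * r) s r"
  define C where "C = {c. 1 \<le> c \<and> real c < Y}"
  have finC: "finite C" unfolding C_def by (rule finite_subset[of _ "{..nat \<lceil>Y\<rceil>}"]) (auto, linarith)
  define \<beta> where "\<beta> = (\<Prod>p\<in>Q. sieve_factor (r * s) p)"
  have \<beta>: "0 \<le> \<beta>" unfolding \<beta>_def sieve_factor_def using inverse_prime_factor(2) Q by (intro prod_nonneg) (auto simp: less_imp_le)
  define H where "H c = (\<Prod>p\<in>{p. prime p \<and> p \<le> y}. hit_factor (r * s) p (int c))" for c :: nat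
  have H0: "0 \<le> H c" for c unfolding H_def by (intro prod_nonneg hit_factor_nonneg) auto
  have one: "real (card (?S c)) \<le> real g * \<beta> * exp 3 * H k" if k: "k \<in> C" and c: "c = int k \<or> c = - int k" for c k
  proof (cases "?S c = {}")
    case True
    then show ?thesis using \<beta> H0 by simp
  next
    case False
    then obtain a b where "(a, b) \<in> ?S c" by auto
    then have av: "\<not> p dvd k" if "prime p" "p dvd r * s" for p
      using coprime_sols_rhs[OF cop \<open>(a, b) \<in> ?S c\<close> that] c by fastforce
    have "real k < 4 ^ (y + 1)" using k Y by (simp add: C_def)
    then have "k < 4 ^ (y + 1)" by (metis of_nat_less_iff of_nat_numeral of_nat_power)
    have "real (card (?S c)) \<le> real g * (\<Prod>p\<in>Q. if p dvd r * s \<or> int p dvd c then 1 - 1 / real p else (1 - 1 / real p)^2)"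
      by (rule card_coprime_sols_le[OF pos cop Q])
    also have "(\<Prod>p\<in>Q. if p dvd r * s \<or> int p dvd c then 1 - 1 / real p else (1 - 1 / real p)^2)
        = (\<Prod>p\<in>Q. if p dvd r * s \<or> int p dvd int k then 1 - 1 / real p else (1 - 1 / real p)^2)"
      using c by (intro prod.cong) auto
    also have "\<dots> \<le> \<beta> * (exp 3 * H k)"
      unfolding \<beta>_def H_def using k \<open>k < 4 ^ (y + 1)\<close> av by (intro sieve_pointwise Q) (auto simp: C_def)
    finally show ?thesis by (simp add: mult.assoc mult_left_mono)
  qed
  have "(\<Union>c\<in>{c. c \<noteq> 0 \<and> \<bar>real_of_int c\<bar> < Y}. ?S c) \<subseteq> (\<Union>k\<in>C. ?S (int k) \<union> ?S (- int k))"
  proof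
    fix x assume "x \<in> (\<Union>c\<in>{c. c \<noteq> 0 \<and> \<bar>real_of_int c\<bar> < Y}. ?S c)"
    then obtain c where c: "c \<noteq> 0" "\<bar>real_of_int c\<bar> < Y" "x \<in> ?S c" by auto
    define k where "k = nat \<bar>c\<bar>"
    have "k \<in> C" using c by (simp add: C_def k_def)
    moreover have "c = int k \<or> c = - int k" by (auto simp: k_def)
    ultimately show "x \<in> (\<Union>k\<in>C. ?S (int k) \<union> ?S (- int k))" using c(3) by blast
  qed
  then have "card (\<Union>c\<in>{c. c \<noteq> 0 \<and> \<bar>real_of_int c\<bar> < Y}. ?S c) \<le> card (\<Union>k\<in>C. ?S (int k) \<union> ?S (- int k))"
    using finC finite_coprime_sols by (intro card_mono) auto
  also have "\<dots> \<le> (\<Sum>k\<in>C. card (?S (int k) \<union> ?S (- int k)))" by (rule card_UN_le[OF finC])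
  also have "\<dots> \<le> (\<Sum>k\<in>C. card (?S (int k)) + card (?S (- int k)))" by (intro sum_mono card_Un_le)
  finally have "real (card (\<Union>c\<in>{c. c \<noteq> 0 \<and> \<bar>real_of_int c\<bar> < Y}. ?S c)) \<le> (\<Sum>k\<in>C. real (card (?S (int k))) + real (card (?S (- int k))))"
    by (simp flip: of_nat_add of_nat_sum)
  also have "\<dots> \<le> (\<Sum>k\<in>C. real g * \<beta> * exp 3 * H k + real g * \<beta> * exp 3 * H k)"
    using one by (intro sum_mono add_mono) auto
  also have "\<dots> = 2 * (real g * \<beta> * exp 3) * (\<Sum>k\<in>C. H k)"
    unfolding sum_distrib_left by (intro sum.cong refl) simp
  also have "\<dots> \<le> 2 * (real g * \<beta> * exp 3) * (2 * exp 1 * Y * (\<Prod>p\<in>{p. prime p \<and> p \<le> y}. if p dvd r * s then 1 - 1 / real p else 1))"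
    unfolding H_def C_def using \<beta> by (intro mult_left_mono sum_hit_factor_interval_le Y) auto
  also have "\<dots> = 4 * (exp 3 * exp 1) * real g * Y * \<beta> * (\<Prod>p\<in>{p. prime p \<and> p \<le> y}. if p dvd r * s then 1 - 1 / real p else 1)"
    by simp
  also have "exp 3 * exp 1 = exp (4::real)" by (simp flip: exp_add)
  finally show ?thesis by (simp add: \<beta>_def)
qed

section \<open>Arcs around reduced fractions\<close>

definition psi_mass :: "(nat \<Rightarrow> real) \<Rightarrow> nat \<Rightarrow> real" where
  "psi_mass \<psi> n = \<psi> n * real (totient n) / real n"

definition numerators :: "nat \<Rightarrow> nat set" where
  "numerators n = {a::nat. 1 \<le> a \<and> a \<le> n \<and> gcd a n = 1}"

definition approx_arc :: "(nat \<Rightarrow> real) \<Rightarrow> nat \<Rightarrow> nat \<Rightarrow> real set" where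
  "approx_arc \<psi> n a = {(real a - \<psi> n) / real n <..< (real a + \<psi> n) / real n}"

lemma finite_numerators: "finite (numerators n)"
  by (rule finite_subset[of _ "{..n}"]) (auto simp: numerators_def)

lemma card_numerators: "0 < n \<Longrightarrow> card (numerators n) = totient n"
  unfolding numerators_def totient_def totatives_def coprime_iff_gcd_eq_1
  by (rule arg_cong[of _ _ card]) auto

lemma fmeasurable_arc: "approx_arc \<psi> n a \<in> fmeasurable lborel"
  unfolding approx_arc_def
  using emeasure_lborel_box_finite[of "(real a - \<psi> n) / real n" "(real a + \<psi> n) / real n"]
  by (intro fmeasurableI) (simp_all add: box_real)

lemma measure_arc_Int_le:
  assumes "0 < m" "0 < n" "0 \<le> \<psi> m" "0 \<le> \<psi> n"
  shows "measure lborel (approx_arc \<psi> m a \<inter> approx_arc \<psi> n b) \<le> 2 * min (\<psi> m / real m) (\<psi> n / real n)"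
proof -
  have len: "measure lborel (approx_arc \<psi> k c) = 2 * (\<psi> k / real k)" if "0 < k" "0 \<le> \<psi> k" for k c
    using that by (simp add: approx_arc_def divide_right_mono diff_divide_distrib add_divide_distrib)
  have "measure lborel (approx_arc \<psi> m a \<inter> approx_arc \<psi> n b) \<le> measure lborel (approx_arc \<psi> m a)"
    "measure lborel (approx_arc \<psi> m a \<inter> approx_arc \<psi> n b) \<le> measure lborel (approx_arc \<psi> n b)"
    by (intro measure_mono_fmeasurable Int_lower1 Int_lower2 fmeasurable_arc; simp add: approx_arc_def)+
  then show ?thesis using len assms by simp
qed

lemma arc_Int_nonempty:
  assumes "0 < m" "0 < n" and "approx_arc \<psi> m a \<inter> approx_arc \<psi> n b \<noteq> {}"
  shows "\<bar>real a / real m - real b / real n\<bar> < \<psi> m / real m + \<psi> n / real n"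
proof -
  obtain x where "x \<in> approx_arc \<psi> m a" "x \<in> approx_arc \<psi> n b" using assms(3) by blast
  then have "real a / real m - \<psi> m / real m < x" "x < real a / real m + \<psi> m / real m"
    "real b / real n - \<psi> n / real n < x" "x < real b / real n + \<psi> n / real n"
    by (auto simp: approx_arc_def diff_divide_distrib add_divide_distrib)
  then show ?thesis by linarith
qed

locale prime_support =
  fixes P :: "nat set"
  assumes finP: "finite P" and primeP: "p \<in> P \<Longrightarrow> prime p"
begin

definition supported :: "nat \<Rightarrow> bool" where
  "supported n \<longleftrightarrow> 0 < n \<and> prime_factors n \<subseteq> P"

abbreviation val :: "nat \<Rightarrow> nat \<Rightarrow> nat" where "val n p \<equiv> multiplicity p n"

lemma supported_prod: "n = (\<Prod>p\<in>P. p ^ val n p)" if "supported n"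
proof -
  have "n = (\<Prod>p\<in>prime_factors n. p ^ val n p)" using that by (intro prime_factorization_nat) (simp add: supported_def)
  also have "\<dots> = (\<Prod>p\<in>P. p ^ val n p)"
    using that finP primeP
    by (intro prod.mono_neutral_left) (auto simp: supported_def prime_factors_multiplicity)
  finally show ?thesis .
qed

lemma supported_totient: "real (totient n) / real n = totfac P (val n)" if "supported n"
proof -
  have n0: "0 < n" using that by (simp add: supported_def)
  have "real (totient n) / real n = (\<Prod>p\<in>prime_factors n. 1 - 1 / real p)"
    unfolding totient_formula2 using n0 by simp
  also have "\<dots> = (\<Prod>p\<in>P. if val n p = 0 then 1 else 1 - 1 / real p)"
    using that finP primeP n0
    by (intro prod.mono_neutral_cong_left) (auto simp: supported_def prime_factors_multiplicity)
  finally show ?thesis by (simp add: totfac_def)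
qed

lemma psi_mass_eq: "psi_mass \<psi> n = \<psi> n * totfac P (val n)" if "supported n"
  by (simp add: psi_mass_def supported_totient[OF that, symmetric])

lemma supported_eqI:
  assumes "\<And>p. p \<in> P \<Longrightarrow> val m p = val n p" "supported m" "supported n"
  shows "m = n"
proof -
  have "m = (\<Prod>p\<in>P. p ^ val m p)" by (rule supported_prod[OF assms(2)])
  also have "\<dots> = (\<Prod>p\<in>P. p ^ val n p)" using assms(1) by (intro prod.cong) auto
  also have "\<dots> = n" by (rule supported_prod[OF assms(3), symmetric])
  finally show ?thesis .
qed

lemma prime_dvd_prod_powers:
  assumes "prime p"
  shows "p dvd (\<Prod>q\<in>P. q ^ k q) \<longleftrightarrow> p \<in> P \<and> 0 < k p"
proof -
  have "(\<Prod>q\<in>P. q ^ k q) \<noteq> 0" using finP primeP prime_gt_0_nat by (auto simp: prod_zero_iff)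
  then have "p dvd (\<Prod>q\<in>P. q ^ k q) \<longleftrightarrow> 0 < multiplicity p (\<Prod>q\<in>P. q ^ k q)"
    using assms by (simp add: prime_multiplicity_gt_zero_iff)
  also have "multiplicity p (\<Prod>q\<in>P. q ^ k q) = (if p \<in> P then k p else 0)"
    by (rule multiplicity_prod_prime_powers[OF finP primeP assms])
  finally show ?thesis by simp
qed

text \<open>Intersecting arcs correspond to differences \<open>c\<close> with
  \<open>\<bar>c\<bar> < Y\<close>, and \<open>y\<close> is chosen so that
  \<open>4 ^ y \<le> Y < 4 ^ (y + 1)\<close>. Sieving numerators by the common primes, and the
  differences by the primes up to \<open>y\<close>, recovers both factors
  \<open>\<phi>(n) / n\<close> except at differing primes beyond \<open>y\<close>.\<close>

lemma overlap_bound: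
  assumes m: "supported m" and n: "supported n" and \<psi>: "0 \<le> \<psi> m" "0 \<le> \<psi> n"
  obtains y :: nat where
    "\<psi> m * rdist P (val m) (val n) < 4 ^ (y + 1)" "\<psi> n * rdist P (val n) (val m) < 4 ^ (y + 1)"
    "(\<Sum>a\<in>numerators m. \<Sum>b\<in>numerators n. measure lborel (approx_arc \<psi> m a \<inter> approx_arc \<psi> n b))
      \<le> (if m = n then 2 * psi_mass \<psi> m else 0) + 16 * exp 4 * psi_mass \<psi> m * psi_mass \<psi> n *
        (\<Prod>p\<in>{p\<in>P. val m p \<noteq> val n p \<and> y < p}. inverse (1 - 1 / real p))"
proof -
  define g where "g = (\<Prod>p\<in>P. p ^ min (val m p) (val n p))"
  define r where "r = (\<Prod>p\<in>P. p ^ (val n p - val m p))"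
  define s where "s = (\<Prod>p\<in>P. p ^ (val m p - val n p))"
  have pos: "0 < m" "0 < n" using m n by (auto simp: supported_def)
  have gsr: "0 < g" "0 < s" "0 < r" unfolding g_def s_def r_def
    using primeP prime_gt_0_nat by (auto intro!: prod_pos)
  have mn: "min i j + (i - j) = i" "min i j + (j - i) = j" for i j :: nat by simp_all
  have "g * s = m" "g * r = n"
    unfolding g_def s_def r_def prod.distrib[symmetric] power_add[symmetric] mn
    using supported_prod[OF m] supported_prod[OF n] by simp_all
  then have ms: "m = g * s" and nr: "n = g * r" by simp_all
  have cop: "coprime r s"
  proof (rule ccontr)
    assume "\<not> coprime r s"
    then have "gcd r s \<noteq> 1" using coprime_iff_gcd_eq_1 by blast
    then obtain p where "prime p" "p dvd gcd r s" using prime_factor_nat by blast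
    then show False unfolding r_def s_def by (auto simp: prime_dvd_prod_powers)
  qed
  have dvdD: "p dvd r * s \<longleftrightarrow> p \<in> P \<and> val m p \<noteq> val n p" if "prime p" for p
    unfolding prime_dvd_mult_iff[OF that] unfolding r_def s_def prime_dvd_prod_powers[OF that] by auto
  define Q where "Q = {p\<in>P. p dvd g}"
  have Q: "finite Q" "\<And>p. p \<in> Q \<Longrightarrow> prime p" "\<And>p. p \<in> Q \<Longrightarrow> p dvd g" using finP primeP by (auto simp: Q_def)
  have Qiff: "p \<in> Q \<longleftrightarrow> 0 < val m p \<and> 0 < val n p" if "p \<in> P" for p
    unfolding Q_def g_def using that prime_dvd_prod_powers[OF primeP[OF that]] by auto
  define u v where "u = \<psi> m / real m" and "v = \<psi> n / real n"
  have uv: "0 \<le> u" "0 \<le> v" using \<psi> by (auto simp: u_def v_def)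
  \<comment> \<open>The least common multiple of \<open>m\<close> and \<open>n\<close>;
    \<open>Y\<close> is the sum of the two radii in units of \<open>1 / L\<close>.\<close>
  define L where "L = real (g * r * s)"
  have L0: "0 < L" using gsr by (simp add: L_def)
  define Y where "Y = (u + v) * L"
  have uL: "u * L = \<psi> m * real r" "v * L = \<psi> n * real s"
    using gsr by (auto simp: u_def v_def L_def ms nr)
  have Yle: "\<psi> m * rdist P (val m) (val n) \<le> Y" "\<psi> n * rdist P (val n) (val m) \<le> Y"
  proof -
    have "rdist P (val m) (val n) = real r" "rdist P (val n) (val m) = real s"
      by (simp_all add: rdist_def r_def s_def)
    then show "\<psi> m * rdist P (val m) (val n) \<le> Y" "\<psi> n * rdist P (val n) (val m) \<le> Y"
      using uL \<psi> uv L0 by (auto simp: Y_def distrib_right)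
  qed
  define T where "T = (\<Union>c\<in>{c. c \<noteq> 0 \<and> \<bar>real_of_int c\<bar> < Y}. coprime_sols m n s r c)"
  let ?mu = "\<lambda>a b. measure lborel (approx_arc \<psi> m a \<inter> approx_arc \<psi> n b)"
  have mu0: "?mu a b = 0" if ab: "a \<in> numerators m" "b \<in> numerators n" "(a, b) \<notin> T" "\<not> (m = n \<and> a = b)" for a b
  proof (rule ccontr)
    assume "?mu a b \<noteq> 0"
    then have ne: "approx_arc \<psi> m a \<inter> approx_arc \<psi> n b \<noteq> {}" by auto
    define c where "c = int a * int r - int b * int s"
    have "real a / real m - real b / real n = real_of_int c / L"
      using gsr by (simp add: ms nr L_def c_def field_simps)
    then have "\<bar>real_of_int c\<bar> / L < u + v"
      using arc_Int_nonempty[OF pos ne] L0 by (simp add: u_def v_def)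
    then have cY: "\<bar>real_of_int c\<bar> < Y" using L0 by (simp add: Y_def field_simps)
    have sol: "(a, b) \<in> coprime_sols m n s r c" using ab by (simp add: coprime_sols_def numerators_def c_def)
    \<comment> \<open>Equal centres are equal reduced fractions, which forces
      \<open>r = s = 1\<close> and the diagonal pair.\<close>
    have "c = 0" using ab(3) sol cY by (auto simp: T_def)
    then have eq: "a * r = b * s" unfolding c_def by (simp flip: of_nat_mult)
    have "r dvd b" using eq cop by (metis coprime_dvd_mult_left_iff dvd_triv_right)
    then have "r dvd gcd b n" using nr by (intro gcd_greatest) auto
    moreover have "gcd b n = 1" using ab(2) by (simp only: numerators_def mem_Collect_eq)
    ultimately have r1: "r = 1" by (simp only: nat_dvd_1_iff_1)
    have "s dvd a" using eq cop by (metis coprime_commute coprime_dvd_mult_left_iff dvd_triv_right)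
    then have "s dvd gcd a m" using ms by (intro gcd_greatest) auto
    moreover have "gcd a m = 1" using ab(1) by (simp only: numerators_def mem_Collect_eq)
    ultimately have s1: "s = 1" by (simp only: nat_dvd_1_iff_1)
    show False using ab(4) r1 s1 eq ms nr by simp
  qed
  have finT: "finite T"
    unfolding T_def by (rule finite_subset[of _ "{..m} \<times> {..n}"]) (auto simp: coprime_sols_def)
  have mub: "?mu a b \<le> 2 * min u v" for a b
    unfolding u_def v_def by (rule measure_arc_Int_le[OF pos \<psi>])
  have main: "(\<Sum>a\<in>numerators m. \<Sum>b\<in>numerators n. ?mu a b) \<le> (if m = n then 2 * psi_mass \<psi> m else 0) + 2 * min u v * real (card T)"
  proof -
    have "(\<Sum>a\<in>numerators m. \<Sum>b\<in>numerators n. ?mu a b)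
        \<le> (\<Sum>a\<in>numerators m. \<Sum>b\<in>numerators n. (if m = n \<and> a = b then 2 * u else 0) + (if (a, b) \<in> T then 2 * min u v else 0))"
    proof (intro sum_mono)
      fix a b assume ab: "a \<in> numerators m" "b \<in> numerators n"
      have "2 * min u v \<le> 2 * u" "0 \<le> 2 * min u v" using uv by auto
      then show "?mu a b \<le> (if m = n \<and> a = b then 2 * u else 0) + (if (a, b) \<in> T then 2 * min u v else 0)"
        using mub[of a b] mu0[OF ab] by (cases "(a, b) \<in> T"; cases "m = n \<and> a = b") (auto simp: uv intro: order_trans)
    qed
    also have "\<dots> = (\<Sum>a\<in>numerators m. \<Sum>b\<in>numerators n. if m = n \<and> a = b then 2 * u else 0) + (\<Sum>a\<in>numerators m. \<Sum>b\<in>numerators n. if (a, b) \<in> T then 2 * min u v else 0)"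
      by (simp only: sum.distrib)
    also have "(\<Sum>a\<in>numerators m. \<Sum>b\<in>numerators n. if m = n \<and> a = b then 2 * u else 0) = (if m = n then 2 * psi_mass \<psi> m else 0)"
    proof (cases "m = n")
      case True
      have "(\<Sum>a\<in>numerators m. \<Sum>b\<in>numerators n. if m = n \<and> a = b then 2 * u else 0) = (\<Sum>a\<in>numerators m. 2 * u)"
        using True finite_numerators by (intro sum.cong refl) (simp add: sum.delta)
      also have "\<dots> = 2 * psi_mass \<psi> m" using pos by (simp add: card_numerators psi_mass_def u_def)
      finally show ?thesis using True by simp
    qed simp
    also have "(\<Sum>a\<in>numerators m. \<Sum>b\<in>numerators n. if (a, b) \<in> T then 2 * min u v else 0) = (\<Sum>x\<in>numerators m \<times> numerators n. if x \<in> T then 2 * min u v else 0)"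
      by (simp add: sum.cartesian_product)
    also have "\<dots> = (\<Sum>x\<in>T. 2 * min u v)"
      by (intro sum.mono_neutral_cong_right) (use finite_numerators in \<open>auto simp: T_def coprime_sols_def numerators_def\<close>)
    also have "(\<Sum>x\<in>T. 2 * min u v) = 2 * min u v * real (card T)" by simp
    finally show ?thesis .
  qed
  define Tail where "Tail y = (\<Prod>p\<in>{p\<in>P. val m p \<noteq> val n p \<and> y < p}. inverse (1 - 1 / real p))" for y :: nat
  have Tail0: "0 \<le> Tail y" for y unfolding Tail_def using primeP inverse_prime_factor(2) by (intro prod_nonneg) (auto simp: less_imp_le)
  have D0: "0 \<le> psi_mass \<psi> m" "0 \<le> psi_mass \<psi> n" using \<psi> by (auto simp: psi_mass_def)
  show thesis
  proof (cases "Y \<le> 1")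
    case True
    \<comment> \<open>No nonzero integer is below 1 in absolute value, so only the diagonal
      contributes.\<close>
    have e: "{c::int. c \<noteq> 0 \<and> \<bar>real_of_int c\<bar> < Y} = {}" using True by auto
    have "T = {}" unfolding T_def e by simp
    then have "(\<Sum>a\<in>numerators m. \<Sum>b\<in>numerators n. ?mu a b) \<le> (if m = n then 2 * psi_mass \<psi> m else 0) + 16 * exp 4 * psi_mass \<psi> m * psi_mass \<psi> n * Tail 0"
      using main D0 Tail0[of 0] by (intro order_trans[OF main]) simp
    then show thesis using that[of 0] Yle True by (simp add: Tail_def)
  next
    case False
    define y where "y = (GREATEST k. (4::real) ^ k \<le> Y)"
    have bnd: "k \<le> nat \<lceil>Y\<rceil>" if "(4::real) ^ k \<le> Y" for k
    proof -
      have "k < 4 ^ k" by (simp add: power_gt_expt)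
      then have "real k < real (4 ^ k)" by (simp only: of_nat_less_iff)
      then have "real k < 4 ^ k" by (simp only: of_nat_power of_nat_numeral)
      then have "real k \<le> Y" using that by linarith
      then show ?thesis by linarith
    qed
    have y: "4 ^ y \<le> Y" unfolding y_def
      by (rule GreatestI_nat[where k = 0 and b = "nat \<lceil>Y\<rceil>"]) (use False bnd in auto)
    have y': "Y < 4 ^ (y + 1)"
    proof (rule ccontr)
      assume "\<not> Y < 4 ^ (y + 1)"
      then have "y + 1 \<le> y" unfolding y_def by (intro Greatest_le_nat[where b = "nat \<lceil>Y\<rceil>"]) (use bnd in auto)
      then show False by simp
    qed
    have "real (card T) \<le> 4 * exp 4 * real g * Y * (\<Prod>p\<in>Q. sieve_factor (r * s) p) * (\<Prod>p\<in>{p. prime p \<and> p \<le> y}. if p dvd r * s then 1 - 1 / real p else 1)"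
      unfolding T_def ms nr by (rule card_close_fractions_le[OF gsr cop Q y y'])
    also have "\<dots> = 4 * exp 4 * real g * Y * ((\<Prod>p\<in>Q. sieve_factor (r * s) p) * (\<Prod>p\<in>{p. prime p \<and> p \<le> y}. if p dvd r * s then 1 - 1 / real p else 1))"
      by simp
    \<comment> \<open>Prime by prime: equal positive valuations give the square from the sieve;
      different positive ones give one factor from the sieve and, for \<open>p \<le> y\<close>, one
      from averaging; if exactly one valuation is positive, only the averaging factor occurs.
      \<open>Tail\<close> restores what is missing for \<open>p > y\<close>.\<close>
    also have "(\<Prod>p\<in>Q. sieve_factor (r * s) p) * (\<Prod>p\<in>{p. prime p \<and> p \<le> y}. if p dvd r * s then 1 - 1 / real p else 1)
        = totfac P (val m) * totfac P (val n) * Tail y"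
    proof -
      have 1: "(\<Prod>p\<in>Q. sieve_factor (r * s) p) = (\<Prod>p\<in>P. if p \<in> Q then sieve_factor (r * s) p else 1)"
        using finP by (intro prod.mono_neutral_cong_left) (auto simp: Q_def)
      have 2: "(\<Prod>p\<in>{p. prime p \<and> p \<le> y}. if p dvd r * s then 1 - 1 / real p else 1)
        = (\<Prod>p\<in>P. if p \<le> y \<and> val m p \<noteq> val n p then 1 - 1 / real p else 1)"
      proof -
        have "(\<Prod>p\<in>{p. prime p \<and> p \<le> y}. if p dvd r * s then 1 - 1 / real p else 1)
          = (\<Prod>p\<in>{p. prime p \<and> p \<le> y} \<inter> P. if p \<le> y \<and> val m p \<noteq> val n p then 1 - 1 / real p else 1)"
          using dvdD by (intro prod.mono_neutral_cong_right) auto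
        also have "\<dots> = (\<Prod>p\<in>P. if p \<le> y \<and> val m p \<noteq> val n p then 1 - 1 / real p else 1)"
          using finP primeP by (intro prod.mono_neutral_cong_left) auto
        finally show ?thesis .
      qed
      have 3: "Tail y = (\<Prod>p\<in>P. if val m p \<noteq> val n p \<and> y < p then inverse (1 - 1 / real p) else 1)"
        unfolding Tail_def using finP by (intro prod.inter_filter) auto
      show ?thesis unfolding 1 2 3 totfac_def prod.distrib[symmetric]
      proof (rule prod.cong[OF refl])
        fix p assume p: "p \<in> P"
        define x where "x = 1 - 1 / real p"
        have "0 < x" unfolding x_def by (rule inverse_prime_factor(2)[OF primeP[OF p]])
        then have x: "x \<noteq> 0" by simp
        have pp: "prime p" by (rule primeP[OF p])
        show "(if p \<in> Q then sieve_factor (r * s) p else 1) * (if p \<le> y \<and> val m p \<noteq> val n p then 1 - 1 / real p else 1)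
          = (if val m p = 0 then 1 else 1 - 1 / real p) * (if val n p = 0 then 1 else 1 - 1 / real p) *
            (if val m p \<noteq> val n p \<and> y < p then inverse (1 - 1 / real p) else 1)"
          unfolding sieve_factor_def x_def[symmetric] Qiff[OF p] dvdD[OF pp] using p x
          by (auto simp: power2_eq_square not_le not_less)
      qed
    qed
    finally have cT: "real (card T) \<le> 4 * exp 4 * real g * Y * (totfac P (val m) * totfac P (val n) * Tail y)" .
    have "2 * min u v * real (card T) \<le> 2 * min u v * (4 * exp 4 * real g * Y * (totfac P (val m) * totfac P (val n) * Tail y))"
      using cT uv by (intro mult_left_mono) auto
    also have "\<dots> = 8 * exp 4 * (real g * L) * (min u v * (u + v)) * (totfac P (val m) * totfac P (val n) * Tail y)"
      by (simp add: Y_def)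
    also have "\<dots> \<le> 8 * exp 4 * (real g * L) * (2 * (u * v)) * (totfac P (val m) * totfac P (val n) * Tail y)"
    proof (intro mult_right_mono mult_left_mono)
      have "min u v * (u + v) = min u v * min u v + u * v" by (simp add: min_def algebra_simps)
      also have "min u v * min u v \<le> u * v" using uv by (intro mult_mono) auto
      finally show "min u v * (u + v) \<le> 2 * (u * v)" by simp
      show "0 \<le> totfac P (val m) * totfac P (val n) * Tail y"
        using totfac_pos[of P "val m"] totfac_pos[of P "val n"] primeP Tail0 by (intro mult_nonneg_nonneg) (auto intro: less_imp_le)
      show "0 \<le> 8 * exp 4 * (real g * L)" using L0 by simp
    qed
    also have "\<dots> = 16 * exp 4 * psi_mass \<psi> m * psi_mass \<psi> n * Tail y"
    proof -
      have "real g * L = real m * real n" by (simp add: L_def ms nr)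
      then have "real g * L * (u * v) = \<psi> m * \<psi> n" using pos by (simp add: u_def v_def)
      moreover have "psi_mass \<psi> m = \<psi> m * totfac P (val m)" "psi_mass \<psi> n = \<psi> n * totfac P (val n)"
        by (rule psi_mass_eq[OF m] psi_mass_eq[OF n])+
      ultimately show ?thesis by (simp add: mult_ac)
    qed
    finally have "2 * min u v * real (card T) \<le> 16 * exp 4 * psi_mass \<psi> m * psi_mass \<psi> n * Tail y" .
    then have fin: "(\<Sum>a\<in>numerators m. \<Sum>b\<in>numerators n. ?mu a b) \<le> (if m = n then 2 * psi_mass \<psi> m else 0) + 16 * exp 4 * psi_mass \<psi> m * psi_mass \<psi> n * Tail y"
      by (intro order_trans[OF main] add_left_mono)
    show thesis
      by (rule that[OF le_less_trans[OF Yle(1) y'] le_less_trans[OF Yle(2) y'] fin[unfolded Tail_def]])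
  qed
qed

end

section \<open>Positive measure\<close>

lemma inverse_prime_factor_le_exp: "prime p \<Longrightarrow> inverse (1 - 1 / real p) \<le> exp (2 * (1 / real p))"
proof -
  assume "prime p"
  then have p: "2 \<le> real p" using prime_ge_2_nat by fastforce
  have "inverse (1 - 1 / real p) = 1 + 1 / (real p - 1)" using p by (simp add: field_simps)
  also have "1 / (real p - 1) \<le> 1 / (real p / 2)" using p by (intro divide_left_mono) auto
  also have "1 / (real p / 2) = 2 * (1 / real p)" by simp
  also have "1 + 2 * (1 / real p) \<le> exp (2 * (1 / real p))" by (rule exp_ge_add_one_self)
  finally show ?thesis by simp
qed

text \<open>Extended to all integers from 2 to \<open>t + 1\<close>, the product telescopes.\<close>

lemma prod_small_primes_le:
  assumes "finite A" "\<And>p. p \<in> A \<Longrightarrow> prime p \<and> p \<le> t"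
  shows "(\<Prod>p\<in>A. inverse (1 - 1 / real p)) \<le> real t + 1"
proof -
  have tel: "(\<Prod>k\<in>{2..Suc n}. inverse (1 - 1 / real k)) = real (Suc n)" for n
  proof (induction n)
    case (Suc n)
    have "{2..Suc (Suc n)} = insert (Suc (Suc n)) {2..Suc n}" by auto
    then show ?case using Suc by (simp add: field_simps)
  qed simp
  have "(\<Prod>p\<in>A. inverse (1 - 1 / real p)) \<le> (\<Prod>k\<in>{2..Suc t}. inverse (1 - 1 / real k))"
  proof (rule prod_mono2)
    show "A \<subseteq> {2..Suc t}" using assms prime_ge_2_nat by fastforce
    show "1 \<le> inverse (1 - 1 / real b)" if "b \<in> {2..Suc t} - A" for b
      using that by (simp add: field_simps)
    show "0 \<le> inverse (1 - 1 / real a)" if "a \<in> A" for a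
      using that assms inverse_prime_factor(1)[of a] by (meson order_trans zero_le_one)
  qed simp
  then show ?thesis unfolding tel by simp
qed

text \<open>With \<open>t\<close> the last level at which the tail sum \<open>L\<close> exceeds 1, the primes beyond
  \<open>t\<close> contribute \<open>O(1)\<close> and the trivial bound \<open>t + 1\<close> is used below; the bilinear bound
  will make up for it by a factor exponential in \<open>t\<close>.\<close>

lemma prod_inverse_le_levels:
  fixes A :: "nat set"
  assumes fin: "finite A" and pr: "\<And>p. p \<in> A \<Longrightarrow> prime p" and N: "\<And>p. p \<in> A \<Longrightarrow> p \<le> N"
  defines "L \<equiv> \<lambda>t. \<Sum>p\<in>{p\<in>A. t \<le> p}. 1 / real p"
  shows "(\<Prod>p\<in>{p\<in>A. y < p}. inverse (1 - 1 / real p))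
    \<le> exp 2 * (1 + (\<Sum>t\<le>N. if y \<le> t \<and> 1 < L t then real (t + 1) else 0))"
proof -
  have tail: "(\<Prod>p\<in>{p\<in>A. t \<le> p}. inverse (1 - 1 / real p)) \<le> exp 2" if "L t \<le> 1" for t
  proof -
    have "(\<Prod>p\<in>{p\<in>A. t \<le> p}. inverse (1 - 1 / real p)) \<le> (\<Prod>p\<in>{p\<in>A. t \<le> p}. exp (2 * (1 / real p)))"
    proof (rule prod_mono, intro conjI)
      fix p assume "p \<in> {p\<in>A. t \<le> p}"
      then have p: "prime p" using pr by simp
      show "inverse (1 - 1 / real p) \<le> exp (2 * (1 / real p))" by (rule inverse_prime_factor_le_exp[OF p])
      show "0 \<le> inverse (1 - 1 / real p)" using inverse_prime_factor(1)[OF p] by linarith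
    qed
    also have "\<dots> = exp (2 * L t)" unfolding L_def using fin by (simp add: exp_sum sum_distrib_left)
    also have "\<dots> \<le> exp 2" using that by simp
    finally show ?thesis .
  qed
  have inv1: "1 \<le> inverse (1 - 1 / real p)" if "p \<in> A" for p by (rule inverse_prime_factor(1)[OF pr[OF that]])
  have inv0: "0 \<le> inverse (1 - 1 / real p)" if "p \<in> A" for p using inv1[OF that] by linarith
  have S0: "0 \<le> (\<Sum>t\<le>N. if y \<le> t \<and> 1 < L t then real (t + 1) else 0)" by (intro sum_nonneg) auto
  define \<tau> where "\<tau> = (LEAST t. L t \<le> 1)"
  have "{p\<in>A. Suc N \<le> p} = {}" using N by fastforce
  then have LN: "L (Suc N) \<le> 1" unfolding L_def by (simp only: sum.empty)
  have \<tau>: "L \<tau> \<le> 1" "\<tau> \<le> Suc N" unfolding \<tau>_def by (rule LeastI[of _ "Suc N"] Least_le, rule LN)+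
  show ?thesis
  proof (cases "\<tau> \<le> Suc y")
    case True
    have "(\<Prod>p\<in>{p\<in>A. y < p}. inverse (1 - 1 / real p)) \<le> (\<Prod>p\<in>{p\<in>A. \<tau> \<le> p}. inverse (1 - 1 / real p))"
      using fin True inv0 inv1 by (intro prod_mono2) auto
    also have "\<dots> \<le> exp 2 * 1" using tail[OF \<tau>(1)] by simp
    also have "\<dots> \<le> exp 2 * (1 + (\<Sum>t\<le>N. if y \<le> t \<and> 1 < L t then real (t + 1) else 0))"
      using S0 by (intro mult_left_mono) auto
    finally show ?thesis .
  next
    case False
    define t where "t = \<tau> - 1"
    have t: "\<tau> = Suc t" "y \<le> t" "t \<le> N" using False \<tau>(2) by (auto simp: t_def)
    have "\<not> L t \<le> 1" using not_less_Least[of t "\<lambda>t. L t \<le> 1"] t(1) unfolding \<tau>_def[symmetric] by simp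
    then have Lt: "1 < L t" by simp
    have "(\<Prod>p\<in>{p\<in>A. y < p}. inverse (1 - 1 / real p)) \<le> (\<Prod>p\<in>A. inverse (1 - 1 / real p))"
      using fin inv0 inv1 by (intro prod_mono2) auto
    also have "\<dots> = (\<Prod>p\<in>{p\<in>A. p \<le> t} \<union> {p\<in>A. \<tau> \<le> p}. inverse (1 - 1 / real p))"
      by (rule prod.cong) (auto simp: t(1))
    also have "\<dots> = (\<Prod>p\<in>{p\<in>A. p \<le> t}. inverse (1 - 1 / real p)) * (\<Prod>p\<in>{p\<in>A. \<tau> \<le> p}. inverse (1 - 1 / real p))"
      using fin by (intro prod.union_disjoint) (auto simp: t(1))
    also have "\<dots> \<le> (real t + 1) * exp 2"
      using fin pr tail[OF \<tau>(1)] inv0 by (intro mult_mono prod_small_primes_le prod_nonneg) auto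
    also have "\<dots> \<le> exp 2 * (1 + (\<Sum>t\<le>N. if y \<le> t \<and> 1 < L t then real (t + 1) else 0))"
    proof -
      have "real (t + 1) = (if y \<le> t \<and> 1 < L t then real (t + 1) else 0)" using t Lt by simp
      also have "\<dots> \<le> (\<Sum>t\<le>N. if y \<le> t \<and> 1 < L t then real (t + 1) else 0)"
        using t by (intro member_le_sum[of t "{..N}" "\<lambda>t. if y \<le> t \<and> 1 < L t then real (t + 1) else 0"]) auto
      finally show ?thesis by (simp add: mult.commute mult_left_mono)
    qed
    finally show ?thesis .
  qed
qed

lemma sum_linear_geometric_le: "(\<Sum>t\<le>N. real (t + 1) / 2 ^ t) \<le> 4"
proof -
  have "(\<Sum>t\<le>N. real (t + 1) / 2 ^ t) = 4 - real (N + 3) / 2 ^ N" for N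
    by (induction N) (auto simp: field_simps)
  then show ?thesis by simp
qed

text \<open>The lower bound 1 on the mass enters twice: the diagonal is linear in the mass and the
  bilinear bound has total degree 3/2, and both must be dominated by the square.\<close>

lemma total_overlap_bound:
  obtains C where "0 < C"
    "\<And>\<psi> S. finite S \<Longrightarrow> (\<And>n. n \<in> S \<Longrightarrow> 0 < n \<and> 0 \<le> \<psi> n) \<Longrightarrow> 1 \<le> sum (psi_mass \<psi>) S \<Longrightarrow>
      (\<Sum>m\<in>S. \<Sum>n\<in>S. \<Sum>a\<in>numerators m. \<Sum>b\<in>numerators n. measure lborel (approx_arc \<psi> m a \<inter> approx_arc \<psi> n b))
      \<le> C * (sum (psi_mass \<psi>) S)^2"
proof -
  have "(1::real) \<le> exp 2" by simp
  then obtain K where K: "0 < K"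
    "\<And>\<omega> P (e :: nat \<Rightarrow> nat \<Rightarrow> nat) V W \<psi> \<theta> f g. weights \<omega> (exp 2) (16 * exp 8) \<Longrightarrow> finite P \<Longrightarrow> (\<And>p. p \<in> P \<Longrightarrow> prime p) \<Longrightarrow>
      admissible P e V \<psi> f \<Longrightarrow> admissible P e W \<theta> g \<Longrightarrow>
      (\<Sum>v\<in>V. \<Sum>w\<in>W. if close_pair P e \<psi> \<theta> v w then f v * g w * wdist \<omega> P (e v) (e w) else 0)
        \<le> K * root 4 (sum f V) ^ 3 * root 4 (sum g W) ^ 3"
    using bilinear_bound[of "exp 2" "16 * exp 8"] by blast
  define C where "C = 2 + 16 * exp 4 * (exp 2 * (1 + 8 * K))"
  show thesis
  proof (rule that[of C])
    show "0 < C" using K(1) by (auto simp: C_def intro!: add_pos_nonneg)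
    fix \<psi> :: "nat \<Rightarrow> real" and S :: "nat set"
    assume S: "finite S" and pos: "\<And>n. n \<in> S \<Longrightarrow> 0 < n \<and> 0 \<le> \<psi> n" and big: "1 \<le> sum (psi_mass \<psi>) S"
    define \<Psi> where "\<Psi> = sum (psi_mass \<psi>) S"
    define P where "P = (\<Union>n\<in>S. prime_factors n)"
    interpret prime_support P
      by standard (auto simp: P_def S)
    have supp: "supported n" if "n \<in> S" for n
    proof -
      have "prime_factors n \<subseteq> P" using that unfolding P_def by blast
      then show ?thesis using pos[OF that] by (simp add: supported_def)
    qed
    let ?ov = "\<lambda>m n. \<Sum>a\<in>numerators m. \<Sum>b\<in>numerators n. measure lborel (approx_arc \<psi> m a \<inter> approx_arc \<psi> n b)"
    define A where "A m n = {p\<in>P. val m p \<noteq> val n p}" for m n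
    define Rel where "Rel m n y \<longleftrightarrow> \<psi> m * rdist P (val m) (val n) < 4 ^ (y + 1) \<and> \<psi> n * rdist P (val n) (val m) < 4 ^ (y + 1) \<and>
      ?ov m n \<le> (if m = n then 2 * psi_mass \<psi> m else 0) + 16 * exp 4 * psi_mass \<psi> m * psi_mass \<psi> n *
        (\<Prod>p\<in>{p\<in>A m n. y < p}. inverse (1 - 1 / real p))" for m n y
    have "\<exists>y. Rel m n y" if mn: "m \<in> S" "n \<in> S" for m n
    proof (rule overlap_bound[OF supp[OF mn(1)] supp[OF mn(2)], of \<psi>])
      fix y assume y: "\<psi> m * rdist P (val m) (val n) < 4 ^ (y + 1)" "\<psi> n * rdist P (val n) (val m) < 4 ^ (y + 1)"
        "?ov m n \<le> (if m = n then 2 * psi_mass \<psi> m else 0) + 16 * exp 4 * psi_mass \<psi> m * psi_mass \<psi> n *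
          (\<Prod>p\<in>{p\<in>P. val m p \<noteq> val n p \<and> y < p}. inverse (1 - 1 / real p))"
      have "{p\<in>A m n. y < p} = {p\<in>P. val m p \<noteq> val n p \<and> y < p}" by (auto simp: A_def)
      then have "Rel m n y" unfolding Rel_def using y by (simp only: simp_thms)
      then show "\<exists>y. Rel m n y" ..
    qed (use pos mn in auto)
    then have "\<exists>y. \<forall>m n. m \<in> S \<longrightarrow> n \<in> S \<longrightarrow> Rel m n (y m n)" by metis
    then obtain y where Rel: "\<And>m n. m \<in> S \<Longrightarrow> n \<in> S \<Longrightarrow> Rel m n (y m n)" by blast
    note y = Rel[unfolded Rel_def, THEN conjunct1] Rel[unfolded Rel_def, THEN conjunct2, THEN conjunct1]
      Rel[unfolded Rel_def, THEN conjunct2, THEN conjunct2]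
    define N where "N = Max (insert 0 P)"
    have N: "p \<le> N" if "p \<in> P" for p using that finP by (auto simp: N_def)
    define L where "L m n t = (\<Sum>p\<in>{p\<in>A m n. t \<le> p}. 1 / real p)" for m n t
    define bad where "bad t m n \<longleftrightarrow> y m n \<le> t \<and> 1 < L m n t" for t m n
    have mass0: "0 \<le> psi_mass \<psi> n" if "n \<in> S" for n using pos[OF that] by (simp add: psi_mass_def)
    have finA: "finite (A m n)" for m n using finP by (simp add: A_def)
    have level: "(\<Sum>m\<in>S. \<Sum>n\<in>S. if bad t m n then psi_mass \<psi> m * psi_mass \<psi> n else 0) \<le> 2 * K * \<Psi>^2 / 2 ^ t" for t
    proof -
      \<comment> \<open>\<open>X\<close> exceeds the normalised arc sizes of every pair that is bad
        at level \<open>t\<close>, so dividing by it makes these pairs close; \<open>q\<close> is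
        its square root.\<close>
      define q where "q = (2::real) ^ (t + 1)"
      define X where "X = (4::real) ^ (t + 1)"
      have q: "0 < q" by (simp add: q_def)
      have Xq: "X = q^2" unfolding X_def q_def power2_eq_square power_mult_distrib[symmetric] by simp
      have X: "0 < X" by (simp add: X_def)
      define f where "f n = (1 / X) * psi_mass \<psi> n" for n
      define h where "h n = (1 / X) * \<psi> n" for n
      have adm: "admissible P val S h f"
        unfolding admissible_def
      proof (intro conjI ballI impI S)
        fix n assume n: "n \<in> S"
        show "0 \<le> h n" "0 \<le> f n" using X pos[OF n] mass0[OF n] by (auto simp: h_def f_def)
        have "psi_mass \<psi> n = \<psi> n * totfac P (val n)" by (rule psi_mass_eq[OF supp[OF n]])
        then show "f n \<le> h n * totfac P (val n)" by (simp add: f_def h_def)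
        fix m assume m: "m \<in> S" "\<forall>p\<in>P. val n p = val m p"
        show "n = m" by (rule supported_eqI[OF _ supp[OF n] supp[OF m(1)]]) (use m(2) in blast)
      qed
      have "(\<Sum>m\<in>S. \<Sum>n\<in>S. if bad t m n then psi_mass \<psi> m * psi_mass \<psi> n else 0)
          \<le> (\<Sum>m\<in>S. \<Sum>n\<in>S. X^2 * exp (- (2 * real t)) * (if close_pair P val h h m n then f m * f n * wdist (tail_weight t) P (val m) (val n) else 0))"
      proof (intro sum_mono)
        fix m n assume mn: "m \<in> S" "n \<in> S"
        have w0: "0 \<le> f m * f n * wdist (tail_weight t) P (val m) (val n)"
          using mass0 mn X weights.wdist_ge[OF tail_weight_weights, of t P "val m" "val n"] by (simp add: f_def)
        show "(if bad t m n then psi_mass \<psi> m * psi_mass \<psi> n else 0)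
          \<le> X^2 * exp (- (2 * real t)) * (if close_pair P val h h m n then f m * f n * wdist (tail_weight t) P (val m) (val n) else 0)"
        proof (cases "bad t m n")
          case False
          then show ?thesis using w0 by simp
        next
          case True
          then have t: "y m n \<le> t" "1 < L m n t" by (auto simp: bad_def)
          have "(4::real) ^ (y m n + 1) \<le> X" unfolding X_def using t(1) by (intro power_increasing) auto
          then have cp: "close_pair P val h h m n"
            using y(1,2)[OF mn] X by (simp add: close_pair_def h_def field_simps)
          \<comment> \<open>On a bad pair the product of the weights is at least
            \<open>exp (2 * t)\<close>, so inserting it together with \<open>exp (- (2 * t))\<close>
            only enlarges the term.\<close>
          have "2 * real t * 1 \<le> 2 * real t * L m n t" using t(2) by (intro mult_left_mono) auto
          then have "exp (2 * real t) \<le> exp (2 * real t * L m n t)" by (simp only: mult_1_right exp_le_cancel_iff)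
          also have "\<dots> = (\<Prod>p\<in>{p\<in>A m n. t \<le> p}. exp (2 * real t / real p))"
            unfolding L_def sum_distrib_left using finA by (simp add: exp_sum)
          also have "\<dots> = wdist (tail_weight t) P (val m) (val n)"
            unfolding wdist_def using finP by (intro prod.mono_neutral_cong_left) (auto simp: A_def tail_weight_def)
          finally have w: "exp (2 * real t) \<le> wdist (tail_weight t) P (val m) (val n)" .
          have "psi_mass \<psi> m * psi_mass \<psi> n = X^2 * exp (- (2 * real t)) * (f m * f n * exp (2 * real t))"
            using X by (simp add: f_def power2_eq_square exp_minus field_simps)
          also have "\<dots> \<le> X^2 * exp (- (2 * real t)) * (f m * f n * wdist (tail_weight t) P (val m) (val n))"
            using w mass0 mn X by (intro mult_left_mono) (auto simp: f_def)
          finally show ?thesis using True cp by simp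
        qed
      qed
      also have "\<dots> = X^2 * exp (- (2 * real t)) * (\<Sum>m\<in>S. \<Sum>n\<in>S. if close_pair P val h h m n then f m * f n * wdist (tail_weight t) P (val m) (val n) else 0)"
        by (simp only: sum_distrib_left)
      also have "\<dots> \<le> X^2 * exp (- (2 * real t)) * (K * root 4 (sum f S) ^ 3 * root 4 (sum f S) ^ 3)"
        by (intro mult_left_mono K(2)[OF tail_weight_weights finP primeP adm adm]) auto
      also have "sum f S = \<Psi> / X" unfolding f_def \<Psi>_def by (simp add: sum_divide_distrib)
      also have "K * root 4 (\<Psi> / X) ^ 3 * root 4 (\<Psi> / X) ^ 3 = K * (\<Psi> / X * (sqrt \<Psi> / q))"
      proof -
        have nn: "0 \<le> \<Psi> / X" using big X by (simp add: \<Psi>_def)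
        have "root 4 (\<Psi> / X) ^ 3 * root 4 (\<Psi> / X) ^ 3 = root 4 (\<Psi> / X) ^ 4 * (root 4 (\<Psi> / X))^2"
          by (simp flip: power_add)
        also have "root 4 (\<Psi> / X) ^ 4 = \<Psi> / X" using nn by simp
        also have "(root 4 (\<Psi> / X))^2 = sqrt (\<Psi> / X)"
        proof -
          have "((root 4 (\<Psi> / X))^2)^2 = \<Psi> / X" using nn by (simp flip: power_mult)
          then show ?thesis by (metis real_sqrt_abs abs_power2 power2_abs)
        qed
        also have "sqrt (\<Psi> / X) = sqrt \<Psi> / q" using q by (simp add: Xq real_sqrt_divide)
        finally show ?thesis by (simp add: mult.assoc)
      qed
      also have "X^2 * exp (- (2 * real t)) * (K * (\<Psi> / X * (sqrt \<Psi> / q))) = K * (q * exp (- (2 * real t))) * (\<Psi> * sqrt \<Psi>)"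
        using q by (simp add: Xq power2_eq_square field_simps)
      \<comment> \<open>Here \<open>q = 2 ^ (t + 1)\<close> meets
        \<open>exp (2 * t) \<ge> 4 ^ t\<close>, and \<open>sqrt \<Psi> \<le> \<Psi>\<close> because
        \<open>\<Psi> \<ge> 1\<close>.\<close>
      also have "\<dots> \<le> K * (2 / 2 ^ t) * (\<Psi> * \<Psi>)"
      proof (intro mult_mono)
        have "(4::real) \<le> exp 2"
        proof -
          have "(2::real)^2 \<le> (exp 1)^2" using exp_ge_add_one_self[of 1] by (intro power_mono) auto
          then show ?thesis by (simp flip: exp_of_nat_mult)
        qed
        then have "(4::real) ^ t \<le> exp 2 ^ t" by (intro power_mono) auto
        then have "(4::real) ^ t \<le> exp (2 * real t)" by (simp flip: exp_of_nat_mult add: mult.commute)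
        then have "exp (- (2 * real t)) \<le> 1 / 4 ^ t" by (simp add: exp_minus inverse_eq_divide frac_le)
        then have "q * exp (- (2 * real t)) \<le> q * (1 / 4 ^ t)" using q by (intro mult_left_mono) auto
        also have "\<dots> = 2 / 2 ^ t"
        proof -
          have "(4::real) ^ t = 2 ^ t * 2 ^ t" by (simp flip: power_mult_distrib)
          then show ?thesis by (simp add: q_def)
        qed
        finally show "q * exp (- (2 * real t)) \<le> 2 / 2 ^ t" .
        show "sqrt \<Psi> \<le> \<Psi>"
          using big by (intro real_le_lsqrt) (auto simp: \<Psi>_def power2_eq_square mult_left_mono)
      qed (use K(1) q big in \<open>auto simp: \<Psi>_def\<close>)
      also have "K * (2 / 2 ^ t) * (\<Psi> * \<Psi>) = 2 * K * \<Psi>^2 / 2 ^ t" by (simp add: power2_eq_square)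
      finally show ?thesis .
    qed
    have "(\<Sum>m\<in>S. \<Sum>n\<in>S. ?ov m n) \<le> (\<Sum>m\<in>S. \<Sum>n\<in>S. (if m = n then 2 * psi_mass \<psi> m else 0)
        + 16 * exp 4 * exp 2 * (psi_mass \<psi> m * psi_mass \<psi> n + (\<Sum>t\<le>N. real (t + 1) * (if bad t m n then psi_mass \<psi> m * psi_mass \<psi> n else 0))))"
    proof (intro sum_mono)
      fix m n assume mn: "m \<in> S" "n \<in> S"
      have mm: "0 \<le> 16 * exp 4 * psi_mass \<psi> m * psi_mass \<psi> n" using mass0 mn by simp
      have "(\<Prod>p\<in>{p\<in>A m n. y m n < p}. inverse (1 - 1 / real p)) \<le> exp 2 * (1 + (\<Sum>t\<le>N. if bad t m n then real (t + 1) else 0))"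
        unfolding bad_def L_def using primeP N by (intro prod_inverse_le_levels finA) (auto simp: A_def)
      from mult_left_mono[OF this mm]
      have "?ov m n \<le> (if m = n then 2 * psi_mass \<psi> m else 0) + 16 * exp 4 * psi_mass \<psi> m * psi_mass \<psi> n * (exp 2 * (1 + (\<Sum>t\<le>N. if bad t m n then real (t + 1) else 0)))"
        using y(3)[OF mn] by linarith
      also have "16 * exp 4 * psi_mass \<psi> m * psi_mass \<psi> n * (exp 2 * (1 + (\<Sum>t\<le>N. if bad t m n then real (t + 1) else 0)))
        = 16 * exp 4 * exp 2 * (psi_mass \<psi> m * psi_mass \<psi> n + psi_mass \<psi> m * psi_mass \<psi> n * (\<Sum>t\<le>N. if bad t m n then real (t + 1) else 0))"
        by (simp add: algebra_simps)
      also have "psi_mass \<psi> m * psi_mass \<psi> n * (\<Sum>t\<le>N. if bad t m n then real (t + 1) else 0)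
        = (\<Sum>t\<le>N. real (t + 1) * (if bad t m n then psi_mass \<psi> m * psi_mass \<psi> n else 0))"
        unfolding sum_distrib_left by (intro sum.cong refl) auto
      finally show "?ov m n \<le> (if m = n then 2 * psi_mass \<psi> m else 0)
        + 16 * exp 4 * exp 2 * (psi_mass \<psi> m * psi_mass \<psi> n + (\<Sum>t\<le>N. real (t + 1) * (if bad t m n then psi_mass \<psi> m * psi_mass \<psi> n else 0)))" .
    qed
    also have "\<dots> = 2 * \<Psi> + 16 * exp 4 * exp 2 * (\<Psi>^2 + (\<Sum>m\<in>S. \<Sum>n\<in>S. \<Sum>t\<le>N. real (t + 1) * (if bad t m n then psi_mass \<psi> m * psi_mass \<psi> n else 0)))"
    proof -
      have d: "(\<Sum>m\<in>S. \<Sum>n\<in>S. if m = n then 2 * psi_mass \<psi> m else 0) = 2 * \<Psi>"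
        using S by (simp add: sum.delta \<Psi>_def sum_distrib_left)
      have s: "(\<Sum>m\<in>S. psi_mass \<psi> m * sum (psi_mass \<psi>) S) = \<Psi>^2"
        unfolding sum_distrib_right[symmetric] by (simp add: \<Psi>_def power2_eq_square)
      show ?thesis by (simp only: sum.distrib d sum_distrib_left[symmetric] s)
    qed
    also have "(\<Sum>m\<in>S. \<Sum>n\<in>S. \<Sum>t\<le>N. real (t + 1) * (if bad t m n then psi_mass \<psi> m * psi_mass \<psi> n else 0))
      = (\<Sum>t\<le>N. real (t + 1) * (\<Sum>m\<in>S. \<Sum>n\<in>S. if bad t m n then psi_mass \<psi> m * psi_mass \<psi> n else 0))"
    proof -
      have "(\<Sum>m\<in>S. \<Sum>n\<in>S. \<Sum>t\<le>N. real (t + 1) * (if bad t m n then psi_mass \<psi> m * psi_mass \<psi> n else 0))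
        = (\<Sum>m\<in>S. \<Sum>t\<le>N. \<Sum>n\<in>S. real (t + 1) * (if bad t m n then psi_mass \<psi> m * psi_mass \<psi> n else 0))"
        by (intro sum.cong refl sum.swap)
      also have "\<dots> = (\<Sum>t\<le>N. \<Sum>m\<in>S. \<Sum>n\<in>S. real (t + 1) * (if bad t m n then psi_mass \<psi> m * psi_mass \<psi> n else 0))"
        by (rule sum.swap)
      finally show ?thesis by (simp only: sum_distrib_left)
    qed
    also have "(\<Sum>t\<le>N. real (t + 1) * (\<Sum>m\<in>S. \<Sum>n\<in>S. if bad t m n then psi_mass \<psi> m * psi_mass \<psi> n else 0)) \<le> (\<Sum>t\<le>N. real (t + 1) * (2 * K * \<Psi>^2 / 2 ^ t))"
      by (intro sum_mono mult_left_mono level) auto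
    also have "\<dots> = 2 * K * \<Psi>^2 * (\<Sum>t\<le>N. real (t + 1) / 2 ^ t)"
      unfolding sum_distrib_left by (intro sum.cong refl) simp
    also have "\<dots> \<le> 2 * K * \<Psi>^2 * 4"
      using K(1) by (intro mult_left_mono sum_linear_geometric_le) auto
    finally have "(\<Sum>m\<in>S. \<Sum>n\<in>S. ?ov m n) \<le> 2 * \<Psi> + 16 * exp 4 * exp 2 * (\<Psi>^2 + 2 * K * \<Psi>^2 * 4)" by simp
    also have "2 * \<Psi> \<le> 2 * \<Psi>^2" using big by (simp add: \<Psi>_def power2_eq_square)
    finally show "(\<Sum>m\<in>S. \<Sum>n\<in>S. ?ov m n) \<le> C * (sum (psi_mass \<psi>) S)^2"
      unfolding \<Psi>_def[symmetric] by (simp add: C_def algebra_simps)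
  qed
qed

text \<open>Integrate the pointwise bound \<open>k \<le> k\<^sup>2 / (2 s) + s / 2\<close> for the multiplicity \<open>k\<close>
  and optimise over \<open>s\<close>.\<close>

lemma chung_erdos:
  assumes fin: "finite I" and A: "\<And>i. i \<in> I \<Longrightarrow> A i \<in> fmeasurable M"
  shows "(\<Sum>i\<in>I. measure M (A i))^2 \<le> measure M (\<Union>i\<in>I. A i) * (\<Sum>i\<in>I. \<Sum>j\<in>I. measure M (A i \<inter> A j))"
proof -
  define Q where "Q = (\<Sum>i\<in>I. measure M (A i))"
  define R where "R = (\<Sum>i\<in>I. \<Sum>j\<in>I. measure M (A i \<inter> A j))"
  define U where "U = (\<Union>i\<in>I. A i)"
  have U: "U \<in> fmeasurable M" unfolding U_def using fin A by (intro fmeasurable.finite_UN) auto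
  have ind: "has_bochner_integral M (indicator B) (measure M B)" if "B \<in> fmeasurable M" for B
    using that by (intro has_bochner_integral_real_indicator) (auto simp: fmeasurable_def)
  have key: "Q \<le> (1 / (2 * s)) * R + (s / 2) * measure M U" if s: "0 < s" for s
  proof -
    have h1: "has_bochner_integral M (\<lambda>x. \<Sum>i\<in>I. indicator (A i) x) Q"
      unfolding Q_def using A by (intro has_bochner_integral_sum ind)
    have h2: "has_bochner_integral M (\<lambda>x. (1 / (2 * s)) * (\<Sum>i\<in>I. \<Sum>j\<in>I. indicator (A i \<inter> A j) x) + (s / 2) * indicator U x)
      ((1 / (2 * s)) * R + (s / 2) * measure M U)"
      unfolding R_def using A U
      by (intro has_bochner_integral_add has_bochner_integral_mult_right has_bochner_integral_sum ind) auto
    have pw: "(\<Sum>i\<in>I. indicator (A i) x) \<le> (1 / (2 * s)) * (\<Sum>i\<in>I. \<Sum>j\<in>I. indicator (A i \<inter> A j) x) + (s / 2) * indicator U x" for x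
    proof (cases "x \<in> U")
      case False
      then show ?thesis by (auto simp: U_def intro!: sum_nonneg)
    next
      case True
      define k :: real where "k = (\<Sum>i\<in>I. indicator (A i) x)"
      have "(\<Sum>i\<in>I. \<Sum>j\<in>I. indicator (A i \<inter> A j) x :: real) = k^2"
        by (simp add: k_def power2_eq_square sum_product indicator_inter_arith)
      moreover have "k \<le> (1 / (2 * s)) * k^2 + s / 2"
      proof -
        have "2 * k * s \<le> k^2 + s^2" by (rule sum_squares_bound)
        then show ?thesis using s by (simp add: power2_eq_square field_simps)
      qed
      ultimately show ?thesis using True by (simp add: k_def)
    qed
    have "integral\<^sup>L M (\<lambda>x. \<Sum>i\<in>I. indicator (A i) x) \<le>
      integral\<^sup>L M (\<lambda>x. (1 / (2 * s)) * (\<Sum>i\<in>I. \<Sum>j\<in>I. indicator (A i \<inter> A j) x) + (s / 2) * indicator U x)"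
      by (rule integral_mono[OF integrable.intros[OF h1] integrable.intros[OF h2] pw])
    then show ?thesis
      unfolding has_bochner_integral_integral_eq[OF h1] has_bochner_integral_integral_eq[OF h2] .
  qed
  have R0: "0 \<le> R" unfolding R_def by (intro sum_nonneg) auto
  have Q0: "0 \<le> Q" unfolding Q_def by (intro sum_nonneg) auto
  show ?thesis
  proof (cases "0 < Q \<and> 0 < R")
    case True
    \<comment> \<open>The choice \<open>s = R / Q\<close> turns the first summand into half of the
      left side.\<close>
    have "Q \<le> Q / 2 + R / (2 * Q) * measure M U"
      using key[of "R / Q"] True by (simp add: field_simps)
    then have "Q^2 \<le> R * measure M U" using True by (simp add: field_simps power2_eq_square)
    then show ?thesis by (simp add: Q_def R_def U_def mult.commute)
  next
    case False
    \<comment> \<open>For \<open>R = 0\<close> and positive \<open>Q\<close> the parameter may be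
      arbitrarily small; \<open>s = Q / w\<close> would give \<open>Q \<le> Q / 2\<close>.\<close>
    have "Q = 0"
    proof (rule ccontr)
      assume "Q \<noteq> 0"
      then have "0 < Q" "R = 0" using Q0 R0 False by auto
      define w where "w = measure M U + 1"
      have w: "0 < w" by (simp add: w_def add_nonneg_pos)
      have "Q \<le> (Q / w / 2) * measure M U" using key[of "Q / w"] \<open>R = 0\<close> \<open>0 < Q\<close> w by simp
      also have "\<dots> \<le> (Q / w / 2) * w" using \<open>0 < Q\<close> w by (intro mult_left_mono) (auto simp: w_def)
      also have "\<dots> = Q / 2" using w by simp
      finally show False using \<open>0 < Q\<close> by simp
    qed
    then show ?thesis using R0 by (simp add: Q_def R_def)
  qed
qed

definition unit_arc :: "(nat \<Rightarrow> real) \<Rightarrow> nat \<Rightarrow> nat \<Rightarrow> real set" where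
  "unit_arc \<psi> n a = approx_arc \<psi> n a \<inter> {0..1}"

lemma unit_arc_measurable: "unit_arc \<psi> n a \<in> fmeasurable lborel"
  unfolding unit_arc_def by (intro fmeasurable_Int_fmeasurable fmeasurable_arc) auto

text \<open>The centre lies in the unit interval and the radius is at most 1/2, so at least one half
  of the arc, left or right of the centre, survives the cut. In total the cut arcs of
  \<open>n\<close> keep length \<open>psi_mass \<psi> n\<close>.\<close>

lemma measure_unit_arc_ge:
  assumes a: "a \<in> numerators n" and \<psi>: "0 \<le> \<psi> n" "\<psi> n \<le> real n / 2"
  shows "\<psi> n / real n \<le> measure lborel (unit_arc \<psi> n a)"
proof -
  have n: "0 < real n" "real a \<le> real n" using a by (auto simp: numerators_def)
  define x d where "x = real a / real n" and "d = \<psi> n / real n"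
  have x: "0 \<le> x" "x \<le> 1" using n by (auto simp: x_def)
  have d: "0 \<le> d" "d \<le> 1 / 2" using n \<psi> by (auto simp: d_def field_simps)
  have arc: "unit_arc \<psi> n a = {x - d <..< x + d} \<inter> {0..1}"
    by (simp add: unit_arc_def approx_arc_def x_def d_def diff_divide_distrib add_divide_distrib)
  define l where "l = (if x \<le> 1 / 2 then x else x - d)"
  have "{l<..<l + d} \<subseteq> unit_arc \<psi> n a"
    unfolding arc using x d by (auto simp: l_def split: if_splits)
  then have "measure lborel {l<..<l + d} \<le> measure lborel (unit_arc \<psi> n a)"
    by (intro measure_mono_fmeasurable unit_arc_measurable) auto
  then show ?thesis using d by (simp add: d_def)
qed

text \<open>The restriction to the unit interval is dropped so that the set is periodic and affine
  maps can act on it.\<close>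

definition circle_limsup :: "(nat \<Rightarrow> real) \<Rightarrow> real set" where
  "circle_limsup \<psi> = {x. infinite {n::nat. n \<ge> 1 \<and> in_mod1 x (approx_set \<psi> n)}}"

lemma approx_set_eq: "approx_set \<psi> n = (\<Union>a\<in>numerators n. approx_arc \<psi> n a)"
  by (simp add: approx_set_def numerators_def approx_arc_def)

lemma circle_limsup_borel: "circle_limsup \<psi> \<in> sets borel"
proof -
  define E where "E n = {x. 1 \<le> n \<and> in_mod1 x (approx_set \<psi> n)}" for n
  have "E n \<in> sets borel" for n
  proof -
    have "open (\<Union>k::int. (\<lambda>x. x + of_int k) -` approx_set \<psi> n)"
      by (intro open_UN ballI open_vimage continuous_intros) (auto simp: approx_set_def)
    moreover have "{x. in_mod1 x (approx_set \<psi> n)} = (\<Union>k::int. (\<lambda>x. x + of_int k) -` approx_set \<psi> n)"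
      by (auto simp: in_mod1_def)
    ultimately show ?thesis by (cases "1 \<le> n") (auto simp: E_def)
  qed
  moreover have "circle_limsup \<psi> = (\<Inter>N. \<Union>n\<in>{N..}. E n)"
    by (auto simp: circle_limsup_def E_def infinite_nat_iff_unbounded_le)
  ultimately show ?thesis by (simp only:) auto
qed

text \<open>The first moment is bounded below with the cut arcs, the second above with the uncut
  ones. The square of the mass cancels, so the constant depends neither on \<open>\<psi>\<close> nor
  on \<open>S\<close>.\<close>

lemma measure_union_arcs_ge:
  obtains c where "0 < c"
    "\<And>\<psi> S. finite S \<Longrightarrow> (\<And>n. n \<in> S \<Longrightarrow> 0 < n \<and> 0 \<le> \<psi> n \<and> \<psi> n \<le> real n / 2) \<Longrightarrow> 1 \<le> sum (psi_mass \<psi>) S \<Longrightarrow>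
      c \<le> measure lborel (\<Union>n\<in>S. \<Union>a\<in>numerators n. unit_arc \<psi> n a)"
proof -
  obtain C where C: "0 < C"
    "\<And>\<psi> S. finite S \<Longrightarrow> (\<And>n. n \<in> S \<Longrightarrow> 0 < n \<and> 0 \<le> \<psi> n) \<Longrightarrow> 1 \<le> sum (psi_mass \<psi>) S \<Longrightarrow>
      (\<Sum>m\<in>S. \<Sum>n\<in>S. \<Sum>a\<in>numerators m. \<Sum>b\<in>numerators n. measure lborel (approx_arc \<psi> m a \<inter> approx_arc \<psi> n b))
      \<le> C * (sum (psi_mass \<psi>) S)^2"
    using total_overlap_bound by blast
  show thesis
  proof (rule that[of "1 / C"])
    show "0 < 1 / C" using C(1) by simp
    fix \<psi> S
    assume S: "finite S" and pos: "\<And>n. n \<in> S \<Longrightarrow> 0 < n \<and> 0 \<le> \<psi> n \<and> \<psi> n \<le> real n / 2" and big: "1 \<le> sum (psi_mass \<psi>) S"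
    define I where "I = Sigma S numerators"
    define A where "A i = unit_arc \<psi> (fst i) (snd i)" for i
    define U where "U = (\<Union>n\<in>S. \<Union>a\<in>numerators n. unit_arc \<psi> n a)"
    have finI: "finite I" unfolding I_def using S finite_numerators by auto
    have sumI: "(\<Sum>i\<in>I. F (fst i) (snd i)) = (\<Sum>n\<in>S. \<Sum>a\<in>numerators n. F n a)" for F :: "nat \<Rightarrow> nat \<Rightarrow> real"
      unfolding I_def using S finite_numerators by (simp add: sum.Sigma split_def)
    have UI: "(\<Union>i\<in>I. A i) = U" by (auto simp: I_def A_def U_def) blast
    define \<Psi> where "\<Psi> = sum (psi_mass \<psi>) S"
    have "\<Psi> \<le> (\<Sum>i\<in>I. measure lborel (A i))"
    proof -
      have "\<Psi> \<le> (\<Sum>n\<in>S. \<Sum>a\<in>numerators n. measure lborel (unit_arc \<psi> n a))"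
        unfolding \<Psi>_def
      proof (rule sum_mono)
        fix n assume n: "n \<in> S"
        have "psi_mass \<psi> n = (\<Sum>a\<in>numerators n. \<psi> n / real n)"
          using pos[OF n] by (simp add: psi_mass_def card_numerators)
        also have "\<dots> \<le> (\<Sum>a\<in>numerators n. measure lborel (unit_arc \<psi> n a))"
          using pos[OF n] by (intro sum_mono measure_unit_arc_ge) auto
        finally show "psi_mass \<psi> n \<le> (\<Sum>a\<in>numerators n. measure lborel (unit_arc \<psi> n a))" .
      qed
      then show ?thesis unfolding A_def sumI[of "\<lambda>n a. measure lborel (unit_arc \<psi> n a)"] .
    qed
    then have "\<Psi>^2 \<le> (\<Sum>i\<in>I. measure lborel (A i))^2"
      using big by (intro power_mono) (auto simp: \<Psi>_def)
    also have "\<dots> \<le> measure lborel U * (\<Sum>i\<in>I. \<Sum>j\<in>I. measure lborel (A i \<inter> A j))"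
      unfolding UI[symmetric] by (rule chung_erdos[OF finI]) (simp add: A_def unit_arc_measurable)
    also have "\<dots> \<le> measure lborel U * (C * \<Psi>^2)"
    proof (intro mult_left_mono)
      have "(\<Sum>i\<in>I. \<Sum>j\<in>I. measure lborel (A i \<inter> A j)) = (\<Sum>m\<in>S. \<Sum>a\<in>numerators m. \<Sum>n\<in>S. \<Sum>b\<in>numerators n. measure lborel (unit_arc \<psi> m a \<inter> unit_arc \<psi> n b))"
        unfolding A_def sumI[of "\<lambda>n b. measure lborel (unit_arc \<psi> m a \<inter> unit_arc \<psi> n b)" for m a]
        by (rule sumI)
      also have "\<dots> = (\<Sum>m\<in>S. \<Sum>n\<in>S. \<Sum>a\<in>numerators m. \<Sum>b\<in>numerators n. measure lborel (unit_arc \<psi> m a \<inter> unit_arc \<psi> n b))"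
        by (intro sum.cong refl sum.swap)
      also have "\<dots> \<le> (\<Sum>m\<in>S. \<Sum>n\<in>S. \<Sum>a\<in>numerators m. \<Sum>b\<in>numerators n. measure lborel (approx_arc \<psi> m a \<inter> approx_arc \<psi> n b))"
      proof (intro sum_mono measure_mono_fmeasurable)
        fix m n a b
        show "unit_arc \<psi> m a \<inter> unit_arc \<psi> n b \<subseteq> approx_arc \<psi> m a \<inter> approx_arc \<psi> n b" by (auto simp: unit_arc_def)
        show "unit_arc \<psi> m a \<inter> unit_arc \<psi> n b \<in> sets lborel" using unit_arc_measurable fmeasurableD by blast
        show "approx_arc \<psi> m a \<inter> approx_arc \<psi> n b \<in> fmeasurable lborel" using fmeasurable_arc by (intro fmeasurable.Int)
      qed
      also have "\<dots> \<le> C * \<Psi>^2" unfolding \<Psi>_def using pos by (intro C(2) S big) auto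
      finally show "(\<Sum>i\<in>I. \<Sum>j\<in>I. measure lborel (A i \<inter> A j)) \<le> C * \<Psi>^2" .
    qed simp
    finally have "\<Psi>^2 * 1 \<le> \<Psi>^2 * (C * measure lborel U)" by (simp add: mult_ac)
    moreover have "0 < \<Psi>^2" using big by (simp add: \<Psi>_def)
    ultimately have "1 \<le> C * measure lborel U" by (simp only: mult_le_cancel_left_pos)
    then show "1 / C \<le> measure lborel (\<Union>n\<in>S. \<Union>a\<in>numerators n. unit_arc \<psi> n a)"
      using C(1) by (simp add: U_def field_simps)
  qed
qed

text \<open>Wherever the truncation is effective, the truncated mass is half of the totient and so
  at least 1/2. If the truncated series converged, this could happen only finitely often.\<close>

lemma psi_mass_truncate_not_summable:
  assumes nn: "\<And>n. 1 \<le> n \<Longrightarrow> 0 \<le> \<psi> n" and ns: "\<not> summable (psi_mass \<psi>)"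
  shows "\<not> summable (psi_mass (\<lambda>n. min (\<psi> n) (real n / 2)))"
proof
  let ?\<psi> = "\<lambda>n. min (\<psi> n) (real n / 2)"
  assume s: "summable (psi_mass ?\<psi>)"
  have "eventually (\<lambda>n. psi_mass ?\<psi> n < 1 / 2) sequentially"
    by (rule order_tendstoD(2)[OF summable_LIMSEQ_zero[OF s]]) simp
  then have "eventually (\<lambda>n. psi_mass ?\<psi> n = psi_mass \<psi> n) sequentially"
    using eventually_ge_at_top[of 1]
  proof eventually_elim
    case (elim n)
    have "\<not> real n / 2 < \<psi> n"
    proof
      assume "real n / 2 < \<psi> n"
      then have "psi_mass ?\<psi> n = real (totient n) / 2" using elim by (simp add: psi_mass_def)
      moreover have "0 < totient n" using elim by simp
      then have "1 \<le> real (totient n)" by linarith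
      ultimately show False using elim(1) by linarith
    qed
    then show ?case by (simp add: psi_mass_def min_def)
  qed
  then have "summable (psi_mass \<psi>)" using s summable_cong by blast
  then show False using ns by simp
qed

lemma not_summable_block:
  fixes a :: "nat \<Rightarrow> real"
  assumes nn: "\<And>n. 0 \<le> a n" and ns: "\<not> summable a"
  shows "\<exists>M. 1 \<le> sum a {N..<M}"
proof (rule ccontr)
  assume no: "\<not> (\<exists>M. 1 \<le> sum a {N..<M})"
  have "summable a"
  proof (rule summableI_nonneg_bounded[OF nn])
    fix M
    have "{..<M} \<subseteq> {..<N} \<union> {N..<M}" by auto
    then have "sum a {..<M} \<le> sum a ({..<N} \<union> {N..<M})" using nn by (intro sum_mono2) auto
    also have "\<dots> = sum a {..<N} + sum a {N..<M}" by (intro sum.union_disjoint) auto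
    finally have "sum a {..<M} \<le> sum a {..<N} + sum a {N..<M}" .
    moreover have "\<not> 1 \<le> sum a {N..<M}" using no by blast
    ultimately show "sum a {..<M} \<le> sum a {..<N} + 1" by linarith
  qed
  then show False using ns by simp
qed

text \<open>Every tail contains a finite block of mass at least 1 and so has measure at least
  \<open>c\<close>; continuity from above passes to the limsup. It matters that \<open>c\<close> is
  fixed before \<open>\<psi>\<close>, since the zero-one law applies the bound to infinite nested
  families.\<close>

theorem circle_limsup_positive:
  obtains c where "0 < c"
    "\<And>\<psi>. (\<And>n. 1 \<le> n \<Longrightarrow> 0 \<le> \<psi> n) \<Longrightarrow> \<not> summable (psi_mass \<psi>) \<Longrightarrow> ennreal c \<le> emeasure lborel (circle_limsup \<psi> \<inter> {0..1})"
proof -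
  obtain c where c: "0 < c"
    "\<And>\<psi> S. finite S \<Longrightarrow> (\<And>n. n \<in> S \<Longrightarrow> 0 < n \<and> 0 \<le> \<psi> n \<and> \<psi> n \<le> real n / 2) \<Longrightarrow> 1 \<le> sum (psi_mass \<psi>) S \<Longrightarrow>
      c \<le> measure lborel (\<Union>n\<in>S. \<Union>a\<in>numerators n. unit_arc \<psi> n a)"
    using measure_union_arcs_ge by blast
  show thesis
  proof (rule that[OF c(1)])
    fix \<psi> :: "nat \<Rightarrow> real" assume nn: "\<And>n. 1 \<le> n \<Longrightarrow> 0 \<le> \<psi> n" and ns: "\<not> summable (psi_mass \<psi>)"
    define \<theta> where "\<theta> n = min (\<psi> n) (real n / 2)" for n
    have ns': "\<not> summable (psi_mass \<theta>)"
      using psi_mass_truncate_not_summable[OF nn ns] by (simp add: \<theta>_def[abs_def])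
    have \<theta>: "0 \<le> \<theta> n" "\<theta> n \<le> real n / 2" "\<theta> n \<le> \<psi> n" if "1 \<le> n" for n using nn[OF that] by (auto simp: \<theta>_def)
    have mass0: "0 \<le> psi_mass \<theta> n" for n using \<theta>(1)[of n] by (cases "n = 0") (auto simp: psi_mass_def)
    define E where "E n = (\<Union>a\<in>numerators n. unit_arc \<theta> n a)" for n
    have E: "E n \<in> sets lborel" for n unfolding E_def
      using finite_numerators fmeasurableD[OF unit_arc_measurable] by (intro sets.finite_UN) auto
    define U where "U N = (\<Union>n\<in>{Suc N..}. E n)" for N
    have U: "U N \<in> sets lborel" for N unfolding U_def using E by (intro sets.countable_UN'') auto
    have Usub: "U N \<subseteq> {0..1}" for N by (auto simp: U_def E_def unit_arc_def)
    have ge: "ennreal c \<le> emeasure lborel (U N)" for N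
    proof -
      obtain M where M: "1 \<le> sum (psi_mass \<theta>) {Suc N..<M}" using not_summable_block[OF mass0 ns'] by blast
      have sub: "(\<Union>n\<in>{Suc N..<M}. E n) \<subseteq> U N" by (auto simp: U_def)
      have fm: "(\<Union>n\<in>{Suc N..<M}. E n) \<in> fmeasurable lborel"
        unfolding E_def using finite_numerators unit_arc_measurable by (intro fmeasurable.finite_UN) auto
      have "c \<le> measure lborel (\<Union>n\<in>{Suc N..<M}. E n)"
        unfolding E_def by (rule c(2)[OF _ _ M]) (use \<theta> in auto)
      then have "ennreal c \<le> ennreal (measure lborel (\<Union>n\<in>{Suc N..<M}. E n))" by (rule ennreal_leI)
      also have "\<dots> = emeasure lborel (\<Union>n\<in>{Suc N..<M}. E n)" using fm by (simp add: emeasure_eq_measure2)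
      also have "\<dots> \<le> emeasure lborel (U N)" by (intro emeasure_mono sub U)
      finally show ?thesis .
    qed
    have fin: "emeasure lborel (U N) \<noteq> \<infinity>" for N
    proof -
      have "emeasure lborel (U N) \<le> emeasure lborel {0..1::real}" by (intro emeasure_mono Usub) auto
      then show ?thesis by (auto simp: top_unique)
    qed
    have "ennreal c \<le> (INF N. emeasure lborel (U N))" by (intro INF_greatest ge)
    also have "\<dots> = emeasure lborel (\<Inter>N. U N)"
      by (rule INF_emeasure_decseq) (use U fin in \<open>auto simp: decseq_def U_def\<close>, force)
    also have "\<dots> \<le> emeasure lborel (circle_limsup \<psi> \<inter> {0..1})"
    proof (intro emeasure_mono)
      show "(\<Inter>N. U N) \<subseteq> circle_limsup \<psi> \<inter> {0..1}"
      proof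
        fix x assume x: "x \<in> (\<Inter>N. U N)"
        have "\<exists>n\<ge>N. n \<in> {n. 1 \<le> n \<and> in_mod1 x (approx_set \<psi> n)}" for N
        proof -
          from x have "x \<in> U N" by blast
          then obtain n a where n: "Suc N \<le> n" "a \<in> numerators n" "x \<in> unit_arc \<theta> n a" by (auto simp: U_def E_def)
          have n1: "1 \<le> n" using n(1) by simp
          have "approx_arc \<theta> n a \<subseteq> approx_arc \<psi> n a"
            unfolding approx_arc_def using \<theta>(3)[OF n1] n1 by (auto simp: field_simps)
          then have "x \<in> approx_set \<psi> n" using n by (auto simp: approx_set_eq unit_arc_def)
          then have "in_mod1 x (approx_set \<psi> n)" unfolding in_mod1_def by (intro exI[of _ 0]) simp
          then show ?thesis using n(1) n1 by (intro exI[of _ n]) auto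
        qed
        then have "x \<in> circle_limsup \<psi>" unfolding circle_limsup_def infinite_nat_iff_unbounded_le by blast
        moreover have "x \<in> {0..1}" using x Usub by blast
        ultimately show "x \<in> circle_limsup \<psi> \<inter> {0..1}" by blast
      qed
      show "circle_limsup \<psi> \<inter> {0..1} \<in> sets lborel" using circle_limsup_borel by simp
    qed
    finally show "ennreal c \<le> emeasure lborel (circle_limsup \<psi> \<inter> {0..1})" .
  qed
qed

section \<open>Zero-one law\<close>

lemma coprime_add_multiple: "coprime (b + int n * k) (int n) \<longleftrightarrow> coprime b (int n)"
proof -
  have eq: "b + int n * k = k * int n + b" by simp
  show ?thesis unfolding eq coprime_iff_gcd_eq_1 gcd.commute[of _ "int n"] gcd_add_mult ..
qed

lemma in_mod1_approx_set_iff: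
  assumes n: "1 \<le> n"
  shows "in_mod1 x (approx_set \<psi> n) \<longleftrightarrow> (\<exists>b::int. coprime b (int n) \<and> \<bar>real n * x - real_of_int b\<bar> < \<psi> n)"
proof
  have iff: "y \<in> approx_arc \<psi> n a \<longleftrightarrow> \<bar>real n * y - real a\<bar> < \<psi> n" for y a
    using n unfolding approx_arc_def by (auto simp: field_simps abs_less_iff)
  {
    assume "in_mod1 x (approx_set \<psi> n)"
    then obtain k a where a: "a \<in> numerators n" "x + of_int k \<in> approx_arc \<psi> n a"
      by (auto simp: in_mod1_def approx_set_eq)
    have "gcd a n = 1" using a(1) by (simp only: numerators_def mem_Collect_eq)
    then have "coprime a n" by (rule gcd_eq_1_imp_coprime)
    then have "coprime (int a) (int n)" by simp
    then have "coprime (int a - int n * k) (int n)"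
      using coprime_add_multiple[of "int a" n "- k"] by simp
    moreover have "\<bar>real n * x - real_of_int (int a - int n * k)\<bar> < \<psi> n"
      using a(2) by (simp add: iff algebra_simps)
    ultimately show "\<exists>b::int. coprime b (int n) \<and> \<bar>real n * x - real_of_int b\<bar> < \<psi> n" by blast
  next
    assume "\<exists>b::int. coprime b (int n) \<and> \<bar>real n * x - real_of_int b\<bar> < \<psi> n"
    then obtain b :: int where b: "coprime b (int n)" "\<bar>real n * x - real_of_int b\<bar> < \<psi> n" by blast
    define k where "k = - ((b - 1) div int n)"
    \<comment> \<open>Representatives run from 1 to \<open>n\<close> and not from 0; for
      \<open>n = 1\<close> the only numerator is 1.\<close>
    define a where "a = nat ((b - 1) mod int n + 1)"
    have ai: "int a = (b - 1) mod int n + 1" using n by (simp add: a_def)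
    have eq: "int a = b + int n * k"
      using mult_div_mod_eq[of "int n" "b - 1"] unfolding ai k_def mult_minus_right by linarith
    have rng: "1 \<le> a" "a \<le> n"
    proof -
      have "0 \<le> (b - 1) mod int n" "(b - 1) mod int n < int n" using n by auto
      then show "1 \<le> a" "a \<le> n" using ai by linarith+
    qed
    have "coprime (int a) (int n)" unfolding eq coprime_add_multiple by (rule b(1))
    then have "coprime a n" by simp
    then have "gcd a n = 1" by (rule coprime_imp_gcd_eq_1)
    then have "a \<in> numerators n" using rng by (simp add: numerators_def)
    moreover have "x + of_int k \<in> approx_arc \<psi> n a"
    proof -
      have "real a = real_of_int (int a)" by simp
      also have "\<dots> = real_of_int b + real n * real_of_int k" unfolding eq by simp
      finally show ?thesis unfolding iff using b(2) by (simp add: algebra_simps)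
    qed
    ultimately show "in_mod1 x (approx_set \<psi> n)" by (auto simp: in_mod1_def approx_set_eq)
  }
qed

definition hits :: "(nat \<Rightarrow> real) \<Rightarrow> real \<Rightarrow> nat \<Rightarrow> bool" where
  "hits \<psi> x n \<longleftrightarrow> 1 \<le> n \<and> (\<exists>b::int. coprime b (int n) \<and> \<bar>real n * x - real_of_int b\<bar> < \<psi> n)"

lemma circle_limsup_hits: "circle_limsup \<psi> = {x. infinite {n. hits \<psi> x n}}"
proof -
  have "{n. 1 \<le> n \<and> in_mod1 x (approx_set \<psi> n)} = {n. hits \<psi> x n}" for x
    using in_mod1_approx_set_iff by (auto simp: hits_def)
  then show ?thesis by (simp add: circle_limsup_def)
qed

lemma circle_limsup_transfer:
  assumes "x \<in> circle_limsup \<psi>" and "\<And>n. hits \<psi> x n \<Longrightarrow> hits \<theta> y n"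
  shows "y \<in> circle_limsup \<theta>"
proof -
  have "{n. hits \<psi> x n} \<subseteq> {n. hits \<theta> y n}" using assms(2) by blast
  moreover have "infinite {n. hits \<psi> x n}" using assms(1) by (simp add: circle_limsup_hits)
  ultimately have "infinite {n. hits \<theta> y n}" by (rule infinite_super)
  then show ?thesis by (simp add: circle_limsup_hits)
qed

lemma circle_limsup_mono:
  assumes "\<And>n. 1 \<le> n \<Longrightarrow> \<psi> n \<le> \<theta> n"
  shows "circle_limsup \<psi> \<subseteq> circle_limsup \<theta>"
proof
  fix x assume "x \<in> circle_limsup \<psi>"
  then show "x \<in> circle_limsup \<theta>"
  proof (rule circle_limsup_transfer)
    fix n assume "hits \<psi> x n"
    then show "hits \<theta> x n" unfolding hits_def using assms[of n] less_le_trans by blast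
  qed
qed

lemma hits_periodic: "hits \<psi> x n \<Longrightarrow> hits \<psi> (x + of_int k) n"
proof -
  assume "hits \<psi> x n"
  then obtain b where b: "1 \<le> n" "coprime b (int n)" "\<bar>real n * x - real_of_int b\<bar> < \<psi> n" by (auto simp: hits_def)
  have "coprime (b + int n * k) (int n)" using b(2) by (simp add: coprime_add_multiple)
  moreover have "\<bar>real n * (x + of_int k) - real_of_int (b + int n * k)\<bar> < \<psi> n" using b(3) by (simp add: algebra_simps)
  ultimately show ?thesis using b(1) unfolding hits_def by blast
qed

lemma circle_limsup_periodic: "x + of_int k \<in> circle_limsup \<psi> \<longleftrightarrow> x \<in> circle_limsup \<psi>"
proof
  assume "x \<in> circle_limsup \<psi>"
  then show "x + of_int k \<in> circle_limsup \<psi>" by (rule circle_limsup_transfer[OF _ hits_periodic])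
next
  assume "x + of_int k \<in> circle_limsup \<psi>"
  then have "(x + of_int k) + of_int (- k) \<in> circle_limsup \<psi>" by (rule circle_limsup_transfer[OF _ hits_periodic])
  then show "x \<in> circle_limsup \<psi>" by simp
qed

text \<open>The class of the \<open>n\<close> that are exactly divisible by \<open>2\<^sup>j\<close> is carried into itself by an expanding
  affine map of the circle, at the price of doubling \<open>\<psi>\<close>.\<close>

definition exact_class :: "nat \<Rightarrow> (nat \<Rightarrow> real) \<Rightarrow> nat \<Rightarrow> real" where
  "exact_class j \<psi> n = (if 2 ^ j dvd n \<and> \<not> 2 ^ Suc j dvd n then \<psi> n else 0)"

definition multiple_class :: "nat \<Rightarrow> (nat \<Rightarrow> real) \<Rightarrow> nat \<Rightarrow> real" where
  "multiple_class j \<psi> n = (if 2 ^ j dvd n then \<psi> n else 0)"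

text \<open>With \<open>n = 2 ^ j * k\<close> and \<open>k\<close> odd, the map sends
  \<open>b / n\<close> to \<open>(2 * b + k) / n\<close>, whose numerator is odd and coprime to
  \<open>k\<close>. For \<open>j = 0\<close> there is no factor 2 to repair and pure doubling works.
  The distance to the centre doubles, hence the halved function in the hypothesis.\<close>

lemma doubling_step:
  assumes "x \<in> circle_limsup (\<lambda>n. exact_class j \<psi> n / 2)"
  shows "2 * x + (if j = 0 then 0 else 1 / 2 ^ j) \<in> circle_limsup (exact_class j \<psi>)"
proof (rule circle_limsup_transfer[OF assms])
  fix n assume h: "hits (\<lambda>n. exact_class j \<psi> n / 2) x n"
  then obtain b where b: "1 \<le> n" "coprime b (int n)" "\<bar>real n * x - real_of_int b\<bar> < exact_class j \<psi> n / 2" by (auto simp: hits_def)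
  have dv: "2 ^ j dvd n" "\<not> 2 ^ Suc j dvd n"
    using b(3) by (auto simp: exact_class_def split: if_splits)
  then obtain k where k: "n = 2 ^ j * k" by (auto elim: dvdE)
  have oddk: "odd k"
  proof
    assume "even k"
    then obtain l where "k = 2 * l" by (rule evenE)
    then have "n = 2 ^ Suc j * l" using k by simp
    then show False using dv(2) by simp
  qed
  have bk: "coprime b (int k)" using b(2) by (simp add: k)
  define s where "s = (if j = 0 then 0 else int k)"
  have "coprime (2 * b + s) (int n)"
  proof (cases "j = 0")
    case True
    then have "odd n" using k oddk by simp
    then show ?thesis using True b(2) by (simp add: s_def)
  next
    case False
    have "coprime (2 * b + int k * 1) (int k)" using bk oddk by (subst coprime_add_multiple) simp
    moreover have "coprime (2 * b + int k) (2 ^ j)"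
    proof -
      have "odd (2 * b + int k)" using oddk by simp
      then show ?thesis by simp
    qed
    ultimately show ?thesis using False by (simp add: s_def k)
  qed
  moreover have "\<bar>real n * (2 * x + (if j = 0 then 0 else 1 / 2 ^ j)) - real_of_int (2 * b + s)\<bar> < exact_class j \<psi> n"
  proof -
    have "real n * (if j = 0 then 0 else 1 / 2 ^ j) = real_of_int s" by (simp add: s_def k)
    then have "real n * (2 * x + (if j = 0 then 0 else 1 / 2 ^ j)) - real_of_int (2 * b + s) = 2 * (real n * x - real_of_int b)"
      by (simp only: distrib_left of_int_add) simp
    then show ?thesis using b(3) by (simp only: abs_mult) simp
  qed
  ultimately show "hits (exact_class j \<psi>) (2 * x + (if j = 0 then 0 else 1 / 2 ^ j)) n"
    unfolding hits_def using b(1) by blast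
qed

text \<open>The translation changes the numerator by a multiple of \<open>n / 2 ^ j\<close>.
  Divisibility by one more power of 2 makes this quotient divisible by every prime factor of
  \<open>n\<close>, including 2, so coprimality is preserved.\<close>

lemma shift_step:
  assumes "x \<in> circle_limsup (multiple_class (Suc j) \<psi>)"
  shows "x + of_int i / 2 ^ j \<in> circle_limsup (multiple_class (Suc j) \<psi>)"
proof (rule circle_limsup_transfer[OF assms])
  fix n assume h: "hits (multiple_class (Suc j) \<psi>) x n"
  then obtain b where b: "1 \<le> n" "coprime b (int n)" "\<bar>real n * x - real_of_int b\<bar> < multiple_class (Suc j) \<psi> n" by (auto simp: hits_def)
  have "2 ^ Suc j dvd n" using b(3) by (auto simp: multiple_class_def split: if_splits)
  then obtain k where k: "n = 2 ^ j * (2 * k)" by (auto elim!: dvdE simp: mult_ac)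
  define c where "c = b + int (2 * k) * i"
  have "coprime c (int (2 * k))" unfolding c_def coprime_add_multiple using b(2) by (simp add: k)
  moreover from this have "coprime c (2 ^ j)" by simp
  ultimately have "coprime c (int n)" by (simp add: k)
  moreover have "real n * (x + of_int i / 2 ^ j) - real_of_int c = real n * x - real_of_int b"
    by (simp add: c_def k algebra_simps)
  ultimately show "hits (multiple_class (Suc j) \<psi>) (x + of_int i / 2 ^ j) n"
    unfolding hits_def using b(1,3) by metis
qed

section \<open>Measures of slices of periodic sets\<close>

lemma lmeasurable_slice: "A \<in> sets lebesgue \<Longrightarrow> A \<inter> {a..<b::real} \<in> lmeasurable"
  by (rule fmeasurableI2[of "{a..b}"]) auto

lemma measure_shift_slice:
  fixes d :: real
  assumes "\<And>x. x + d \<in> A \<longleftrightarrow> x \<in> A"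
  shows "measure lebesgue (A \<inter> {a + d..<b + d}) = measure lebesgue (A \<inter> {a..<b})"
proof -
  have "A \<inter> {a + d..<b + d} = (+) d ` (A \<inter> {a..<b})"
  proof (intro equalityI subsetI)
    fix x assume x: "x \<in> A \<inter> {a + d..<b + d}"
    then have "x - d \<in> A \<inter> {a..<b}" using assms[of "x - d"] by auto
    then show "x \<in> (+) d ` (A \<inter> {a..<b})" by (rule rev_image_eqI) simp
  next
    fix x assume "x \<in> (+) d ` (A \<inter> {a..<b})"
    then show "x \<in> A \<inter> {a + d..<b + d}" using assms by (auto simp: add.commute)
  qed
  then show ?thesis by (simp only: measure_translation)
qed

lemma measure_slice_split:
  fixes a b c :: real
  assumes A: "A \<in> sets lebesgue" and "a \<le> b" "b \<le> c"
  shows "measure lebesgue (A \<inter> {a..<c}) = measure lebesgue (A \<inter> {a..<b}) + measure lebesgue (A \<inter> {b..<c})"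
proof -
  have "A \<inter> {a..<c} = (A \<inter> {a..<b}) \<union> (A \<inter> {b..<c})" using assms by auto
  moreover have "measure lebesgue ((A \<inter> {a..<b}) \<union> (A \<inter> {b..<c})) = measure lebesgue (A \<inter> {a..<b}) + measure lebesgue (A \<inter> {b..<c})"
  proof -
    have "(A \<inter> {a..<b}) \<inter> (A \<inter> {b..<c}) = {}" by auto
    then show ?thesis
      using measure_Un3[OF lmeasurable_slice[OF A, of a b] lmeasurable_slice[OF A, of b c]] by simp
  qed
  ultimately show ?thesis by simp
qed

lemma measure_unit_slice:
  fixes z :: real
  assumes A: "A \<in> sets lebesgue" and per: "\<And>x k. x + of_int k \<in> A \<longleftrightarrow> x \<in> A"
  shows "measure lebesgue (A \<inter> {z..<z + 1}) = measure lebesgue (A \<inter> {0..<1})"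
proof -
  define t where "t = z - of_int \<lfloor>z\<rfloor>"
  have t: "0 \<le> t" "t \<le> 1" unfolding t_def by linarith+
  have "measure lebesgue (A \<inter> {z..<z + 1}) = measure lebesgue (A \<inter> {t + of_int \<lfloor>z\<rfloor>..<(t + 1) + of_int \<lfloor>z\<rfloor>})"
    by (simp add: t_def)
  also have "\<dots> = measure lebesgue (A \<inter> {t..<t + 1})" by (rule measure_shift_slice[OF per])
  also have "\<dots> = measure lebesgue (A \<inter> {t..<1}) + measure lebesgue (A \<inter> {1..<t + 1})"
    using t by (intro measure_slice_split[OF A]) auto
  also have "measure lebesgue (A \<inter> {1..<t + 1}) = measure lebesgue (A \<inter> {0..<t})"
    using measure_shift_slice[of "of_int 1" A 0 t, OF per] by simp
  also have "measure lebesgue (A \<inter> {t..<1}) + measure lebesgue (A \<inter> {0..<t}) = measure lebesgue (A \<inter> {0..<1})"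
    using measure_slice_split[OF A t] by simp
  finally show ?thesis .
qed

section \<open>Dyadic intervals and invariance\<close>

definition dyadic :: "nat \<Rightarrow> nat \<Rightarrow> real set" where
  "dyadic k i = {real i / 2 ^ k ..< (real i + 1) / 2 ^ k}"

definition dyadic_index :: "nat \<Rightarrow> real \<Rightarrow> nat" where
  "dyadic_index k x = nat \<lfloor>2 ^ k * x\<rfloor>"

lemma mem_dyadic_iff: "0 \<le> x \<Longrightarrow> x \<in> dyadic k i \<longleftrightarrow> dyadic_index k x = i"
proof -
  assume "0 \<le> x"
  then have "0 \<le> \<lfloor>2 ^ k * x\<rfloor>" by simp
  have "x \<in> dyadic k i \<longleftrightarrow> real i \<le> 2 ^ k * x \<and> 2 ^ k * x < real i + 1"
    by (auto simp: dyadic_def field_simps)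
  also have "\<dots> \<longleftrightarrow> \<lfloor>2 ^ k * x\<rfloor> = int i" by (simp add: floor_eq_iff)
  also have "\<dots> \<longleftrightarrow> dyadic_index k x = i" using \<open>0 \<le> \<lfloor>2 ^ k * x\<rfloor>\<close> by (auto simp: dyadic_index_def)
  finally show ?thesis .
qed

lemma dyadic_nonneg: "x \<in> dyadic k i \<Longrightarrow> 0 \<le> x"
proof -
  assume "x \<in> dyadic k i"
  then have "real i / 2 ^ k \<le> x" by (simp add: dyadic_def)
  moreover have "0 \<le> real i / 2 ^ k" by simp
  ultimately show "0 \<le> x" by linarith
qed

lemma dyadic_index_less: "0 \<le> x \<Longrightarrow> x < 1 \<Longrightarrow> dyadic_index k x < 2 ^ k"
proof -
  assume x: "0 \<le> x" "x < 1"
  have "2 ^ k * x < 2 ^ k" using x by simp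
  then have "\<lfloor>2 ^ k * x\<rfloor> < 2 ^ k" by (simp add: floor_less_iff)
  then show ?thesis using x by (simp add: dyadic_index_def nat_less_iff)
qed

lemma dyadic_refine: "0 \<le> x \<Longrightarrow> dyadic (Suc k) (dyadic_index (Suc k) x) \<subseteq> dyadic k (dyadic_index k x)"
proof
  fix y assume x: "0 \<le> x" and y: "y \<in> dyadic (Suc k) (dyadic_index (Suc k) x)"
  have half: "dyadic_index k z = dyadic_index (Suc k) z div 2" for z
  proof -
    have "\<lfloor>2 ^ k * z\<rfloor> = \<lfloor>2 ^ Suc k * z / of_int 2\<rfloor>" by simp
    also have "\<dots> = \<lfloor>2 ^ Suc k * z\<rfloor> div 2" by (rule floor_divide_real_eq_div) simp
    finally show ?thesis by (simp add: dyadic_index_def nat_div_distrib')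
  qed
  have y0: "0 \<le> y" by (rule dyadic_nonneg[OF y])
  then have "dyadic_index (Suc k) y = dyadic_index (Suc k) x" using y mem_dyadic_iff by blast
  then have "dyadic_index k y = dyadic_index k x" by (simp add: half)
  then show "y \<in> dyadic k (dyadic_index k x)" using mem_dyadic_iff y0 by blast
qed

lemma measure_dyadic: "measure lebesgue (dyadic k i) = 1 / 2 ^ k"
proof -
  have "real i / 2 ^ k \<le> (real i + 1) / 2 ^ k" by (intro divide_right_mono) auto
  then have "measure lebesgue (dyadic k i) = (real i + 1) / 2 ^ k - real i / 2 ^ k" by (simp add: dyadic_def)
  then show ?thesis by (simp add: diff_divide_distrib[symmetric])
qed

lemma dyadic_lmeasurable: "dyadic k i \<in> lmeasurable"
  using lmeasurable_slice[of UNIV] by (simp add: dyadic_def)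

text \<open>Inside an open set that approximates \<open>A\<close> from outside, the dyadic intervals carry all of \<open>A\<close>;
  if none of them had more than its share, then \<open>q \<le> q (q + \<epsilon>)\<close>.\<close>

lemma dyadic_zero_one:
  assumes A: "A \<in> sets lebesgue" and q: "0 < measure lebesgue (A \<inter> {0..<1})"
    and H: "\<And>k i. i < 2 ^ k \<Longrightarrow> 2 ^ k * measure lebesgue (A \<inter> dyadic k i) \<le> measure lebesgue (A \<inter> {0..<1})"
  shows "measure lebesgue (A \<inter> {0..<1}) = 1"
proof (rule ccontr)
  define q where "q = measure lebesgue (A \<inter> {0..<1})"
  have A0: "A \<inter> {0..<1} \<in> lmeasurable" by (rule lmeasurable_slice[OF A])
  have "q \<le> measure lebesgue {0..<1::real}" unfolding q_def
    using A0 lmeasurable_slice[of UNIV 0 1] by (intro measure_mono_fmeasurable) auto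
  then have q1: "q \<le> 1" by simp
  assume "measure lebesgue (A \<inter> {0..<1}) \<noteq> 1"
  then have qless: "q < 1" using q1 by (simp add: q_def)
  \<comment> \<open>Half of the gap to 1, so that \<open>q + e < 1\<close> and
    \<open>q \<le> q * (q + e)\<close> is impossible for positive \<open>q\<close>.\<close>
  define e where "e = (1 - q) / 2"
  have e: "0 < e" "q + e < 1" using qless by (auto simp: e_def field_simps)
  obtain T where T: "open T" "A \<inter> {0..<1} \<subseteq> T" "T - A \<inter> {0..<1} \<in> lmeasurable" "emeasure lebesgue (T - A \<inter> {0..<1}) < ennreal e"
    using sets_lebesgue_outer_open[OF fmeasurableD[OF A0] e(1)] by metis
  define V where "V = T \<inter> {0..<1}"
  have Tl: "T \<in> sets lebesgue" using T(1) by auto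
  have V: "V \<in> lmeasurable" unfolding V_def by (rule lmeasurable_slice[OF Tl])
  have AV: "A \<inter> V = A \<inter> {0..<1}" using T(2) by (auto simp: V_def)
  have mV: "measure lebesgue V < q + e"
  proof -
    have "V \<subseteq> (A \<inter> {0..<1}) \<union> (T - A \<inter> {0..<1})" by (auto simp: V_def)
    then have "measure lebesgue V \<le> measure lebesgue ((A \<inter> {0..<1}) \<union> (T - A \<inter> {0..<1}))"
      using V A0 T(3) by (intro measure_mono_fmeasurable fmeasurable.Un) auto
    also have "\<dots> \<le> q + measure lebesgue (T - A \<inter> {0..<1})"
      unfolding q_def using A0 T(3) by (intro measure_Un_le) auto
    also have "measure lebesgue (T - A \<inter> {0..<1}) < e"
      using T(3,4) e(1) by (simp add: emeasure_eq_measure2 ennreal_less_iff)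
    finally show ?thesis by simp
  qed
  define J where "J k = {i. i < 2 ^ k \<and> dyadic k i \<subseteq> V}" for k
  define U where "U k = (\<Union>i\<in>J k. dyadic k i)" for k
  have finJ: "finite (J k)" for k by (simp add: J_def)
  have Uiff: "x \<in> U k \<longleftrightarrow> 0 \<le> x \<and> x < 1 \<and> dyadic k (dyadic_index k x) \<subseteq> V" for x k
  proof
    assume "x \<in> U k"
    then obtain i where i: "i \<in> J k" "x \<in> dyadic k i" by (auto simp: U_def)
    have x0: "0 \<le> x" by (rule dyadic_nonneg[OF i(2)])
    then have "dyadic_index k x = i" using i mem_dyadic_iff by blast
    moreover have "x \<in> V" using i by (auto simp: J_def)
    ultimately show "0 \<le> x \<and> x < 1 \<and> dyadic k (dyadic_index k x) \<subseteq> V" using i x0 by (auto simp: J_def V_def)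
  next
    assume x: "0 \<le> x \<and> x < 1 \<and> dyadic k (dyadic_index k x) \<subseteq> V"
    then have "dyadic_index k x \<in> J k" using dyadic_index_less by (simp add: J_def)
    moreover have "x \<in> dyadic k (dyadic_index k x)" using x mem_dyadic_iff by blast
    ultimately show "x \<in> U k" by (auto simp: U_def)
  qed
  have Ul: "U k \<in> lmeasurable" for k unfolding U_def using finJ dyadic_lmeasurable by (intro fmeasurable.finite_UN) auto
  have bound: "measure lebesgue (A \<inter> U k) \<le> q * (q + e)" for k
  proof -
    have "A \<inter> U k = (\<Union>i\<in>J k. A \<inter> dyadic k i)" by (auto simp: U_def)
    then have "measure lebesgue (A \<inter> U k) \<le> (\<Sum>i\<in>J k. measure lebesgue (A \<inter> dyadic k i))"
      using finJ A dyadic_lmeasurable by (simp only:) (intro measure_UNION_le, auto)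
    also have "\<dots> \<le> (\<Sum>i\<in>J k. q * (1 / 2 ^ k))"
    proof (rule sum_mono)
      fix i assume "i \<in> J k"
      then have "2 ^ k * measure lebesgue (A \<inter> dyadic k i) \<le> q" using H by (simp add: J_def q_def)
      then show "measure lebesgue (A \<inter> dyadic k i) \<le> q * (1 / 2 ^ k)" by (simp add: field_simps)
    qed
    also have "\<dots> = q * (\<Sum>i\<in>J k. measure lebesgue (dyadic k i))" by (simp add: measure_dyadic)
    also have "(\<Sum>i\<in>J k. measure lebesgue (dyadic k i)) = measure lebesgue (U k)"
      unfolding U_def
    proof (rule measure_UNION'[symmetric, OF finJ dyadic_lmeasurable])
      have "dyadic k i \<inter> dyadic k j = {}" if "i \<noteq> j" for i j
      proof (rule ccontr)
        assume "dyadic k i \<inter> dyadic k j \<noteq> {}"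
        then obtain x where x: "x \<in> dyadic k i" "x \<in> dyadic k j" by blast
        then show False using mem_dyadic_iff[OF dyadic_nonneg[OF x(1)]] that by simp
      qed
      then show "pairwise (\<lambda>i j. disjnt (dyadic k i) (dyadic k j)) (J k)" by (auto simp: pairwise_def disjnt_def)
    qed
    also have "q * measure lebesgue (U k) \<le> q * (q + e)"
    proof (intro mult_left_mono)
      have "U k \<subseteq> V" by (auto simp: U_def J_def)
      then have "measure lebesgue (U k) \<le> measure lebesgue V" using Ul V by (intro measure_mono_fmeasurable) auto
      then show "measure lebesgue (U k) \<le> q + e" using mV by simp
    qed (use q in \<open>simp add: q_def\<close>)
    finally show ?thesis .
  qed
  have UV: "(\<Union>k. A \<inter> U k) = A \<inter> V"
  proof (intro equalityI subsetI)
    fix x assume "x \<in> (\<Union>k. A \<inter> U k)"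
    then show "x \<in> A \<inter> V" by (auto simp: U_def J_def)
  next
    fix x assume x: "x \<in> A \<inter> V"
    then have x01: "0 \<le> x" "x < 1" "x \<in> T" by (auto simp: V_def)
    then obtain r where r: "0 < r" "ball x r \<subseteq> T" using T(1) open_contains_ball by blast
    obtain k where k: "(1 / 2) ^ k < r" using real_arch_pow_inv[OF r(1), of "1/2"] by auto
    have "dyadic k (dyadic_index k x) \<subseteq> V"
    proof
      fix y assume y: "y \<in> dyadic k (dyadic_index k x)"
      have xd: "x \<in> dyadic k (dyadic_index k x)" using mem_dyadic_iff[OF x01(1)] by simp
      have "\<bar>x - y\<bar> < 1 / 2 ^ k" using xd y by (auto simp: dyadic_def add_divide_distrib)
      then have "y \<in> T" using r(2) k by (auto simp: dist_real_def power_one_over)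
      moreover have "y < 1"
      proof -
        have "real (dyadic_index k x) + 1 \<le> 2 ^ k"
        proof -
          have "dyadic_index k x + 1 \<le> 2 ^ k" using dyadic_index_less[OF x01(1,2), of k] by simp
          then have "real (dyadic_index k x + 1) \<le> real (2 ^ k)" by (simp only: of_nat_le_iff)
          then show ?thesis by simp
        qed
        then have "(real (dyadic_index k x) + 1) / 2 ^ k \<le> 1" by simp
        moreover have "y < (real (dyadic_index k x) + 1) / 2 ^ k" using y by (simp add: dyadic_def)
        ultimately show ?thesis by linarith
      qed
      ultimately show "y \<in> V" using dyadic_nonneg[OF y] by (simp add: V_def)
    qed
    then show "x \<in> (\<Union>k. A \<inter> U k)" using x x01 Uiff by blast
  qed
  have "(\<lambda>k. measure lebesgue (A \<inter> U k)) \<longlonglongrightarrow> measure lebesgue (\<Union>k. A \<inter> U k)"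
  proof (rule Lim_measure_incseq)
    show "range (\<lambda>k. A \<inter> U k) \<subseteq> sets lebesgue" using A Ul by auto
    have "U k \<subseteq> U (Suc k)" for k
    proof
      fix x assume "x \<in> U k"
      then have "0 \<le> x" "x < 1" "dyadic k (dyadic_index k x) \<subseteq> V" using Uiff by auto
      then show "x \<in> U (Suc k)" using dyadic_refine[of x k] Uiff by (meson order_trans)
    qed
    then show "incseq (\<lambda>k. A \<inter> U k)" by (intro incseq_SucI) blast
    show "emeasure lebesgue (\<Union>k. A \<inter> U k) \<noteq> \<infinity>" unfolding UV AV using fmeasurableD2[OF A0] by simp
  qed
  then have "(\<lambda>k. measure lebesgue (A \<inter> U k)) \<longlonglongrightarrow> q" unfolding UV AV q_def .
  then have "q \<le> q * (q + e)" by (rule LIMSEQ_le_const2) (use bound in auto)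
  also have "\<dots> < q * 1" using e q by (intro mult_strict_left_mono) (auto simp: q_def)
  finally show False by simp
qed

text \<open>The \<open>k\<close>-th iterate stretches a dyadic interval of level \<open>k\<close> by
  \<open>2 ^ k\<close> onto an interval of length 1 and sends points of \<open>A\<close> into
  \<open>A\<close>. By periodicity the target carries as much of \<open>A\<close> as the unit
  interval, so no dyadic interval has more than its share.\<close>

lemma expanding_full_measure:
  fixes c :: real
  assumes A: "A \<in> sets lebesgue" and per: "\<And>x k. x + of_int k \<in> A \<longleftrightarrow> x \<in> A"
    and exp: "\<And>x. x \<in> A \<Longrightarrow> 2 * x + c \<in> A" and pos: "0 < measure lebesgue (A \<inter> {0..<1})"
  shows "measure lebesgue (A \<inter> {0..<1}) = 1"
proof (rule dyadic_zero_one[OF A pos])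
  fix k i :: nat
  obtain d where d: "\<And>x. x \<in> A \<Longrightarrow> 2 ^ k * x + d \<in> A"
  proof -
    have "\<exists>d. \<forall>x\<in>A. 2 ^ k * x + d \<in> A"
    proof (induction k)
      case 0
      show ?case by (intro exI[of _ 0]) simp
    next
      case (Suc k)
      then obtain d where "\<forall>x\<in>A. 2 ^ k * x + d \<in> A" by blast
      then have "\<forall>x\<in>A. 2 * (2 ^ k * x + d) + c \<in> A" using exp by blast
      then show ?case by (intro exI[of _ "2 * d + c"]) (simp add: algebra_simps)
    qed
    then show thesis using that by blast
  qed
  define z where "z = real i + d"
  let ?T = "\<lambda>x::real. 2 ^ k *\<^sub>R x + d"
  have D: "A \<inter> dyadic k i \<in> lmeasurable" unfolding dyadic_def by (rule lmeasurable_slice[OF A])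
  have Z: "A \<inter> {z..<z + 1} \<in> lmeasurable" by (rule lmeasurable_slice[OF A])
  have "?T ` (A \<inter> dyadic k i) \<subseteq> A \<inter> {z..<z + 1}"
    using d by (auto simp: dyadic_def z_def field_simps)
  then have "emeasure lebesgue (?T ` (A \<inter> dyadic k i)) \<le> emeasure lebesgue (A \<inter> {z..<z + 1})"
    using Z by (intro emeasure_mono) auto
  then have "ennreal (2 ^ k) * emeasure lebesgue (A \<inter> dyadic k i) \<le> emeasure lebesgue (A \<inter> {z..<z + 1})"
    using emeasure_lebesgue_affine[of "2 ^ k" d "A \<inter> dyadic k i"] by (simp del: emeasure_completion)
  then have "ennreal (2 ^ k * measure lebesgue (A \<inter> dyadic k i)) \<le> ennreal (measure lebesgue (A \<inter> {z..<z + 1}))"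
    by (simp only: emeasure_eq_measure2[OF D] emeasure_eq_measure2[OF Z] ennreal_mult zero_le_power zero_le_numeral measure_nonneg)
  then have "2 ^ k * measure lebesgue (A \<inter> dyadic k i) \<le> measure lebesgue (A \<inter> {z..<z + 1})" by simp
  also have "\<dots> = measure lebesgue (A \<inter> {0..<1})" by (rule measure_unit_slice[OF A per])
  finally show "2 ^ k * measure lebesgue (A \<inter> dyadic k i) \<le> measure lebesgue (A \<inter> {0..<1})" .
qed

text \<open>Dyadic intervals of the same level are translates of each other and therefore all carry
  the same part of \<open>A\<close>.\<close>

lemma shift_invariant_full_measure:
  fixes A :: "real set"
  assumes A: "A \<in> sets lebesgue" and shift: "\<And>x i k. x + of_int i / 2 ^ k \<in> A \<longleftrightarrow> x \<in> A"
    and pos: "0 < measure lebesgue (A \<inter> {0..<1})"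
  shows "measure lebesgue (A \<inter> {0..<1}) = 1"
proof (rule dyadic_zero_one[OF A pos])
  fix k i :: nat
  have eq: "measure lebesgue (A \<inter> dyadic k j) = measure lebesgue (A \<inter> dyadic k i)" for j
  proof -
    define t where "t = (of_int (int j - int i) / 2 ^ k :: real)"
    have "real j / 2 ^ k = real i / 2 ^ k + t" "(real j + 1) / 2 ^ k = (real i + 1) / 2 ^ k + t"
      unfolding t_def by (simp_all add: add_divide_distrib[symmetric])
    moreover have "x + t \<in> A \<longleftrightarrow> x \<in> A" for x unfolding t_def by (rule shift)
    ultimately show ?thesis unfolding dyadic_def by (simp only: measure_shift_slice)
  qed
  have "2 ^ k * measure lebesgue (A \<inter> dyadic k i) = (\<Sum>j<(2::nat) ^ k. measure lebesgue (A \<inter> dyadic k i))" by simp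
  also have "\<dots> = (\<Sum>j<2 ^ k. measure lebesgue (A \<inter> dyadic k j))" by (intro sum.cong refl eq[symmetric])
  also have "\<dots> = measure lebesgue (\<Union>j<2 ^ k. A \<inter> dyadic k j)"
  proof (rule measure_UNION'[symmetric])
    show "A \<inter> dyadic k j \<in> lmeasurable" for j unfolding dyadic_def by (rule lmeasurable_slice[OF A])
    have "dyadic k j \<inter> dyadic k l = {}" if "j \<noteq> l" for j l
    proof (rule ccontr)
      assume "dyadic k j \<inter> dyadic k l \<noteq> {}"
      then obtain x where x: "x \<in> dyadic k j" "x \<in> dyadic k l" by blast
      then show False using mem_dyadic_iff[OF dyadic_nonneg[OF x(1)]] that by simp
    qed
    then show "pairwise (\<lambda>j l. disjnt (A \<inter> dyadic k j) (A \<inter> dyadic k l)) {..<2 ^ k}"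
      by (fastforce simp: pairwise_def disjnt_def)
  qed simp
  also have "\<dots> \<le> measure lebesgue (A \<inter> {0..<1})"
  proof (rule measure_mono_fmeasurable)
    show "(\<Union>j<2 ^ k. A \<inter> dyadic k j) \<subseteq> A \<inter> {0..<1}"
    proof
      fix x assume "x \<in> (\<Union>j<2 ^ k. A \<inter> dyadic k j)"
      then obtain j where j: "j < 2 ^ k" "x \<in> A" "x \<in> dyadic k j" by auto
      have "real (j + 1) \<le> real (2 ^ k)" using j(1) by (simp only: of_nat_le_iff)
      then have "(real j + 1) / 2 ^ k \<le> 1" by simp
      moreover have "x < (real j + 1) / 2 ^ k" using j(3) by (simp add: dyadic_def)
      ultimately have "x < 1" by linarith
      then show "x \<in> A \<inter> {0..<1}" using j(2) dyadic_nonneg[OF j(3)] by simp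
    qed
    show "(\<Union>j<2 ^ k. A \<inter> dyadic k j) \<in> sets lebesgue" using A dyadic_lmeasurable by auto
    show "A \<inter> {0..<1} \<in> lmeasurable" by (rule lmeasurable_slice[OF A])
  qed
  finally show "2 ^ k * measure lebesgue (A \<inter> dyadic k i) \<le> measure lebesgue (A \<inter> {0..<1})" .
qed

lemma circle_limsup_lebesgue: "circle_limsup \<psi> \<in> sets lebesgue"
  using circle_limsup_borel by simp

text \<open>Continuity from above within the unit interval, where measures are finite; the endpoint
  1 is a null set and is dropped to match the half-open slices.\<close>

lemma decreasing_intersection_positive:
  fixes A :: "nat \<Rightarrow> real set"
  assumes A: "\<And>n. A n \<in> sets borel" and dec: "\<And>n. A (Suc n) \<subseteq> A n" and c: "0 < c"
    and ge: "\<And>n. ennreal c \<le> emeasure lborel (A n \<inter> {0..1})"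
  shows "0 < measure lebesgue ((\<Inter>n. A n) \<inter> {0..<1})"
proof -
  have fin: "emeasure lborel (A n \<inter> {0..1}) \<noteq> \<infinity>" for n
  proof -
    have "emeasure lborel (A n \<inter> {0..1}) \<le> emeasure lborel {0..1::real}" by (intro emeasure_mono) auto
    then show ?thesis by (auto simp: top_unique)
  qed
  define I where "I = (\<Inter>n. A n)"
  have I: "I \<in> sets borel" unfolding I_def using A by auto
  have "ennreal c \<le> (INF n. emeasure lborel (A n \<inter> {0..1}))" by (intro INF_greatest ge)
  also have "\<dots> = emeasure lborel (\<Inter>n. A n \<inter> {0..1})"
  proof (rule INF_emeasure_decseq[OF _ _ fin])
    show "range (\<lambda>n. A n \<inter> {0..1}) \<subseteq> sets lborel" using A by auto
    show "decseq (\<lambda>n. A n \<inter> {0..1})" using dec by (intro decseq_SucI) blast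
  qed
  also have "(\<Inter>n. A n \<inter> {0..1}) = I \<inter> {0..1}" by (auto simp: I_def)
  also have "emeasure lborel (I \<inter> {0..1}) \<le> emeasure lborel (I \<inter> {0..<1}) + emeasure lborel {1::real}"
  proof -
    have "emeasure lborel (I \<inter> {0..1}) \<le> emeasure lborel ((I \<inter> {0..<1}) \<union> {1})" using I by (intro emeasure_mono) auto
    also have "\<dots> \<le> emeasure lborel (I \<inter> {0..<1}) + emeasure lborel {1::real}"
      by (rule emeasure_subadditive) (use I in auto)
    finally show ?thesis .
  qed
  also have "\<dots> = emeasure lebesgue (I \<inter> {0..<1})" using I by simp
  also have "\<dots> = ennreal (measure lebesgue (I \<inter> {0..<1}))"
    using I by (intro emeasure_eq_measure2 lmeasurable_slice) auto
  finally have "c \<le> measure lebesgue (I \<inter> {0..<1})" using c by (simp add: ennreal_le_iff2)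
  then show ?thesis using c by (simp add: I_def)
qed

lemma psi_mass_cmult: "psi_mass (\<lambda>n. c * \<psi> n) n = c * psi_mass \<psi> n"
  by (simp add: psi_mass_def)

lemma psi_mass_multiple_class: "psi_mass (multiple_class j \<psi>) n = psi_mass (exact_class j \<psi>) n + psi_mass (multiple_class (Suc j) \<psi>) n"
proof -
  have "2 ^ j dvd n" if "2 ^ Suc j dvd n" using that by (rule dvd_trans[rotated]) simp
  then show ?thesis by (auto simp: psi_mass_def multiple_class_def exact_class_def)
qed

theorem duffin_schaeffer:
  assumes nn: "\<And>n. 1 \<le> n \<Longrightarrow> 0 \<le> \<psi> n" and ns: "\<not> summable (psi_mass \<psi>)"
  shows "measure lebesgue (circle_limsup \<psi> \<inter> {0..<1}) = 1"
proof -
  obtain c where c: "0 < c"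
    "\<And>\<psi>. (\<And>n. 1 \<le> n \<Longrightarrow> 0 \<le> \<psi> n) \<Longrightarrow> \<not> summable (psi_mass \<psi>) \<Longrightarrow> ennreal c \<le> emeasure lborel (circle_limsup \<psi> \<inter> {0..1})"
    using circle_limsup_positive by blast
  have "\<exists>A\<subseteq>circle_limsup \<psi>. A \<in> sets lebesgue \<and> measure lebesgue (A \<inter> {0..<1}) = 1"
  proof (cases "\<exists>j. \<not> summable (psi_mass (exact_class j \<psi>))")
    case True
    then obtain j where j: "\<not> summable (psi_mass (exact_class j \<psi>))" by blast
    define \<theta> where "\<theta> \<nu> n = 1 / 2 ^ \<nu> * \<psi> n" for \<nu> n
    define A where "A \<nu> = circle_limsup (exact_class j (\<theta> \<nu>))" for \<nu>
    have half: "exact_class j (\<theta> (Suc \<nu>)) = (\<lambda>n. exact_class j (\<theta> \<nu>) n / 2)" for \<nu>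
      by (auto simp: \<theta>_def exact_class_def)
    have nnc: "0 \<le> exact_class j (\<theta> \<nu>) n" if "1 \<le> n" for \<nu> n
      using nn[OF that] by (simp add: \<theta>_def exact_class_def)
    have scale: "exact_class j (\<theta> \<nu>) = (\<lambda>n. 1 / 2 ^ \<nu> * exact_class j \<psi> n)" for \<nu>
      by (auto simp: \<theta>_def exact_class_def)
    have nsc: "\<not> summable (psi_mass (exact_class j (\<theta> \<nu>)))" for \<nu>
    proof
      assume "summable (psi_mass (exact_class j (\<theta> \<nu>)))"
      then have "summable (\<lambda>n. 1 / 2 ^ \<nu> * psi_mass (exact_class j \<psi>) n)"
        unfolding scale psi_mass_cmult[abs_def] .
      then show False using j by (simp add: summable_cmult_iff)
    qed
    \<comment> \<open>The doubling map leads from scale \<open>Suc \<nu>\<close> to scale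
      \<open>\<nu>\<close>; the intersection over all scales is mapped into itself.\<close>
    define I where "I = (\<Inter>\<nu>. A \<nu>)"
    have I: "I \<in> sets lebesgue" unfolding I_def A_def using circle_limsup_lebesgue by auto
    have pos: "0 < measure lebesgue (I \<inter> {0..<1})"
      unfolding I_def
    proof (rule decreasing_intersection_positive[where A = A, OF _ _ c(1)])
      show "A \<nu> \<in> sets borel" for \<nu> unfolding A_def by (rule circle_limsup_borel)
      show "A (Suc \<nu>) \<subseteq> A \<nu>" for \<nu> unfolding A_def half
      proof (rule circle_limsup_mono)
        fix n :: nat assume "1 \<le> n"
        then show "exact_class j (\<theta> \<nu>) n / 2 \<le> exact_class j (\<theta> \<nu>) n" using nnc[of n \<nu>] by simp
      qed
      show "ennreal c \<le> emeasure lborel (A \<nu> \<inter> {0..1})" for \<nu> unfolding A_def by (rule c(2)[OF nnc nsc])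
    qed
    have "measure lebesgue (I \<inter> {0..<1}) = 1"
    proof (rule expanding_full_measure[OF I _ _ pos])
      show "x + of_int k \<in> I \<longleftrightarrow> x \<in> I" for x k by (simp add: I_def A_def circle_limsup_periodic)
      fix x assume x: "x \<in> I"
      have "2 * x + (if j = 0 then 0 else 1 / 2 ^ j) \<in> A \<nu>" for \<nu>
        unfolding A_def by (rule doubling_step) (use x in \<open>auto simp: I_def A_def half[symmetric]\<close>)
      then show "2 * x + (if j = 0 then 0 else 1 / 2 ^ j) \<in> I" by (simp add: I_def)
    qed
    moreover have "I \<subseteq> circle_limsup \<psi>"
    proof -
      have "A 0 \<subseteq> circle_limsup \<psi>" unfolding A_def
        by (rule circle_limsup_mono) (use nn in \<open>auto simp: exact_class_def \<theta>_def\<close>)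
      then show ?thesis by (auto simp: I_def)
    qed
    ultimately show ?thesis using I by blast
  next
    case False
    then have se: "summable (psi_mass (exact_class j \<psi>))" for j by blast
    define A where "A j = circle_limsup (multiple_class j \<psi>)" for j
    have nsc: "\<not> summable (psi_mass (multiple_class j \<psi>))" for j
    proof (induction j)
      case 0
      show ?case using ns by (simp add: multiple_class_def[abs_def])
    next
      case (Suc j)
      show ?case
      proof
        assume "summable (psi_mass (multiple_class (Suc j) \<psi>))"
        then have "summable (\<lambda>n. psi_mass (exact_class j \<psi>) n + psi_mass (multiple_class (Suc j) \<psi>) n)"
          by (intro summable_add se)
        then show False using Suc by (simp add: psi_mass_multiple_class[symmetric])
      qed
    qed
    have nnc: "0 \<le> multiple_class j \<psi> n" if "1 \<le> n" for j n
      using nn[OF that] by (simp add: multiple_class_def)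
    define I where "I = (\<Inter>j. A j)"
    have I: "I \<in> sets lebesgue" unfolding I_def A_def using circle_limsup_lebesgue by auto
    have dec: "A (Suc j) \<subseteq> A j" for j unfolding A_def
    proof (rule circle_limsup_mono)
      fix n :: nat assume n: "1 \<le> n"
      have "2 ^ j dvd n" if "2 ^ Suc j dvd n" using that by (rule dvd_trans[rotated]) simp
      then show "multiple_class (Suc j) \<psi> n \<le> multiple_class j \<psi> n" using nn[OF n] by (auto simp: multiple_class_def)
    qed
    have pos: "0 < measure lebesgue (I \<inter> {0..<1})"
      unfolding I_def
    proof (rule decreasing_intersection_positive[where A = A, OF _ dec c(1)])
      show "A j \<in> sets borel" for j unfolding A_def by (rule circle_limsup_borel)
      show "ennreal c \<le> emeasure lborel (A j \<inter> {0..1})" for j unfolding A_def by (rule c(2)[OF nnc nsc])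
    qed
    have antimono: "A l \<subseteq> A j" if "j \<le> l" for j l using decseqD[OF decseq_SucI[of A, OF dec] that] .
    have shift1: "x + of_int i / 2 ^ k \<in> I" if x: "x \<in> I" for x i k
    proof -
      have "x + of_int i / 2 ^ k \<in> A j" for j
      proof -
        \<comment> \<open>Rewriting \<open>i / 2 ^ k\<close> with denominator \<open>2 ^ l\<close>
          gives a translation that preserves \<open>A (Suc l)\<close>, a subset of
          \<open>A j\<close>.\<close>
        define l where "l = max j k"
        have "x \<in> A (Suc l)" using x by (simp add: I_def)
        then have "x + of_int (i * 2 ^ (l - k)) / 2 ^ l \<in> A (Suc l)" unfolding A_def by (rule shift_step)
        moreover have "of_int (i * 2 ^ (l - k)) / 2 ^ l = (of_int i / 2 ^ k :: real)"
        proof -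
          have "(2::real) ^ l = 2 ^ k * 2 ^ (l - k)" by (simp add: l_def flip: power_add)
          then show ?thesis by simp
        qed
        moreover have "A (Suc l) \<subseteq> A j" by (rule antimono) (simp add: l_def)
        ultimately show ?thesis by auto
      qed
      then show ?thesis by (simp add: I_def)
    qed
    have "measure lebesgue (I \<inter> {0..<1}) = 1"
    proof (rule shift_invariant_full_measure[OF I _ pos])
      fix x i k
      show "x + of_int i / 2 ^ k \<in> I \<longleftrightarrow> x \<in> I"
      proof
        assume "x + of_int i / 2 ^ k \<in> I"
        then have "(x + of_int i / 2 ^ k) + of_int (- i) / 2 ^ k \<in> I" by (rule shift1)
        then show "x \<in> I" by simp
      qed (rule shift1)
    qed
    moreover have "I \<subseteq> circle_limsup \<psi>"
    proof -
      have "A 0 = circle_limsup \<psi>" by (simp add: A_def multiple_class_def[abs_def])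
      then show ?thesis by (auto simp: I_def)
    qed
    ultimately show ?thesis using I by blast
  qed
  then obtain A where A: "A \<subseteq> circle_limsup \<psi>" "A \<in> sets lebesgue" "measure lebesgue (A \<inter> {0..<1}) = 1" by blast
  have "measure lebesgue (A \<inter> {0..<1}) \<le> measure lebesgue (circle_limsup \<psi> \<inter> {0..<1})"
    using A(1) fmeasurableD[OF lmeasurable_slice[OF A(2)]] lmeasurable_slice[OF circle_limsup_lebesgue]
    by (intro measure_mono_fmeasurable) auto
  moreover have "measure lebesgue (circle_limsup \<psi> \<inter> {0..<1}) \<le> measure lebesgue {0..<1::real}"
    using fmeasurableD[OF lmeasurable_slice[OF circle_limsup_lebesgue]] lmeasurable_slice[of UNIV 0 1]
    by (intro measure_mono_fmeasurable) auto
  ultimately show ?thesis using A(3) by simp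
qed

theorem theorem2:
  fixes \<psi> :: "nat \<Rightarrow> real"
  assumes nonneg: "\<And>n. n \<ge> 1 \<Longrightarrow> \<psi> n \<ge> 0"
    and diverges:
      "filterlim (\<lambda>N. \<Sum>n = 1..N. \<psi> n * real (totient n) / real n) at_top sequentially"
    and extra:
      "\<exists>\<eta>::real. \<eta> > 0 \<and> (\<exists>C::real. C > 0 \<and> (\<forall>h::nat. h \<ge> 1 \<longrightarrow>
         (\<Sum>n \<in> dyadic_block \<eta> h. \<psi> n * real (totient n) / real n)
           \<le> C * (1 / tlog (tlog (real h)))))"
  shows "emeasure lebesgue (approx_limsup \<psi>) = 1"
proof -
  have "\<not> summable (psi_mass \<psi>)"
  proof
    assume s: "summable (psi_mass \<psi>)"
    \<comment> \<open>At \<open>n = 0\<close>, where nothing is known about \<open>\<psi>\<close>,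
      division by zero makes the mass 0.\<close>
    have mass0: "0 \<le> psi_mass \<psi> n" for n using nonneg[of n] by (cases "n = 0") (auto simp: psi_mass_def)
    have "eventually (\<lambda>N. suminf (psi_mass \<psi>) + 1 \<le> (\<Sum>n = 1..N. psi_mass \<psi> n)) sequentially"
      using diverges unfolding filterlim_at_top psi_mass_def[symmetric] by blast
    then obtain N where "suminf (psi_mass \<psi>) + 1 \<le> (\<Sum>n = 1..N. psi_mass \<psi> n)"
      unfolding eventually_sequentially by blast
    moreover have "(\<Sum>n = 1..N. psi_mass \<psi> n) \<le> suminf (psi_mass \<psi>)" using mass0 by (intro sum_le_suminf s) auto
    ultimately show False by linarith
  qed
  then have one: "measure lebesgue (circle_limsup \<psi> \<inter> {0..<1}) = 1" using nonneg by (intro duffin_schaeffer) auto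
  have lim: "approx_limsup \<psi> = circle_limsup \<psi> \<inter> {0..1}" by (auto simp: approx_limsup_def circle_limsup_def)
  have S: "circle_limsup \<psi> \<inter> {0..<1} \<in> lmeasurable" by (rule lmeasurable_slice[OF circle_limsup_lebesgue])
  have "1 = emeasure lebesgue (circle_limsup \<psi> \<inter> {0..<1})"
    using emeasure_eq_measure2[OF S] one by simp
  also have "\<dots> \<le> emeasure lebesgue (approx_limsup \<psi>)"
    unfolding lim using circle_limsup_lebesgue by (intro emeasure_mono) auto
  finally have "1 \<le> emeasure lebesgue (approx_limsup \<psi>)" .
  moreover have "emeasure lebesgue (approx_limsup \<psi>) \<le> emeasure lebesgue {0..1::real}"
    unfolding lim by (intro emeasure_mono) auto
  ultimately show ?thesis by simp
qed

end
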